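(* Let $X$ be a set, let $\Psi$ be a collection of test functions on $X$, and let $x_0\in X$ satisfy $E(x_0)=0$ in $C_b(\Psi)$ (i.e. $\psi(x_0)=0$ for every $\psi\in\Psi$). Let $\mathcal{E}$ be a Hilbert space, let $\theta\in\mathcal{SA}_{\Psi}(\mathcal{E})$ and put $A=\theta(x_0)$. Then the following are equivalent. (i) There exist $\psi_1,\psi_2\in\mathcal{SA}_{\Psi}(\mathcal{E})$ such that $\theta(x)=\psi_1(x)\psi_2(x)$ for all $x\in X$. (ii) There exist Hilbert spaces $\mathcal{H}_1,\mathcal{H}_2$, a reducible unital $*$-representation $\rho:C_b(\Psi)\to\mathcal{B}(\mathcal{H}_1\oplus\mathcal{H}_2)$, an isometry $$U=\begin{bmatrix}A&B_1&B_2\\ C_1&D_1&D_2\\ C_2&0&D_3\end{bmatrix}:\mathcal{E}\oplus(\mathcal{H}_1\oplus\mathcal{H}_2)\to\mathcal{E}\oplus(\mathcal{H}_1\oplus\mathcal{H}_2),$$ and operators $A_1,A_2\in\mathcal{B}(\mathcal{E})$, $X_1\in\mathcal{B}(\mathcal{E},\mathcal{H}_1)$, $Y_2\in\mathcal{B}(\mathcal{H}_2,\mathcal{E})$ such that $$A=A_1A_2,\quad B_2=A_1Y_2,\quad C_1=X_1A_2,\quad D_2=X_1Y_2,\quad A_1^*A_1+X_1^*X_1=I_{\mathcal{E}},$$ $$A_2^*\ \text{is injective on}\ \operatorname{Range}(A_1^*B_1+X_1^*D_1),$$ and, for all $x\in X$, $$\theta(x)=A+\begin{bmatrix}B_1&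B_2\end{bmatrix}\rho(E(x))\left(I_{\mathcal{H}_1\oplus\mathcal{H}_2}-\begin{bmatrix}D_1&D_2\\0&D_3\end{bmatrix}\rho(E(x))\right)^{-1}\begin{bmatrix}C_1\\C_2\end{bmatrix}.$$
   Context: All Hilbert spaces are complex; $\mathcal{B}(\mathcal{H})$ denotes the bounded linear operators on $\mathcal{H}$, and $\mathcal{B}(\mathcal{H},\mathcal{K})$ those from $\mathcal{H}$ to $\mathcal{K}$. Test functions. A collection $\Psi$ of $\mathbb{C}$-valued functions on a set $X$ is called a set of test functions if (1) $\sup_{\psi\in\Psi}|\psi(x)|<1$ for all $x\in X$; and (2) for each finite subset $\Lambda\subseteq X$, the collection $\{\psi|_\Lambda:\psi\in\Psi\}$ together with the constant functions generates the algebra of all $\mathbb{C}$-valued functions on $\Lambda$. $\Psi$ carries the subspace topology from the space of bounded functions $X\to\overline{\mathbb{D}}$ with the topology of pointwise convergence. $C_b(\Psi)$ is the ($C^*$-)algebra of bounded continuous complex functions on $\Psi$ with pointwise operations (and supremum norm). The map $E:X\to C_b(\Psi)$ is $E(x)(\psi)=\psi(x)$ for $\psi\in\Psi$. Positive kernels. A function $K:X\times X\to\mathcal{B}(\mathcal{F})$, $\mathcal{F}$ a Hilbert space, is a positive kernel if $\sum_{i,j=1}^N\langle K(x_i,x_j)h_i,h_j\rangle\ge 0$ for all $N$, $x_1,\dots,x_N\in X$, $h_1,\dots,h_N\in\mathcal{F}$. Admissible kernels. A $\mathcal{B}(\mathcal{F})$-valued (positive) kernel $S$ on $X$ is $\Psi$-admissible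 if for every $\psi\in\Psi$ the multiplication map $M_\psi: h\mapsto\psi\cdot h$ is a contraction on the reproducing kernel Hilbert space $\mathcal{H}_S$ of $S$, that is, if $(x,y)\mapsto(1-\psi(x)\overline{\psi(y)})S(x,y)$ is a positive kernel for every $\psi\in\Psi$. Let $\mathcal{K}_\Psi(\mathcal{F})$ be the collection of all $\mathcal{B}(\mathcal{F})$-valued $\Psi$-admissible kernels on $X$. $\Psi$-Schur-Agler class. For a Hilbert space $\mathcal{E}$, a function $f:X\to\mathcal{B}(\mathcal{E})$ is in $H^\infty_\Psi(\mathcal{E})$ if there is a constant $C\ge 0$ such that the $\mathcal{B}(\mathcal{E}\otimes\mathcal{E})$-valued function $(x,y)\mapsto (C^2 I_{\mathcal{E}}-f(y)^*f(x))\otimes S(x,y)$ is a positive kernel for all $S\in\mathcal{K}_\Psi(\mathcal{E})$; $C_f$ is the infimum of all such $C$. The $\Psi$-Schur-Agler class $\mathcal{SA}_\Psi(\mathcal{E})$ is the set of $f\in H^\infty_\Psi(\mathcal{E})$ with $C_f\le 1$. Reducible representation. For Hilbert spaces $\mathcal{H}_1,\mathcal{H}_2$, a unital $*$-representation $\rho:C_b(\Psi)\to\mathcal{B}(\mathcal{H}_1\oplus\mathcal{H}_2)$ is called reducible if $\rho(g)(\mathcal{H}_j)\subseteq\mathcal{H}_j$ for $j=1,2$ and all $g\in C_b(\Psi)$. *)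

theory Defs
  imports "HOL-Analysis.Analysis" "HOL-Library.Nonpos_Ints"
begin

subsection \<open>Complex Hilbert spaces\<close>

text \<open>Inner products are linear in the first argument.\<close>

class chilbert = real_inner + complete_space +
  fixes scaleC :: "complex \<Rightarrow> 'a \<Rightarrow> 'a" (infixr \<open>*\<^sub>C\<close> 75)
    and cinner :: "'a \<Rightarrow> 'a \<Rightarrow> complex"
  assumes scaleC_add_right: "c *\<^sub>C (x + y) = c *\<^sub>C x + c *\<^sub>C y"
    and scaleC_add_left: "(c + d) *\<^sub>C x = c *\<^sub>C x + d *\<^sub>C x"
    and scaleC_scaleC: "c *\<^sub>C d *\<^sub>C x = (c * d) *\<^sub>C x"
    and scaleR_scaleC: "r *\<^sub>R x = complex_of_real r *\<^sub>C x"
    and cinner_commute: "cinner x y = cnj (cinner y x)"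
    and cinner_add_left: "cinner (x + y) z = cinner x z + cinner y z"
    and cinner_scaleC_left: "cinner (c *\<^sub>C x) y = c * cinner x y"
    and inner_cinner: "inner x y = Re (cinner x y)"

instantiation prod :: (chilbert, chilbert) chilbert
begin

definition scaleC_prod :: "complex \<Rightarrow> 'a \<times> 'b \<Rightarrow> 'a \<times> 'b"
  where "c *\<^sub>C p = (c *\<^sub>C fst p, c *\<^sub>C snd p)"

definition cinner_prod :: "'a \<times> 'b \<Rightarrow> 'a \<times> 'b \<Rightarrow> complex"
  where "cinner p q = cinner (fst p) (fst q) + cinner (snd p) (snd q)"

instance
proof
  fix p q :: "'a \<times> 'b"
  show "cinner p q = cnj (cinner q p)"
    unfolding cinner_prod_def complex_cnj_add
    by (metis cinner_commute)
qed (simp_all add: scaleC_prod_def cinner_prod_def prod_eq_iff scaleC_add_right scaleC_add_left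
      scaleC_scaleC scaleR_scaleC cinner_add_left cinner_scaleC_left inner_prod_def inner_cinner
      distrib_left)

end


subsection \<open>The Hilbert space of a scalar positive definite kernel\<close>

text \<open>
  For a positive definite kernel \<open>pdk\<close> on \<open>'a\<close>, the type \<open>'a rkhs\<close> constructed below is the completion
  of the space of formal combinations \<open>\<Sum>c\<^sub>i x\<^sub>i\<close> (kept as lists of pairs) with semi-inner product
  \<open>\<langle>\<Sum>c\<^sub>i x\<^sub>i, \<Sum>d\<^sub>j y\<^sub>j\<rangle> = \<Sum>c\<^sub>i cnj(d\<^sub>j) pdk x\<^sub>i y\<^sub>j\<close>. An element is the function
  \<open>y \<mapsto> lim \<langle>u\<^sub>n, y\<rangle>\<close> of a Cauchy sequence \<open>u\<close> of combinations. The kernel functions \<open>kvec x\<close> have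
  inner products \<open>pdk x y\<close> and dense linear span (lemmas \<open>cinner_kvec\<close> and \<open>kvec_total\<close>). It yields
  both Hilbert tensor products and the spaces \<open>\<ell>\<^sup>2(I)\<close>.
\<close>

class pd_kernel =
  fixes pdk :: "'a \<Rightarrow> 'a \<Rightarrow> complex"
  assumes pdk_commute: "pdk y x = cnj (pdk x y)"
    and pdk_nonneg: "0 \<le> Re (\<Sum>(c, x)\<leftarrow>us. \<Sum>(d, y)\<leftarrow>us. c * cnj d * pdk x y)"

definition kform :: "(complex \<times> 'a::pd_kernel) list \<Rightarrow> (complex \<times> 'a) list \<Rightarrow> complex"
  where "kform us vs = (\<Sum>(c, x)\<leftarrow>us. \<Sum>(d, y)\<leftarrow>vs. c * cnj d * pdk x y)"

definition kscale :: "complex \<Rightarrow> (complex \<times> 'a) list \<Rightarrow> (complex \<times> 'a) list"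
  where "kscale c us = map (\<lambda>(d, x). (c * d, x)) us"

abbreviation kdiff :: "(complex \<times> 'a) list \<Rightarrow> (complex \<times> 'a) list \<Rightarrow> (complex \<times> 'a) list"
  where "kdiff us vs \<equiv> us @ kscale (-1) vs"

definition knorm :: "(complex \<times> 'a::pd_kernel) list \<Rightarrow> real"
  where "knorm us = sqrt (Re (kform us us))"

lemma kform_append_left: "kform (us @ us') vs = kform us vs + kform us' vs"
  by (simp add: kform_def)

lemma kform_append_right: "kform us (vs @ vs') = kform us vs + kform us vs'"
  unfolding kform_def by (induction us) (auto simp: algebra_simps)

lemma kform_scale_left: "kform (kscale c us) vs = c * kform us vs"
proof -
  have *: "(\<Sum>(d, y)\<leftarrow>vs. c * a * cnj d * pdk x y) = c * (\<Sum>(d, y)\<leftarrow>vs. a * cnj d * pdk x y)" for a x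
    by (induction vs) (auto simp: distrib_left mult.assoc)
  show ?thesis
    unfolding kform_def kscale_def
    by (induction us) (auto simp: * distrib_left)
qed

lemma kform_Nil [simp]: "kform [] vs = 0" "kform us [] = 0"
  unfolding kform_def by (induction us) auto

lemma kform_Cons_left: "kform (p # us) vs = kform [p] vs + kform us vs"
  using kform_append_left[of "[p]" us vs] by simp

lemma kform_Cons_right: "kform us (p # vs) = kform us [p] + kform us vs"
  using kform_append_right[of us "[p]" vs] by simp

lemma kform_commute: "kform us vs = cnj (kform vs us)"
proof (induction us)
  case Nil
  show ?case by simp
next
  case (Cons p us)
  have "kform [p] vs = cnj (kform vs [p])"
  proof (induction vs)
    case (Cons q vs)
    have "kform [p] [q] = cnj (kform [q] [p])"
      by (cases p; cases q) (simp add: kform_def mult_ac pdk_commute[symmetric])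
    then show ?case
      using Cons kform_Cons_right[of "[p]" q vs] kform_Cons_left[of q vs "[p]"] by simp
  qed simp
  then show ?case
    using Cons kform_Cons_left[of p us vs] kform_Cons_right[of vs p us] by simp
qed

lemma kform_scale_right: "kform us (kscale c vs) = cnj c * kform us vs"
  using kform_scale_left[of c vs us] kform_commute[of us "kscale c vs"] kform_commute[of us vs]
  by simp

lemmas kform_simps =
  kform_append_left kform_append_right kform_scale_left kform_scale_right

lemma kform_nonneg: "0 \<le> Re (kform us us)"
  unfolding kform_def by (rule pdk_nonneg)

lemma kform_Im [simp]: "Im (kform us us) = 0"
proof -
  have "Im (kform us us) = - Im (kform us us)"
    by (metis kform_commute cnj.sel(2))
  then show ?thesis by simp
qed

lemma kform_self: "kform us us = complex_of_real ((knorm us)\<^sup>2)"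
  by (simp add: complex_eq_iff knorm_def kform_nonneg)

lemma knorm_nonneg [simp]: "0 \<le> knorm us"
  by (simp add: knorm_def kform_nonneg)

lemma knorm_scale: "knorm (kscale c us) = cmod c * knorm us"
proof -
  have "kform (kscale c us) (kscale c us) = (c * cnj c) * kform us us"
    by (simp only: kform_scale_left kform_scale_right mult_ac)
  also have "\<dots> = complex_of_real ((cmod c * knorm us)\<^sup>2)"
    by (simp only: kform_self complex_norm_square[symmetric] power_mult_distrib of_real_mult of_real_power)
  finally have "kform (kscale c us) (kscale c us) = complex_of_real ((cmod c * knorm us)\<^sup>2)" .
  then have "complex_of_real ((knorm (kscale c us))\<^sup>2) = complex_of_real ((cmod c * knorm us)\<^sup>2)"
    by (simp only: kform_self)
  then have "(knorm (kscale c us))\<^sup>2 = (cmod c * knorm us)\<^sup>2"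
    by (simp only: of_real_eq_iff)
  then show ?thesis
    by (simp add: power2_eq_iff_nonneg)
qed

lemma kform_Cauchy_Schwarz: "cmod (kform us vs) \<le> knorm us * knorm vs"
proof (cases "kform us vs = 0")
  case False
  define z where "z = kform us vs"
  define s where "s = cnj (sgn z)"
  have nz: "cmod z \<noteq> 0"
    using False by (simp add: z_def)
  have s_eq: "s = cnj z / of_real (cmod z)"
    by (simp add: s_def sgn_eq)
  have sz1: "s * z = of_real (cmod z)"
    using complex_norm_square[of z] nz by (simp add: s_eq field_simps power2_eq_square)
  have sz2: "cnj s * cnj z = of_real (cmod z)"
    using arg_cong[OF sz1, of cnj] by simp
  have sz3: "cmod s = 1"
    using nz by (simp add: s_eq norm_divide)
  have ineq: "0 \<le> (knorm us)\<^sup>2 * a\<^sup>2 - 2 * a * b * cmod z + (knorm vs)\<^sup>2 * b\<^sup>2" for a b :: real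
  proof -
    have "0 \<le> Re (kform (kscale (of_real a * s) us @ kscale (of_real (-b)) vs)
                        (kscale (of_real a * s) us @ kscale (of_real (-b)) vs))"
      by (rule kform_nonneg)
    also have "kform (kscale (of_real a * s) us @ kscale (of_real (-b)) vs)
                        (kscale (of_real a * s) us @ kscale (of_real (-b)) vs)
       = of_real (a\<^sup>2) * (s * cnj s) * kform us us - of_real (a * b) * (s * z)
         - of_real (a * b) * (cnj s * cnj z) + of_real (b\<^sup>2) * kform vs vs"
      by (simp add: kform_simps z_def kform_commute[of vs us] algebra_simps power2_eq_square)
    also have "s * cnj s = 1"
      using sz3 by (simp add: complex_norm_square[symmetric])
    finally show ?thesis
      by (simp add: sz1 sz2 kform_self algebra_simps)
  qed
  have "(cmod z)\<^sup>2 \<le> (knorm us)\<^sup>2 * (knorm vs)\<^sup>2"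
  proof (cases "knorm us = 0")
    case True
    have "0 \<le> - 2 * a * cmod z + (knorm vs)\<^sup>2" for a
      using ineq[of a 1] True by simp
    from this[of "((knorm vs)\<^sup>2 + 1) / (2 * cmod z)"] nz show ?thesis
      by (simp add: field_simps)
  next
    case ne: False
    have "0 \<le> (knorm us)\<^sup>2 * (cmod z)\<^sup>2 - 2 * cmod z * (knorm us)\<^sup>2 * cmod z
        + (knorm vs)\<^sup>2 * ((knorm us)\<^sup>2)\<^sup>2"
      using ineq[of "cmod z" "(knorm us)\<^sup>2"] .
    also have "\<dots> = (knorm us)\<^sup>2 * ((knorm us)\<^sup>2 * (knorm vs)\<^sup>2 - (cmod z)\<^sup>2)"
      by (simp add: algebra_simps power2_eq_square)
    finally show ?thesis
      using ne by (simp add: zero_le_mult_iff)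
  qed
  then show ?thesis
    unfolding z_def by (metis abs_le_square_iff abs_norm_cancel abs_of_nonneg knorm_nonneg
        mult_nonneg_nonneg power_mult_distrib)
qed simp

lemma knorm_triangle: "knorm (us @ vs) \<le> knorm us + knorm vs"
proof -
  have "kform (us @ vs) (us @ vs) = kform us us + kform vs vs + (kform us vs + cnj (kform us vs))"
    by (simp add: kform_simps kform_commute[of vs us])
  then have "of_real ((knorm (us @ vs))\<^sup>2) =
      complex_of_real ((knorm us)\<^sup>2 + (knorm vs)\<^sup>2 + 2 * Re (kform us vs))"
    by (simp add: kform_self complex_add_cnj)
  then have "(knorm (us @ vs))\<^sup>2 = (knorm us)\<^sup>2 + (knorm vs)\<^sup>2 + 2 * Re (kform us vs)"
    by (simp only: of_real_eq_iff)
  also have "\<dots> \<le> (knorm us + knorm vs)\<^sup>2"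
    using order_trans[OF complex_Re_le_cmod kform_Cauchy_Schwarz[of us vs]]
    by (simp add: power2_sum)
  finally show ?thesis
    by (simp add: power2_le_iff_abs_le)
qed

lemma knorm_kdiff_commute: "knorm (kdiff us vs) = knorm (kdiff vs us)"
  by (simp add: knorm_def kform_simps algebra_simps)

lemma knorm_kdiff_triangle: "knorm (kdiff us ws) \<le> knorm (kdiff us vs) + knorm (kdiff vs ws)"
proof -
  have "knorm (kdiff us ws) = knorm (kdiff us vs @ kdiff vs ws)"
    by (simp add: knorm_def kform_simps algebra_simps)
  then show ?thesis
    using knorm_triangle[of "kdiff us vs" "kdiff vs ws"] by simp
qed

lemma knorm_le_kdiff: "knorm us \<le> knorm (kdiff us vs) + knorm vs"
proof -
  have "knorm us = knorm (kdiff us vs @ vs)"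
    by (simp add: knorm_def kform_simps algebra_simps)
  then show ?thesis
    using knorm_triangle[of "kdiff us vs" vs] by simp
qed

definition kCauchy :: "(nat \<Rightarrow> (complex \<times> 'a::pd_kernel) list) \<Rightarrow> bool"
  where "kCauchy u \<longleftrightarrow> (\<forall>e>0. \<exists>N. \<forall>m\<ge>N. \<forall>n\<ge>N. knorm (kdiff (u m) (u n)) < e)"

definition krep :: "(nat \<Rightarrow> (complex \<times> 'a::pd_kernel) list) \<Rightarrow> ('a \<Rightarrow> complex) \<Rightarrow> bool"
  where "krep u f \<longleftrightarrow> kCauchy u \<and> (\<forall>y. (\<lambda>n. kform (u n) [(1, y)]) \<longlonglongrightarrow> f y)"

lemma kCauchy_bounded:
  assumes "kCauchy u"
  obtains M where "M > 0" "\<And>n. knorm (u n) \<le> M"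
proof -
  obtain N where N: "\<And>m n. m \<ge> N \<Longrightarrow> n \<ge> N \<Longrightarrow> knorm (kdiff (u m) (u n)) < 1"
    using assms unfolding kCauchy_def by (meson zero_less_one)
  define M where "M = 1 + knorm (u N) + (\<Sum>k<N. knorm (u k))"
  have "knorm (u n) \<le> M" for n
  proof (cases "n < N")
    case True
    then have "knorm (u n) \<le> (\<Sum>k<N. knorm (u k))"
      by (intro member_le_sum) auto
    then show ?thesis
      unfolding M_def using knorm_nonneg[of "u N"] by linarith
  next
    case False
    have "0 \<le> (\<Sum>k<N. knorm (u k))"
      by (simp add: sum_nonneg)
    then show ?thesis
      unfolding M_def using knorm_le_kdiff[of "u n" "u N"] N[of n N] False by simp
  qed
  moreover have "M > 0"
  proof -
    have "0 \<le> (\<Sum>k<N. knorm (u k))"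
      by (simp add: sum_nonneg)
    then show ?thesis
      unfolding M_def using knorm_nonneg[of "u N"] by linarith
  qed
  ultimately show ?thesis using that by blast
qed

lemma kform_diff_bound:
  "cmod (kform us vs - kform us' vs') \<le> knorm (kdiff us us') * knorm vs + knorm us' * knorm (kdiff vs vs')"
proof -
  have "kform us vs - kform us' vs' = kform (kdiff us us') vs + kform us' (kdiff vs vs')"
    by (simp add: kform_simps)
  then show ?thesis
    using norm_triangle_ineq[of "kform (kdiff us us') vs" "kform us' (kdiff vs vs')"]
      kform_Cauchy_Schwarz[of "kdiff us us'" vs] kform_Cauchy_Schwarz[of us' "kdiff vs vs'"]
    by simp
qed

lemma kform_convergent:
  assumes u: "kCauchy u" and v: "kCauchy v"
  shows "convergent (\<lambda>n. kform (u n) (v n))"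
proof -
  obtain M where M: "M > 0" "\<And>n. knorm (u n) \<le> M"
    using kCauchy_bounded[OF u] by blast
  obtain L where L: "L > 0" "\<And>n. knorm (v n) \<le> L"
    using kCauchy_bounded[OF v] by blast
  have "Cauchy (\<lambda>n. kform (u n) (v n))"
  proof (rule CauchyI)
    fix e :: real
    assume "e > 0"
    then obtain N1 N2 where
      N1: "\<And>m n. m \<ge> N1 \<Longrightarrow> n \<ge> N1 \<Longrightarrow> knorm (kdiff (u m) (u n)) < e / (2 * L)" and
      N2: "\<And>m n. m \<ge> N2 \<Longrightarrow> n \<ge> N2 \<Longrightarrow> knorm (kdiff (v m) (v n)) < e / (2 * M)"
      using u v M(1) L(1) unfolding kCauchy_def
      by (metis divide_pos_pos mult_pos_pos zero_less_numeral)
    show "\<exists>N. \<forall>m\<ge>N. \<forall>n\<ge>N. cmod (kform (u m) (v m) - kform (u n) (v n)) < e"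
    proof (intro exI allI impI)
      fix m n
      assume mn: "m \<ge> max N1 N2" "n \<ge> max N1 N2"
      have "cmod (kform (u m) (v m) - kform (u n) (v n))
          \<le> knorm (kdiff (u m) (u n)) * knorm (v m) + knorm (u n) * knorm (kdiff (v m) (v n))"
        by (rule kform_diff_bound)
      also have "\<dots> \<le> knorm (kdiff (u m) (u n)) * L + M * knorm (kdiff (v m) (v n))"
        using M L by (intro add_mono mult_mono) auto
      also have "\<dots> < e / (2 * L) * L + M * (e / (2 * M))"
        using M(1) L(1) N1[of m n] N2[of m n] mn
        by (intro add_strict_mono mult_strict_right_mono mult_strict_left_mono) auto
      also have "\<dots> = e"
        using M L by (simp add: field_simps)
      finally show "cmod (kform (u m) (v m) - kform (u n) (v n)) < e" .
    qed
  qed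
  then show ?thesis
    by (simp add: Cauchy_convergent_iff)
qed

lemma krep_form:
  assumes "krep u f"
  shows "(\<lambda>n. kform (u n) ws) \<longlonglongrightarrow> (\<Sum>(d, y)\<leftarrow>ws. cnj d * f y)"
proof (induction ws)
  case Nil
  show ?case by simp
next
  case (Cons p ws)
  obtain d y where p: "p = (d, y)" by force
  have "kform (u n) [p] = cnj d * kform (u n) [(1, y)]" for n
    using kform_scale_right[of "u n" d "[(1, y)]"] by (simp add: p kscale_def)
  moreover have "(\<lambda>n. cnj d * kform (u n) [(1, y)]) \<longlonglongrightarrow> cnj d * f y"
    using assms unfolding krep_def by (intro tendsto_mult_left) auto
  ultimately have "(\<lambda>n. kform (u n) [p]) \<longlonglongrightarrow> cnj d * f y"
    by simp
  from tendsto_add[OF this Cons] show ?case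
    by (subst kform_Cons_right) (simp add: p)
qed

lemma krep_zero:
  assumes "krep u (\<lambda>_. 0)"
  shows "(\<lambda>n. knorm (u n)) \<longlonglongrightarrow> 0"
proof -
  have u: "kCauchy u" using assms by (simp add: krep_def)
  obtain M where M: "M > 0" "\<And>n. knorm (u n) \<le> M"
    using kCauchy_bounded[OF u] by blast
  have lim: "(\<lambda>n. kform (u n) ws) \<longlonglongrightarrow> 0" for ws
  proof -
    have "(\<Sum>(d, y)\<leftarrow>ws. cnj d * (0::complex)) = 0"
      by (induction ws) auto
    then show ?thesis
      using krep_form[OF assms, of ws] by simp
  qed
  have "(\<lambda>n. (knorm (u n))\<^sup>2) \<longlonglongrightarrow> 0"
  proof (rule LIMSEQ_I)
    fix e :: real
    assume e: "e > 0"
    then obtain N where N: "\<And>m n. m \<ge> N \<Longrightarrow> n \<ge> N \<Longrightarrow> knorm (kdiff (u m) (u n)) < e / (2 * M)"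
      using u M(1) unfolding kCauchy_def by (metis divide_pos_pos mult_pos_pos zero_less_numeral)
    obtain K where K: "\<And>n. n \<ge> K \<Longrightarrow> cmod (kform (u n) (u N)) < e / 2"
      using LIMSEQ_D[OF lim[of "u N"], of "e / 2"] e by auto
    show "\<exists>no. \<forall>n\<ge>no. norm ((knorm (u n))\<^sup>2 - 0) < e"
    proof (intro exI allI impI)
      fix n
      assume n: "n \<ge> max N K"
      have "kform (u n) (u n) = kform (u n) (u N) + kform (u n) (kdiff (u n) (u N))"
        by (simp add: kform_simps)
      then have "cmod (kform (u n) (u n)) \<le> cmod (kform (u n) (u N)) + cmod (kform (u n) (kdiff (u n) (u N)))"
        by (metis norm_triangle_ineq)
      also have "\<dots> \<le> cmod (kform (u n) (u N)) + knorm (u n) * knorm (kdiff (u n) (u N))"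
        by (simp add: kform_Cauchy_Schwarz)
      also have "\<dots> \<le> cmod (kform (u n) (u N)) + M * knorm (kdiff (u n) (u N))"
        using M by (intro add_mono mult_mono) auto
      also have "\<dots> < e / 2 + M * (e / (2 * M))"
        using n K N M(1) by (intro add_strict_mono mult_strict_left_mono) auto
      also have "\<dots> = e"
        using M by (simp add: field_simps)
      finally show "norm ((knorm (u n))\<^sup>2 - 0) < e"
        by (simp add: kform_self norm_power)
    qed
  qed
  then show ?thesis
    using tendsto_real_sqrt[of "\<lambda>n. (knorm (u n))\<^sup>2" 0 sequentially] by simp
qed

lemma kCauchy_append:
  assumes u: "kCauchy u" and v: "kCauchy v"
  shows "kCauchy (\<lambda>n. u n @ v n)"
  unfolding kCauchy_def
proof (intro allI impI)
  fix e :: real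
  assume "e > 0"
  then obtain N1 N2 where
    N1: "\<And>m n. m \<ge> N1 \<Longrightarrow> n \<ge> N1 \<Longrightarrow> knorm (kdiff (u m) (u n)) < e / 2" and
    N2: "\<And>m n. m \<ge> N2 \<Longrightarrow> n \<ge> N2 \<Longrightarrow> knorm (kdiff (v m) (v n)) < e / 2"
    using u v unfolding kCauchy_def by (metis half_gt_zero)
  have "knorm (kdiff (u m @ v m) (u n @ v n)) < e" if "m \<ge> max N1 N2" "n \<ge> max N1 N2" for m n
  proof -
    have "knorm (kdiff (u m @ v m) (u n @ v n)) = knorm (kdiff (u m) (u n) @ kdiff (v m) (v n))"
      by (simp add: knorm_def kform_simps algebra_simps)
    also have "\<dots> \<le> knorm (kdiff (u m) (u n)) + knorm (kdiff (v m) (v n))"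
      by (rule knorm_triangle)
    finally show ?thesis
      using N1[of m n] N2[of m n] that by simp
  qed
  then show "\<exists>N. \<forall>m\<ge>N. \<forall>n\<ge>N. knorm (kdiff (u m @ v m) (u n @ v n)) < e"
    by blast
qed

lemma kCauchy_scale:
  assumes u: "kCauchy u"
  shows "kCauchy (\<lambda>n. kscale c (u n))"
  unfolding kCauchy_def
proof (intro allI impI)
  fix e :: real
  assume "e > 0"
  then have "e / (cmod c + 1) > 0"
    by (simp add: add_nonneg_pos)
  then obtain N where N: "\<And>m n. m \<ge> N \<Longrightarrow> n \<ge> N \<Longrightarrow> knorm (kdiff (u m) (u n)) < e / (cmod c + 1)"
    using u unfolding kCauchy_def by metis
  have "knorm (kdiff (kscale c (u m)) (kscale c (u n))) < e" if "m \<ge> N" "n \<ge> N" for m n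
  proof -
    have "knorm (kdiff (kscale c (u m)) (kscale c (u n))) = knorm (kscale c (kdiff (u m) (u n)))"
      by (simp add: knorm_def kform_simps algebra_simps)
    also have "\<dots> \<le> (cmod c + 1) * knorm (kdiff (u m) (u n))"
      unfolding knorm_scale by (intro mult_right_mono) auto
    also have "\<dots> < (cmod c + 1) * (e / (cmod c + 1))"
      using N[OF that] by (intro mult_strict_left_mono) (auto simp: add_nonneg_pos)
    also have "\<dots> = e"
      by (simp add: add_nonneg_eq_0_iff)
    finally show ?thesis .
  qed
  then show "\<exists>N. \<forall>m\<ge>N. \<forall>n\<ge>N. knorm (kdiff (kscale c (u m)) (kscale c (u n))) < e"
    by blast
qed

lemma krep_add: "krep u f \<Longrightarrow> krep v g \<Longrightarrow> krep (\<lambda>n. u n @ v n) (\<lambda>y. f y + g y)"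
  unfolding krep_def by (auto simp: kCauchy_append kform_append_left intro!: tendsto_add)

lemma krep_scale: "krep u f \<Longrightarrow> krep (\<lambda>n. kscale c (u n)) (\<lambda>y. c * f y)"
  unfolding krep_def by (auto simp: kCauchy_scale kform_scale_left intro!: tendsto_mult_left)

lemma kCauchy_const: "kCauchy (\<lambda>_. us)"
  by (simp add: kCauchy_def knorm_def kform_simps)

lemma krep_const: "krep (\<lambda>_. us) (\<lambda>y. kform us [(1, y)])"
  by (simp add: krep_def kCauchy_const)

lemma krep_unique:
  assumes "krep u f" "krep u' f"
  shows "(\<lambda>n. knorm (kdiff (u n) (u' n))) \<longlonglongrightarrow> 0"
  using krep_zero krep_add[OF assms(1) krep_scale[OF assms(2), of "-1"]] by simp

lemma krep_limit_unique:
  assumes u: "krep u f" "krep u' f" and v: "krep v g" "krep v' g"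
    and l: "(\<lambda>n. kform (u n) (v n)) \<longlonglongrightarrow> l"
  shows "(\<lambda>n. kform (u' n) (v' n)) \<longlonglongrightarrow> l"
proof -
  obtain M where M: "\<And>n. knorm (u' n) \<le> M"
    using kCauchy_bounded u(2) unfolding krep_def by metis
  obtain L where L: "\<And>n. knorm (v n) \<le> L"
    using kCauchy_bounded v(1) unfolding krep_def by metis
  have "(\<lambda>n. knorm (kdiff (u n) (u' n)) * L + M * knorm (kdiff (v n) (v' n))) \<longlonglongrightarrow> 0 * L + M * 0"
    by (intro tendsto_intros krep_unique[OF u] krep_unique[OF v])
  then have lim: "(\<lambda>n. knorm (kdiff (u n) (u' n)) * L + M * knorm (kdiff (v n) (v' n))) \<longlonglongrightarrow> 0"
    by simp
  have "(\<lambda>n. kform (u n) (v n) - kform (u' n) (v' n)) \<longlonglongrightarrow> 0"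
  proof (rule Lim_null_comparison[OF _ lim], rule always_eventually, rule allI)
    fix n
    have "cmod (kform (u n) (v n) - kform (u' n) (v' n))
        \<le> knorm (kdiff (u n) (u' n)) * knorm (v n) + knorm (u' n) * knorm (kdiff (v n) (v' n))"
      by (rule kform_diff_bound)
    also have "\<dots> \<le> knorm (kdiff (u n) (u' n)) * L + M * knorm (kdiff (v n) (v' n))"
      using M L order_trans[OF knorm_nonneg M] by (intro add_mono mult_mono) auto
    finally show "cmod (kform (u n) (v n) - kform (u' n) (v' n))
        \<le> knorm (kdiff (u n) (u' n)) * L + M * knorm (kdiff (v n) (v' n))" .
  qed
  from tendsto_diff[OF l this] show ?thesis by simp
qed

typedef (overloaded) 'a rkhs = "{f :: 'a::pd_kernel \<Rightarrow> complex. \<exists>u. krep u f}"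
  morphisms rkhs_apply Abs_rkhs
  using krep_const by blast

setup_lifting type_definition_rkhs

lift_definition kcomb :: "(complex \<times> 'a::pd_kernel) list \<Rightarrow> 'a rkhs"
  is "\<lambda>us y. kform us [(1, y)]"
  using krep_const by blast

definition rseq :: "'a::pd_kernel rkhs \<Rightarrow> nat \<Rightarrow> (complex \<times> 'a) list"
  where "rseq f = (SOME u. krep u (rkhs_apply f))"

lemma krep_rseq: "krep (rseq f) (rkhs_apply f)"
  unfolding rseq_def using rkhs_apply[of f] by (intro someI_ex[of "\<lambda>u. krep u (rkhs_apply f)"]) auto

instantiation rkhs :: (pd_kernel) real_vector
begin

lift_definition zero_rkhs :: "'a rkhs" is "\<lambda>_. 0"
  using krep_const[of "[]"] by auto

lift_definition plus_rkhs :: "'a rkhs \<Rightarrow> 'a rkhs \<Rightarrow> 'a rkhs" is "\<lambda>f g y. f y + g y"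
  using krep_add by blast

lift_definition uminus_rkhs :: "'a rkhs \<Rightarrow> 'a rkhs" is "\<lambda>f y. - f y"
  using krep_scale[of _ _ "-1"] by fastforce

definition minus_rkhs :: "'a rkhs \<Rightarrow> 'a rkhs \<Rightarrow> 'a rkhs"
  where "minus_rkhs f g = f + (- g)"

lift_definition scaleR_rkhs :: "real \<Rightarrow> 'a rkhs \<Rightarrow> 'a rkhs" is "\<lambda>r f y. complex_of_real r * f y"
  using krep_scale by blast

instance
proof
  fix f g h :: "'a rkhs" and r s :: real
  show "f + g + h = f + (g + h)" "f + g = g + f" "0 + f = f" "- f + f = 0"
    "r *\<^sub>R (f + g) = r *\<^sub>R f + r *\<^sub>R g" "(r + s) *\<^sub>R f = r *\<^sub>R f + s *\<^sub>R f"
    "r *\<^sub>R s *\<^sub>R f = (r * s) *\<^sub>R f" "1 *\<^sub>R f = f"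
    by (transfer; simp add: algebra_simps)+
  show "f - g = f + - g" by (rule minus_rkhs_def)
qed

end

definition rform :: "'a::pd_kernel rkhs \<Rightarrow> 'a rkhs \<Rightarrow> complex"
  where "rform f g = lim (\<lambda>n. kform (rseq f n) (rseq g n))"

lemma rkhs_inner_lim:
  assumes "krep u (rkhs_apply f)" "krep v (rkhs_apply g)"
  shows "(\<lambda>n. kform (u n) (v n)) \<longlonglongrightarrow> rform f g"
proof -
  have "convergent (\<lambda>n. kform (rseq f n) (rseq g n))"
    using krep_rseq[of f] krep_rseq[of g] by (intro kform_convergent) (auto simp: krep_def)
  then have "(\<lambda>n. kform (rseq f n) (rseq g n)) \<longlonglongrightarrow> rform f g"
    by (simp add: convergent_LIMSEQ_iff rform_def)
  with krep_limit_unique[OF krep_rseq assms(1) krep_rseq assms(2)] show ?thesis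
    by blast
qed

lemma rkhs_lim_eq:
  assumes "krep u (rkhs_apply f)" "krep v (rkhs_apply g)" "(\<lambda>n. kform (u n) (v n)) \<longlonglongrightarrow> l"
  shows "rform f g = l"
  using rkhs_inner_lim[OF assms(1,2)] assms(3) LIMSEQ_unique by blast

lemma rkhs_lim_add:
  "rform (f + g) h
    = rform f h + rform g h"
proof (rule rkhs_lim_eq[of "\<lambda>n. rseq f n @ rseq g n" _ "rseq h"])
  show "krep (\<lambda>n. rseq f n @ rseq g n) (rkhs_apply (f + g))"
    using krep_add[OF krep_rseq krep_rseq, of f g] by (simp add: plus_rkhs.rep_eq)
qed (auto simp: krep_rseq kform_append_left intro!: tendsto_add rkhs_inner_lim)

lemma rkhs_lim_scale:
  assumes "rkhs_apply f' = (\<lambda>y. c * rkhs_apply f y)"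
  shows "rform f' h = c * rform f h"
proof (rule rkhs_lim_eq[of "\<lambda>n. kscale c (rseq f n)" _ "rseq h"])
  show "krep (\<lambda>n. kscale c (rseq f n)) (rkhs_apply f')"
    using krep_scale[OF krep_rseq, of c f] assms by simp
qed (auto simp: krep_rseq kform_scale_left intro!: tendsto_mult_left rkhs_inner_lim)

lemma rkhs_lim_commute:
  "rform f g = cnj (rform g f)"
proof (rule rkhs_lim_eq[OF krep_rseq krep_rseq])
  show "(\<lambda>n. kform (rseq f n) (rseq g n)) \<longlonglongrightarrow> cnj (rform g f)"
    using tendsto_cnj[OF rkhs_inner_lim[OF krep_rseq krep_rseq, of g f]]
    by (simp add: kform_commute[symmetric])
qed

lemma rkhs_lim_self: "(\<lambda>n. (knorm (rseq f n))\<^sup>2) \<longlonglongrightarrow> Re (rform f f)"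
  using tendsto_Re[OF rkhs_inner_lim[OF krep_rseq krep_rseq, of f f]]
  by (simp add: kform_self)

lemma Re_of_real_mult: "Re (complex_of_real r * z) = r * Re z"
  by simp

lemma rform_nonneg: "0 \<le> Re (rform f f)"
  by (rule LIMSEQ_le_const[OF rkhs_lim_self]) auto

lemma rform_zero: "rform 0 0 = 0"
  using rkhs_lim_scale[OF scaleR_rkhs.rep_eq, of 0 0 0] by simp

lemma rform_eq_zero:
  assumes "Re (rform f f) = 0"
  shows "f = 0"
proof -
  have "(\<lambda>n. sqrt ((knorm (rseq f n))\<^sup>2)) \<longlonglongrightarrow> 0"
    using tendsto_real_sqrt[OF rkhs_lim_self[of f]] assms by simp
  then have lim: "(\<lambda>n. knorm (rseq f n)) \<longlonglongrightarrow> 0"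
    by (simp only: real_sqrt_abs abs_of_nonneg[OF knorm_nonneg])
  have "rkhs_apply f y = 0" for y
  proof (rule LIMSEQ_unique)
    show "(\<lambda>n. kform (rseq f n) [(1, y)]) \<longlonglongrightarrow> rkhs_apply f y"
      using krep_rseq[of f] by (simp add: krep_def)
    have "(\<lambda>n. knorm (rseq f n) * knorm [(1, y)]) \<longlonglongrightarrow> 0"
      using tendsto_mult_right[OF lim, of "knorm [(1, y)]"] by simp
    then show "(\<lambda>n. kform (rseq f n) [(1, y)]) \<longlonglongrightarrow> 0"
      by (rule Lim_null_comparison[OF always_eventually[OF allI[OF kform_Cauchy_Schwarz]]])
  qed
  then have "rkhs_apply f = rkhs_apply 0"
    by (simp add: zero_rkhs.rep_eq fun_eq_iff)
  then show "f = 0"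
    by (simp only: rkhs_apply_inject)
qed

instantiation rkhs :: (pd_kernel) real_inner
begin

definition inner_rkhs :: "'a rkhs \<Rightarrow> 'a rkhs \<Rightarrow> real"
  where "inner_rkhs f g = Re (rform f g)"

definition norm_rkhs :: "'a rkhs \<Rightarrow> real"
  where "norm_rkhs f = sqrt (Re (rform f f))"

definition sgn_rkhs :: "'a rkhs \<Rightarrow> 'a rkhs"
  where "sgn_rkhs f = f /\<^sub>R sqrt (Re (rform f f))"

definition dist_rkhs :: "'a rkhs \<Rightarrow> 'a rkhs \<Rightarrow> real"
  where "dist_rkhs f g = sqrt (Re (rform (f - g) (f - g)))"

definition uniformity_rkhs :: "('a rkhs \<times> 'a rkhs) filter"
  where "uniformity_rkhs = (INF e\<in>{0<..}. principal {(f, g). sqrt (Re (rform (f - g) (f - g))) < e})"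

definition open_rkhs :: "'a rkhs set \<Rightarrow> bool"
  where "open_rkhs U \<longleftrightarrow> (\<forall>f\<in>U. \<forall>\<^sub>F (f', g) in
    INF e\<in>{0<..}. principal {(f, g). sqrt (Re (rform (f - g) (f - g))) < e}. f' = f \<longrightarrow> g \<in> U)"

instance
proof
  fix f g h :: "'a rkhs" and r s :: real
  show "sgn f = f /\<^sub>R norm f" by (simp only: sgn_rkhs_def norm_rkhs_def)
  show "dist f g = norm (f - g)" by (simp add: dist_rkhs_def norm_rkhs_def)
  show "norm f = sqrt (inner f f)" by (simp add: norm_rkhs_def inner_rkhs_def)
  show "(uniformity :: ('a rkhs \<times> 'a rkhs) filter) = (INF e\<in>{0<..}. principal {(f, g). dist f g < e})"
    by (simp only: uniformity_rkhs_def dist_rkhs_def)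
  show "open U \<longleftrightarrow> (\<forall>f\<in>U. \<forall>\<^sub>F (f', g) in uniformity. f' = f \<longrightarrow> g \<in> U)" for U :: "'a rkhs set"
    by (simp only: open_rkhs_def uniformity_rkhs_def)
  show "inner f g = inner g f"
    unfolding inner_rkhs_def by (subst rkhs_lim_commute) (rule cnj.sel(1))
  show "inner (f + g) h = inner f h + inner g h"
    unfolding inner_rkhs_def by (simp only: rkhs_lim_add plus_complex.sel)
  show "inner (r *\<^sub>R f) g = r * inner f g"
    unfolding inner_rkhs_def rkhs_lim_scale[OF scaleR_rkhs.rep_eq] by (rule Re_of_real_mult)
  show "0 \<le> inner f f"
    unfolding inner_rkhs_def by (rule rform_nonneg)
  show "inner f f = 0 \<longleftrightarrow> f = 0"
    unfolding inner_rkhs_def using rform_eq_zero[of f] by (auto simp only: rform_zero complex.sel zero_complex.sel)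
qed

end

lemma rkhs_norm_lim:
  assumes "krep u (rkhs_apply f)"
  shows "(\<lambda>n. knorm (u n)) \<longlonglongrightarrow> norm f"
  using tendsto_real_sqrt[OF tendsto_Re[OF rkhs_inner_lim[OF assms assms]]]
  by (simp only: norm_rkhs_def kform_self Re_complex_of_real real_sqrt_abs abs_of_nonneg[OF knorm_nonneg])

lemma rkhs_apply_kcomb: "rkhs_apply (kcomb us) = (\<lambda>y. kform us [(1, y)])"
  by (rule kcomb.rep_eq)

lemma norm_diff_kcomb_lim:
  assumes "krep u (rkhs_apply f)"
  shows "(\<lambda>n. knorm (kdiff (u n) us)) \<longlonglongrightarrow> norm (f - kcomb us)"
proof (rule rkhs_norm_lim)
  have "rkhs_apply (f - kcomb us) = (\<lambda>y. rkhs_apply f y + (-1) * kform us [(1, y)])"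
    unfolding minus_rkhs_def plus_rkhs.rep_eq uminus_rkhs.rep_eq rkhs_apply_kcomb by simp
  then show "krep (\<lambda>n. kdiff (u n) us) (rkhs_apply (f - kcomb us))"
    using krep_add[OF assms krep_scale[OF krep_const[of us], of "-1"]] by simp
qed

lemma norm_diff_kcomb_le:
  assumes "krep u (rkhs_apply f)" and "\<And>n. n \<ge> N \<Longrightarrow> knorm (kdiff (u n) us) \<le> e"
  shows "norm (f - kcomb us) \<le> e"
proof (rule LIMSEQ_le_const2[OF norm_diff_kcomb_lim[OF assms(1)]])
  show "\<exists>N. \<forall>n\<ge>N. knorm (kdiff (u n) us) \<le> e"
    using assms(2) by blast
qed

lemma kcomb_dense:
  assumes "e > 0"
  obtains us where "norm (f - kcomb us) < e"
proof -
  have "kCauchy (rseq f)" using krep_rseq[of f] by (simp add: krep_def)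
  moreover have "e / 2 > 0" using assms by simp
  ultimately obtain N where
    N: "\<And>m n. m \<ge> N \<Longrightarrow> n \<ge> N \<Longrightarrow> knorm (kdiff (rseq f m) (rseq f n)) < e / 2"
    unfolding kCauchy_def by blast
  have "norm (f - kcomb (rseq f N)) \<le> e / 2"
  proof (rule norm_diff_kcomb_le[OF krep_rseq, of N])
    show "knorm (kdiff (rseq f n) (rseq f N)) \<le> e / 2" if "n \<ge> N" for n
      using N[of n N] that by simp
  qed
  then show ?thesis
    using that[of "rseq f N"] assms by simp
qed

lemma norm_kcomb_diff: "norm (kcomb us - kcomb vs) = knorm (kdiff us vs)"
proof (rule LIMSEQ_unique)
  show "(\<lambda>n::nat. knorm (kdiff us vs)) \<longlonglongrightarrow> norm (kcomb us - kcomb vs)"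
    by (rule norm_diff_kcomb_lim) (simp only: rkhs_apply_kcomb krep_const)
qed (rule tendsto_const)

instantiation rkhs :: (pd_kernel) chilbert
begin

lift_definition scaleC_rkhs :: "complex \<Rightarrow> 'a rkhs \<Rightarrow> 'a rkhs" is "\<lambda>c f y. c * f y"
  using krep_scale by blast

definition cinner_rkhs :: "'a rkhs \<Rightarrow> 'a rkhs \<Rightarrow> complex"
  where "cinner f g = rform f g"

instance
proof
  fix f g h :: "'a rkhs" and c d :: complex and r :: real
  show "c *\<^sub>C (f + g) = c *\<^sub>C f + c *\<^sub>C g" "(c + d) *\<^sub>C f = c *\<^sub>C f + d *\<^sub>C f"
    "c *\<^sub>C d *\<^sub>C f = (c * d) *\<^sub>C f" "r *\<^sub>R f = complex_of_real r *\<^sub>C f"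
    by (transfer; simp add: algebra_simps)+
  show "cinner f g = cnj (cinner g f)"
    unfolding cinner_rkhs_def by (rule rkhs_lim_commute)
  show "cinner (f + g) h = cinner f h + cinner g h"
    unfolding cinner_rkhs_def by (rule rkhs_lim_add)
  show "cinner (c *\<^sub>C f) g = c * cinner f g"
    unfolding cinner_rkhs_def by (rule rkhs_lim_scale[OF scaleC_rkhs.rep_eq])
  show "inner f g = Re (cinner f g)"
    by (simp add: cinner_rkhs_def inner_rkhs_def)
next
  fix F :: "nat \<Rightarrow> 'a rkhs"
  assume F: "Cauchy F"
  have "\<forall>k. \<exists>us. norm (F k - kcomb us) < inverse (real (Suc k))"
    by (metis kcomb_dense inverse_positive_iff_positive of_nat_0_less_iff zero_less_Suc)
  then obtain w where w: "\<And>k. norm (F k - kcomb (w k)) < inverse (real (Suc k))"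
    by metis
  have inv: "\<exists>N. \<forall>n\<ge>N. norm (F n - kcomb (w n)) < e" if e: "e > 0" for e
  proof -
    obtain N where "inverse (real (Suc N)) < e"
      using reals_Archimedean[OF e] by auto
    then have "norm (F n - kcomb (w n)) < e" if "n \<ge> N" for n
    proof -
      have "inverse (real (Suc n)) \<le> inverse (real (Suc N))"
        using that by (intro le_imp_inverse_le) auto
      with w[of n] \<open>inverse (real (Suc N)) < e\<close> show ?thesis by linarith
    qed
    then show ?thesis by blast
  qed
  have wC: "kCauchy w"
    unfolding kCauchy_def
  proof (intro allI impI)
    fix e :: real
    assume "e > 0"
    then have e: "e / 3 > 0" by simp
    obtain N where N: "\<And>n. n \<ge> N \<Longrightarrow> norm (F n - kcomb (w n)) < e / 3"
      using inv[OF e] by blast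
    obtain K where K: "\<And>m n. m \<ge> K \<Longrightarrow> n \<ge> K \<Longrightarrow> norm (F m - F n) < e / 3"
      using CauchyD[OF F e] by blast
    show "\<exists>N. \<forall>m\<ge>N. \<forall>n\<ge>N. knorm (kdiff (w m) (w n)) < e"
    proof (intro exI allI impI)
      fix m n
      assume mn: "m \<ge> max N K" "n \<ge> max N K"
      have eq: "kcomb (w m) - kcomb (w n)
          = ((F m - F n) - (F m - kcomb (w m))) + (F n - kcomb (w n))"
        by (simp add: algebra_simps)
      have "norm (kcomb (w m) - kcomb (w n))
          \<le> norm (F m - F n) + norm (F m - kcomb (w m)) + norm (F n - kcomb (w n))"
        unfolding eq
        using norm_triangle_ineq[of "(F m - F n) - (F m - kcomb (w m))" "F n - kcomb (w n)"]
          norm_triangle_ineq4[of "F m - F n" "F m - kcomb (w m)"] by linarith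
      also have "\<dots> < e"
        using N[of m] N[of n] K[of m n] mn by simp
      finally show "knorm (kdiff (w m) (w n)) < e"
        by (simp add: norm_kcomb_diff)
    qed
  qed
  have "convergent (\<lambda>n. kform (w n) [(1, y)])" for y
    by (rule kform_convergent[OF wC kCauchy_const])
  then obtain f where f: "\<And>y. (\<lambda>n. kform (w n) [(1, y)]) \<longlonglongrightarrow> f y"
    unfolding convergent_def by metis
  then have wf: "krep w f"
    using wC by (simp add: krep_def)
  then have rep: "krep w (rkhs_apply (Abs_rkhs f))"
    by (subst Abs_rkhs_inverse) auto
  have "F \<longlonglongrightarrow> Abs_rkhs f"
  proof (rule LIMSEQ_I)
    fix e :: real
    assume "e > 0"
    then have e: "e / 2 > 0" by simp
    obtain N where N: "\<And>n. n \<ge> N \<Longrightarrow> norm (F n - kcomb (w n)) < e / 2"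
      using inv[OF e] by blast
    obtain K where K: "\<And>m n. m \<ge> K \<Longrightarrow> n \<ge> K \<Longrightarrow> knorm (kdiff (w m) (w n)) < e / 2"
      using wC e unfolding kCauchy_def by blast
    show "\<exists>no. \<forall>n\<ge>no. norm (F n - Abs_rkhs f) < e"
    proof (intro exI allI impI)
      fix n
      assume n: "n \<ge> max N K"
      have "norm (Abs_rkhs f - kcomb (w n)) \<le> e / 2"
      proof (rule norm_diff_kcomb_le[OF rep, of K])
        show "knorm (kdiff (w m) (w n)) \<le> e / 2" if "m \<ge> K" for m
          using K[of m n] n that by simp
      qed
      moreover have "norm (F n - Abs_rkhs f) \<le> norm (F n - kcomb (w n)) + norm (Abs_rkhs f - kcomb (w n))"
        using norm_triangle_ineq4[of "F n - kcomb (w n)" "Abs_rkhs f - kcomb (w n)"] by simp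
      ultimately show "norm (F n - Abs_rkhs f) < e"
        using N[of n] n by simp
    qed
  qed
  then show "convergent F"
    unfolding convergent_def by blast
qed

end

definition kvec :: "'a::pd_kernel \<Rightarrow> 'a rkhs"
  where "kvec x = kcomb [(1, x)]"

lemma cinner_kcomb: "cinner (kcomb us) (kcomb vs) = kform us vs"
  unfolding cinner_rkhs_def
  by (rule rkhs_lim_eq[of "\<lambda>_. us" _ "\<lambda>_. vs"]) (simp_all add: rkhs_apply_kcomb krep_const)

lemma cinner_kvec: "cinner (kvec x) (kvec y) = pdk x y"
  by (simp add: kvec_def cinner_kcomb kform_def)

lemma rkhs_eqI: "(\<And>y. rkhs_apply f y = rkhs_apply g y) \<Longrightarrow> f = g"
  by (rule iffD1[OF rkhs_apply_inject]) (rule ext)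

lemma rkhs_apply_kvec: "rkhs_apply (kvec x) y = pdk x y"
  by (simp add: kvec_def rkhs_apply_kcomb kform_def)

lemma kcomb_eq_sum: "kcomb us = (\<Sum>(c, x)\<leftarrow>us. c *\<^sub>C kvec x)"
proof (induction us)
  case Nil
  show ?case
    by (rule rkhs_eqI) (simp add: rkhs_apply_kcomb zero_rkhs.rep_eq)
next
  case (Cons p us)
  obtain c x where p: "p = (c, x)" by force
  have "kcomb (p # us) = c *\<^sub>C kvec x + kcomb us"
    by (rule rkhs_eqI)
       (simp add: p rkhs_apply_kcomb plus_rkhs.rep_eq scaleC_rkhs.rep_eq rkhs_apply_kvec
         kform_Cons_left[of _ us], simp add: kform_def)
  then show ?case
    using Cons by (simp add: p)
qed

lemma kvec_total: "closure (range (\<lambda>us. \<Sum>(c, x)\<leftarrow>us. c *\<^sub>C kvec x)) = UNIV"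
proof -
  have "f \<in> closure (range kcomb)" for f :: "'a rkhs"
    unfolding closure_approachable
  proof (intro allI impI)
    fix e :: real
    assume "e > 0"
    then obtain us where "norm (f - kcomb us) < e"
      by (rule kcomb_dense)
    then show "\<exists>g\<in>range kcomb. dist g f < e"
      by (auto simp: dist_norm norm_minus_commute)
  qed
  then show ?thesis
    by (auto simp: kcomb_eq_sum[abs_def])
qed

lemma cinner_add_right: "cinner z (x + y) = cinner z x + cinner z (y :: 'a::chilbert)"
  by (metis cinner_add_left cinner_commute complex_cnj_add)

lemma cinner_scaleC_right: "cinner x (c *\<^sub>C y) = cnj c * cinner x (y :: 'a::chilbert)"
  by (metis cinner_scaleC_left cinner_commute complex_cnj_mult)

lemma cinner_zero_left [simp]: "cinner 0 (y :: 'a::chilbert) = 0"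
  using cinner_add_left[of 0 0 y] by simp

lemma cinner_zero_right [simp]: "cinner (x :: 'a::chilbert) 0 = 0"
  using cinner_add_right[of x 0 0] by simp

lemma cinner_minus_left [simp]: "cinner (- x) (y :: 'a::chilbert) = - cinner x y"
  using cinner_add_left[of x "- x" y] by (simp add: add_eq_0_iff)

lemma cinner_diff_left: "cinner (x - y) z = cinner x z - cinner y (z :: 'a::chilbert)"
  using cinner_add_left[of x "- y" z] by simp

lemma cinner_sum_left: "cinner (\<Sum>i\<in>I. f i) (y :: 'a::chilbert) = (\<Sum>i\<in>I. cinner (f i) y)"
  by (induction I rule: infinite_finite_induct) (simp_all add: cinner_add_left)

lemma cinner_self: "cinner x x = complex_of_real ((norm (x :: 'a::chilbert))\<^sup>2)"
proof -
  have "Im (cinner x x) = - Im (cinner x x)"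
    by (metis cinner_commute cnj.sel(2))
  moreover have "Re (cinner x x) = (norm x)\<^sup>2"
    by (metis inner_cinner power2_norm_eq_inner)
  ultimately show ?thesis
    by (simp add: complex_eq_iff)
qed

lemma scaleC_zero_left [simp]: "0 *\<^sub>C (x :: 'a::chilbert) = 0"
  using scaleC_add_left[of 0 0 x] by simp

instantiation complex :: chilbert
begin

definition scaleC_complex :: "complex \<Rightarrow> complex \<Rightarrow> complex"
  where "c *\<^sub>C z = c * z"

definition cinner_complex :: "complex \<Rightarrow> complex \<Rightarrow> complex"
  where "cinner z w = z * cnj w"

instance
  by standard (simp_all add: scaleC_complex_def cinner_complex_def algebra_simps
      scaleR_conv_of_real inner_complex_def)

end

lemma kernel_sum_nonneg:
  fixes \<phi> :: "'p \<Rightarrow> 'x \<Rightarrow> 'a::chilbert"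
  assumes "\<And>x y. x \<in> snd ` set us \<Longrightarrow> y \<in> snd ` set us \<Longrightarrow> k x y = (\<Sum>p\<in>P. cinner (\<phi> p x) (\<phi> p y))"
  shows "0 \<le> Re (\<Sum>(c, x)\<leftarrow>us. \<Sum>(d, y)\<leftarrow>us. c * cnj d * k x y)"
proof -
  define s where "s vs p = (\<Sum>(c, x)\<leftarrow>vs. c *\<^sub>C \<phi> p x)" for vs :: "(complex \<times> 'x) list" and p
  have inner: "(\<Sum>(d, y)\<leftarrow>ws. c * cnj d * k x y) = (\<Sum>p\<in>P. cinner (c *\<^sub>C \<phi> p x) (s ws p))"
    if "x \<in> snd ` set us" "set ws \<subseteq> set us" for c x ws
    using that(2)
  proof (induction ws)
    case (Cons q ws)
    obtain d y where q: "q = (d, y)" by force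
    have "y \<in> snd ` set us"
      using Cons.prems by (force simp: q)
    then have "c * cnj d * k x y = (\<Sum>p\<in>P. cinner (c *\<^sub>C \<phi> p x) (d *\<^sub>C \<phi> p y))"
      using that(1) by (simp add: assms sum_distrib_left cinner_scaleC_left cinner_scaleC_right mult_ac)
    then show ?case
      using Cons by (simp add: q s_def cinner_add_right sum.distrib)
  qed (simp add: s_def)
  have outer: "(\<Sum>(c, x)\<leftarrow>vs. \<Sum>(d, y)\<leftarrow>us. c * cnj d * k x y) = (\<Sum>p\<in>P. cinner (s vs p) (s us p))"
    if "set vs \<subseteq> set us" for vs
    using that
  proof (induction vs)
    case (Cons q vs)
    obtain c x where q: "q = (c, x)" by force
    have "x \<in> snd ` set us"
      using Cons.prems by (force simp: q)
    from inner[OF this order_refl, of c] Cons show ?case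
      by (simp add: q s_def[of "(c, x) # vs"] s_def[of vs, symmetric] cinner_add_left sum.distrib)
  qed (simp add: s_def)
  show ?thesis
    unfolding outer[OF order_refl] by (simp add: cinner_self sum_nonneg)
qed

lemma finite_orthonormal_expansion:
  fixes S :: "'a::chilbert set"
  assumes "finite S"
  shows "\<exists>P. finite P \<and> (\<forall>e\<in>P. cinner e e = 1) \<and> (\<forall>e\<in>P. \<forall>e'\<in>P. e \<noteq> e' \<longrightarrow> cinner e e' = 0) \<and>
    (\<forall>b\<in>S. (\<Sum>e\<in>P. cinner b e *\<^sub>C e) = b)"
  using assms
proof (induction S)
  case empty
  show ?case by (rule exI[of _ "{}"]) simp
next
  case (insert v S)
  from insert.IH obtain P where P0: "finite P \<and> (\<forall>e\<in>P. cinner e e = 1) \<and>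
    (\<forall>e\<in>P. \<forall>e'\<in>P. e \<noteq> e' \<longrightarrow> cinner e e' = 0) \<and> (\<forall>b\<in>S. (\<Sum>e\<in>P. cinner b e *\<^sub>C e) = b)"
    by (rule exE)
  then have P: "finite P" "\<And>e. e \<in> P \<Longrightarrow> cinner e e = 1"
    "\<And>e e'. e \<in> P \<Longrightarrow> e' \<in> P \<Longrightarrow> e \<noteq> e' \<Longrightarrow> cinner e e' = 0"
    "\<And>b. b \<in> S \<Longrightarrow> (\<Sum>e\<in>P. cinner b e *\<^sub>C e) = b"
    by simp_all
  define q where "q = (\<Sum>e\<in>P. cinner v e *\<^sub>C e)"
  define w where "w = v - q"
  have comb: "cinner (\<Sum>e\<in>P. a e *\<^sub>C e) e' = a e'" if "e' \<in> P" for a e'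
  proof -
    have "cinner (\<Sum>e\<in>P. a e *\<^sub>C e) e' = (\<Sum>e\<in>P. if e = e' then a e else 0)"
      unfolding cinner_sum_left using P(2,3) that
      by (intro sum.cong) (auto simp: cinner_scaleC_left)
    then show ?thesis
      using P(1) that by simp
  qed
  have wP: "cinner w e = 0" if "e \<in> P" for e
    using comb[OF that] by (simp add: w_def q_def cinner_diff_left)
  have Pw: "cinner e w = 0" if "e \<in> P" for e
    by (subst cinner_commute) (simp add: wP[OF that])
  show ?case
  proof (cases "w = 0")
    case True
    then have "(\<Sum>e\<in>P. cinner v e *\<^sub>C e) = v"
      by (simp add: w_def q_def)
    with P0 show ?thesis
      by (intro exI[of _ P]) simp
  next
    case False
    define u where "u = complex_of_real (inverse (norm w)) *\<^sub>C w"
    have uP: "cinner u e = 0" "cinner e u = 0" if "e \<in> P" for e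
      using wP[OF that] Pw[OF that] by (simp_all add: u_def cinner_scaleC_left cinner_scaleC_right)
    have uu: "cinner u u = 1"
      using False by (simp add: cinner_self u_def scaleR_scaleC[symmetric] del: of_real_inverse)
    have u: "u \<notin> P"
      using uP(1)[of u] uu by auto
    have orth: "cinner (\<Sum>e\<in>P. a e *\<^sub>C e) u = 0" for a
      by (simp add: cinner_sum_left cinner_scaleC_left uP)
    have exS: "(\<Sum>e\<in>insert u P. cinner b e *\<^sub>C e) = b" if "b \<in> S" for b
    proof -
      have "cinner b u = 0"
        using orth[of "cinner b"] P(4)[OF that] by simp
      then show ?thesis
        using P(1) u P(4)[OF that] by simp
    qed
    have "cinner v u = cinner q u + cinner w u"
      by (simp add: w_def cinner_diff_left)
    also have "\<dots> = complex_of_real (norm w)"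
      using False unfolding q_def orth
      by (simp add: u_def cinner_scaleC_right cinner_self field_simps power2_eq_square)
    finally have "cinner v u *\<^sub>C u = w"
      using False by (simp add: u_def scaleC_scaleC scaleR_scaleC[symmetric] flip: of_real_mult of_real_inverse)
    then have "(\<Sum>e\<in>insert u P. cinner v e *\<^sub>C e) = v"
      using P(1) u by (simp add: q_def[symmetric] w_def)
    with exS have "\<forall>b\<in>insert v S. (\<Sum>e\<in>insert u P. cinner b e *\<^sub>C e) = b"
      by simp
    moreover have "\<forall>e\<in>insert u P. cinner e e = 1"
      using P(2) uu by simp
    moreover have "\<forall>e\<in>insert u P. \<forall>e'\<in>insert u P. e \<noteq> e' \<longrightarrow> cinner e e' = 0"
      using P(3) uP by simp
    moreover have "finite (insert u P)"
      using P(1) by simp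
    ultimately show ?thesis
      by (intro exI[of _ "insert u P"] conjI)
  qed
qed


subsection \<open>Hilbert tensor products\<close>

text \<open>
  The completion of the algebraic tensor product: the kernel Hilbert space of
  \<open>\<langle>a \<otimes> b, c \<otimes> d\<rangle> = \<langle>a, c\<rangle> \<langle>b, d\<rangle>\<close>; see \<open>cinner_tensor\<close>, \<open>tensor_bilinear\<close> and \<open>tensor_total\<close>.
\<close>

datatype ('a, 'b) pure_tensor = Pure 'a 'b

instantiation pure_tensor :: (chilbert, chilbert) pd_kernel
begin

fun pdk_pure_tensor :: "('a, 'b) pure_tensor \<Rightarrow> ('a, 'b) pure_tensor \<Rightarrow> complex"
  where "pdk_pure_tensor (Pure a b) (Pure c d) = cinner a c * cinner b d"

instance
proof
  fix x y :: "('a, 'b) pure_tensor"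
  show "pdk y x = cnj (pdk x y)"
    by (cases x; cases y) (simp, metis cinner_commute)
next
  fix us :: "(complex \<times> ('a, 'b) pure_tensor) list"
  define B where "B = (\<lambda>(c, x). case x of Pure a b \<Rightarrow> b) ` set us"
  have "finite B"
    by (simp add: B_def)
  then obtain P where P: "\<And>b. b \<in> B \<Longrightarrow> (\<Sum>e\<in>P. cinner b e *\<^sub>C e) = b"
    using finite_orthonormal_expansion[of B] by metis
  show "0 \<le> Re (\<Sum>(c, x)\<leftarrow>us. \<Sum>(d, y)\<leftarrow>us. c * cnj d * pdk x y)"
  proof (rule kernel_sum_nonneg[where P = P and \<phi> = "\<lambda>e x. case x of Pure a b \<Rightarrow> cinner b e *\<^sub>C a"])
    fix x y
    assume xy: "x \<in> snd ` set us" "y \<in> snd ` set us"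
    obtain a b where x: "x = Pure a b" by (cases x)
    obtain c d where y: "y = Pure c d" by (cases y)
    have "b \<in> B"
      using xy(1) by (force simp: B_def x)
    have "cinner b d = cinner (\<Sum>e\<in>P. cinner b e *\<^sub>C e) d"
      by (simp only: P[OF \<open>b \<in> B\<close>])
    also have "\<dots> = (\<Sum>e\<in>P. cinner b e * cinner e d)"
      by (simp only: cinner_sum_left cinner_scaleC_left)
    also have "\<dots> = (\<Sum>e\<in>P. cinner b e * cnj (cinner d e))"
      by (subst (2) cinner_commute) (rule refl)
    finally show "pdk x y = (\<Sum>e\<in>P. cinner (case x of Pure a b \<Rightarrow> cinner b e *\<^sub>C a)
        (case y of Pure a b \<Rightarrow> cinner b e *\<^sub>C a))"
      by (simp add: x y cinner_scaleC_left cinner_scaleC_right sum_distrib_left mult_ac)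
  qed
qed

end

type_synonym ('a, 'b) htensor = "('a, 'b) pure_tensor rkhs"

definition tensor :: "'a::chilbert \<Rightarrow> 'b::chilbert \<Rightarrow> ('a, 'b) htensor"  (infixr \<open>\<otimes>\<^sub>H\<close> 75)
  where "a \<otimes>\<^sub>H b = kvec (Pure a b)"

lemma cinner_tensor: "cinner (a \<otimes>\<^sub>H b) (c \<otimes>\<^sub>H d) = cinner a c * cinner b d"
  by (simp add: tensor_def cinner_kvec)

lemma tensor_bilinear:
  "(a + a') \<otimes>\<^sub>H b = a \<otimes>\<^sub>H b + a' \<otimes>\<^sub>H b" "a \<otimes>\<^sub>H (b + b') = a \<otimes>\<^sub>H b + a \<otimes>\<^sub>H b'"
  "(z *\<^sub>C a) \<otimes>\<^sub>H b = z *\<^sub>C (a \<otimes>\<^sub>H b)" "a \<otimes>\<^sub>H (z *\<^sub>C b) = z *\<^sub>C (a \<otimes>\<^sub>H b)"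
proof -
  have *: "rkhs_apply (a \<otimes>\<^sub>H b) y = (case y of Pure c d \<Rightarrow> cinner a c * cinner b d)"
    for a :: 'a and b :: 'b and y
    by (cases y) (simp add: tensor_def rkhs_apply_kvec)
  show "(a + a') \<otimes>\<^sub>H b = a \<otimes>\<^sub>H b + a' \<otimes>\<^sub>H b" "a \<otimes>\<^sub>H (b + b') = a \<otimes>\<^sub>H b + a \<otimes>\<^sub>H b'"
    "(z *\<^sub>C a) \<otimes>\<^sub>H b = z *\<^sub>C (a \<otimes>\<^sub>H b)" "a \<otimes>\<^sub>H (z *\<^sub>C b) = z *\<^sub>C (a \<otimes>\<^sub>H b)"
    by (rule rkhs_eqI; simp add: * plus_rkhs.rep_eq scaleC_rkhs.rep_eq cinner_add_left
        cinner_scaleC_left algebra_simps split: pure_tensor.split)+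
qed

lemma tensor_total: "closure (range (\<lambda>us. \<Sum>(a, b)\<leftarrow>us. a \<otimes>\<^sub>H b)) = (UNIV :: ('a::chilbert, 'b::chilbert) htensor set)"
proof -
  have "\<exists>vs. (\<Sum>(c, x)\<leftarrow>us. c *\<^sub>C kvec x) = (\<Sum>(a, b)\<leftarrow>vs. a \<otimes>\<^sub>H b)" for us :: "(complex \<times> ('a, 'b) pure_tensor) list"
  proof (induction us)
    case (Cons p us)
    then obtain vs where vs: "(\<Sum>(c, x)\<leftarrow>us. c *\<^sub>C kvec x) = (\<Sum>(a, b)\<leftarrow>vs. a \<otimes>\<^sub>H b)" by blast
    obtain c a b where p: "p = (c, Pure a b)"
      by (metis pure_tensor.exhaust surj_pair)
    have "(\<Sum>(c, x)\<leftarrow>p # us. c *\<^sub>C kvec x) = (\<Sum>(a, b)\<leftarrow>(c *\<^sub>C a, b) # vs. a \<otimes>\<^sub>H b)"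
      using vs by (simp add: p tensor_bilinear) (simp add: tensor_def)
    then show ?case by blast
  qed (rule exI[of _ "[]"], simp)
  then have "range (\<lambda>us. \<Sum>(c, x)\<leftarrow>us. c *\<^sub>C kvec x) \<subseteq> range (\<lambda>us. \<Sum>(a, b)\<leftarrow>us. (a :: 'a) \<otimes>\<^sub>H (b :: 'b))"
    by blast
  from closure_mono[OF this] show ?thesis
    unfolding kvec_total by blast
qed


subsection \<open>The space of square-summable families\<close>

text \<open>With the Kronecker kernel, the vectors \<open>kvec (Index i)\<close> form an orthonormal basis.\<close>

datatype 'i index = Index 'i

instantiation index :: (type) pd_kernel
begin

definition pdk_index :: "'a index \<Rightarrow> 'a index \<Rightarrow> complex"
  where "pdk_index i j = (if i = j then 1 else 0)"

instance
proof
  fix i j :: "'a index"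
  show "pdk j i = cnj (pdk i j)"
    by (simp add: pdk_index_def)
next
  fix us :: "(complex \<times> 'a index) list"
  show "0 \<le> Re (\<Sum>(c, x)\<leftarrow>us. \<Sum>(d, y)\<leftarrow>us. c * cnj d * pdk x y)"
  proof (rule kernel_sum_nonneg[where P = "snd ` set us" and \<phi> = "\<lambda>p x. if x = p then 1 else (0 :: complex)"])
    fix x y
    assume x: "x \<in> snd ` set us"
    have "(\<Sum>p\<in>snd ` set us. cinner (if x = p then 1 else (0 :: complex)) (if y = p then 1 else 0))
        = (\<Sum>p\<in>snd ` set us. if x = p then pdk x y else 0)"
      by (intro sum.cong) (auto simp: cinner_complex_def pdk_index_def)
    also have "\<dots> = pdk x y"
      using x by simp
    finally show "pdk x y = (\<Sum>p\<in>snd ` set us. cinner (if x = p then 1 else (0 :: complex)) (if y = p then 1 else 0))"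
      by (rule sym)
  qed
qed

end

type_synonym 'i ell2 = "'i index rkhs"


subsection \<open>Hilbert spaces and operators on carriers\<close>

text \<open>
  A Hilbert space is a closed complex subspace of a type of class \<^class>\<open>chilbert\<close>; in particular
  \<^term>\<open>UNIV\<close> is one. Operators are functions that matter only on the carrier of their domain, and
  the orthogonal direct sum of \<open>H\<close> and \<open>K\<close> is \<open>H \<times> K\<close>.
\<close>

definition hilbert_space :: "'a::chilbert set \<Rightarrow> bool"
  where "hilbert_space H \<longleftrightarrow> closed H \<and> 0 \<in> H \<and> (\<forall>x\<in>H. \<forall>y\<in>H. x + y \<in> H) \<and> (\<forall>c. \<forall>x\<in>H. c *\<^sub>C x \<in> H)"

definition bounded_ops :: "'a::chilbert set \<Rightarrow> 'b::chilbert set \<Rightarrow> ('a \<Rightarrow> 'b) set"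
  where "bounded_ops H K = {T. (\<forall>x\<in>H. T x \<in> K) \<and> (\<forall>x\<in>H. \<forall>y\<in>H. T (x + y) = T x + T y) \<and>
    (\<forall>c. \<forall>x\<in>H. T (c *\<^sub>C x) = c *\<^sub>C T x) \<and> (\<exists>M. \<forall>x\<in>H. norm (T x) \<le> M * norm x)}"

definition adj :: "'a::chilbert set \<Rightarrow> ('a \<Rightarrow> 'b::chilbert) \<Rightarrow> 'b \<Rightarrow> 'a"
  where "adj H T y = (THE x. x \<in> H \<and> (\<forall>h\<in>H. cinner (T h) y = cinner h x))"

definition isometric_op :: "'a::chilbert set \<Rightarrow> 'b::chilbert set \<Rightarrow> ('a \<Rightarrow> 'b) \<Rightarrow> bool"
  where "isometric_op H K T \<longleftrightarrow> T \<in> bounded_ops H K \<and> (\<forall>x\<in>H. norm (T x) = norm x)"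

definition tensor_op :: "('a::chilbert \<Rightarrow> 'a) \<Rightarrow> ('b::chilbert \<Rightarrow> 'b) \<Rightarrow> ('a, 'b) htensor \<Rightarrow> ('a, 'b) htensor"
  where "tensor_op A B = (THE T. T \<in> bounded_ops UNIV UNIV \<and> (\<forall>a b. T (a \<otimes>\<^sub>H b) = A a \<otimes>\<^sub>H B b))"


subsection \<open>Test functions\<close>

text \<open>The set \<open>X\<close> is the type \<open>'x\<close>.\<close>

inductive_set generated_algebra :: "'x set \<Rightarrow> ('x \<Rightarrow> complex) set \<Rightarrow> ('x \<Rightarrow> complex) set"
  for \<Lambda> :: "'x set" and \<Psi> :: "('x \<Rightarrow> complex) set"
where
  generator: "\<psi> \<in> \<Psi> \<Longrightarrow> restrict \<psi> \<Lambda> \<in> generated_algebra \<Lambda> \<Psi>"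
| const: "(\<lambda>x\<in>\<Lambda>. c) \<in> generated_algebra \<Lambda> \<Psi>"
| add: "f \<in> generated_algebra \<Lambda> \<Psi> \<Longrightarrow> g \<in> generated_algebra \<Lambda> \<Psi> \<Longrightarrow> (\<lambda>x\<in>\<Lambda>. f x + g x) \<in> generated_algebra \<Lambda> \<Psi>"
| mult: "f \<in> generated_algebra \<Lambda> \<Psi> \<Longrightarrow> g \<in> generated_algebra \<Lambda> \<Psi> \<Longrightarrow> (\<lambda>x\<in>\<Lambda>. f x * g x) \<in> generated_algebra \<Lambda> \<Psi>"

definition test_functions :: "('x \<Rightarrow> complex) set \<Rightarrow> bool"
  where "test_functions \<Psi> \<longleftrightarrow>
    (\<forall>x. bdd_above ((\<lambda>\<psi>. cmod (\<psi> x)) ` \<Psi>) \<and> (SUP \<psi>\<in>\<Psi>. cmod (\<psi> x)) < 1) \<and>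
    (\<forall>\<Lambda>. finite \<Lambda> \<longrightarrow> generated_algebra \<Lambda> \<Psi> = extensional \<Lambda>)"

text \<open>
  The topology on \<open>'x \<Rightarrow> complex\<close> used by \<^const>\<open>continuous_on\<close> is the product topology, that is,
  pointwise convergence. Elements of \<open>Cb \<Psi>\<close> are made \<^const>\<open>extensional\<close> so that they are determined
  by their values on \<open>\<Psi>\<close>.
\<close>

definition Cb :: "('x \<Rightarrow> complex) set \<Rightarrow> (('x \<Rightarrow> complex) \<Rightarrow> complex) set"
  where "Cb \<Psi> = {g. g \<in> extensional \<Psi> \<and> continuous_on \<Psi> g \<and> bounded (g ` \<Psi>)}"

definition evaluation :: "('x \<Rightarrow> complex) set \<Rightarrow> 'x \<Rightarrow> ('x \<Rightarrow> complex) \<Rightarrow> complex"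
  where "evaluation \<Psi> x = (\<lambda>\<psi>\<in>\<Psi>. \<psi> x)"


subsection \<open>The Schur--Agler class\<close>

definition positive_kernel :: "('x \<Rightarrow> 'x \<Rightarrow> 'f::chilbert \<Rightarrow> 'f) \<Rightarrow> bool"
  where "positive_kernel K \<longleftrightarrow> (\<forall>x y. K x y \<in> bounded_ops UNIV UNIV) \<and>
    (\<forall>N (x :: nat \<Rightarrow> 'x) (h :: nat \<Rightarrow> 'f).
      (\<Sum>i<N. \<Sum>j<N. cinner (K (x i) (x j) (h i)) (h j)) \<in> \<real>\<^sub>\<ge>\<^sub>0)"

definition admissible_kernels :: "('x \<Rightarrow> complex) set \<Rightarrow> ('x \<Rightarrow> 'x \<Rightarrow> 'f::chilbert \<Rightarrow> 'f) set"
  where "admissible_kernels \<Psi> = {S. positive_kernel S \<and>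
    (\<forall>\<psi>\<in>\<Psi>. positive_kernel (\<lambda>x y h. (1 - \<psi> x * cnj (\<psi> y)) *\<^sub>C S x y h))}"

definition schur_agler_bounds :: "('x \<Rightarrow> complex) set \<Rightarrow> ('x \<Rightarrow> 'e::chilbert \<Rightarrow> 'e) \<Rightarrow> real set"
  where "schur_agler_bounds \<Psi> f = {C. 0 \<le> C \<and> (\<forall>S\<in>admissible_kernels \<Psi>.
    positive_kernel (\<lambda>x y. tensor_op (\<lambda>v :: 'e. complex_of_real (C\<^sup>2) *\<^sub>C v - adj UNIV (f y) (f x v))
      (S x y :: 'e \<Rightarrow> 'e)))}"

definition H_infty :: "('x \<Rightarrow> complex) set \<Rightarrow> ('x \<Rightarrow> 'e::chilbert \<Rightarrow> 'e) set"
  where "H_infty \<Psi> = {f. (\<forall>x. f x \<in> bounded_ops UNIV UNIV) \<and> schur_agler_bounds \<Psi> f \<noteq> {}}"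

definition schur_agler_class :: "('x \<Rightarrow> complex) set \<Rightarrow> ('x \<Rightarrow> 'e::chilbert \<Rightarrow> 'e) set"
  where "schur_agler_class \<Psi> = {f \<in> H_infty \<Psi>. Inf (schur_agler_bounds \<Psi> f) \<le> 1}"


subsection \<open>Representations and colligations\<close>

definition unital_star_rep ::
    "('x \<Rightarrow> complex) set \<Rightarrow> 'h::chilbert set \<Rightarrow> ((('x \<Rightarrow> complex) \<Rightarrow> complex) \<Rightarrow> 'h \<Rightarrow> 'h) \<Rightarrow> bool"
  where "unital_star_rep \<Psi> H \<rho> \<longleftrightarrow>
    (\<forall>g\<in>Cb \<Psi>. \<rho> g \<in> bounded_ops H H) \<and>
    (\<forall>v\<in>H. \<rho> (\<lambda>\<psi>\<in>\<Psi>. 1) v = v) \<and>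
    (\<forall>f\<in>Cb \<Psi>. \<forall>g\<in>Cb \<Psi>. \<forall>v\<in>H. \<rho> (\<lambda>\<psi>\<in>\<Psi>. f \<psi> + g \<psi>) v = \<rho> f v + \<rho> g v) \<and>
    (\<forall>c. \<forall>g\<in>Cb \<Psi>. \<forall>v\<in>H. \<rho> (\<lambda>\<psi>\<in>\<Psi>. c * g \<psi>) v = c *\<^sub>C \<rho> g v) \<and>
    (\<forall>f\<in>Cb \<Psi>. \<forall>g\<in>Cb \<Psi>. \<forall>v\<in>H. \<rho> (\<lambda>\<psi>\<in>\<Psi>. f \<psi> * g \<psi>) v = \<rho> f (\<rho> g v)) \<and>
    (\<forall>g\<in>Cb \<Psi>. \<forall>v\<in>H. \<rho> (\<lambda>\<psi>\<in>\<Psi>. cnj (g \<psi>)) v = adj H (\<rho> g) v)"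

definition reducible_rep :: "('x \<Rightarrow> complex) set \<Rightarrow> 'h::chilbert set \<Rightarrow> 'k::chilbert set \<Rightarrow>
    ((('x \<Rightarrow> complex) \<Rightarrow> complex) \<Rightarrow> 'h \<times> 'k \<Rightarrow> 'h \<times> 'k) \<Rightarrow> bool"
  where "reducible_rep \<Psi> H K \<rho> \<longleftrightarrow> unital_star_rep \<Psi> (H \<times> K) \<rho> \<and>
    (\<forall>g\<in>Cb \<Psi>. \<rho> g ` (H \<times> {0}) \<subseteq> H \<times> {0} \<and> \<rho> g ` ({0} \<times> K) \<subseteq> {0} \<times> K)"

text \<open>
  In the transfer function below, \<open>I - D \<rho>(E(x))\<close> is boundedly invertible on \<open>H1 \<times> H2\<close>, because \<open>D\<close>
  is a compression of an isometry and \<open>\<rho>(E(x))\<close> has norm at most \<open>sup |\<psi>(x)| < 1\<close>; so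
  \<^const>\<open>the_inv_into\<close> is its inverse operator.
\<close>

definition block_realization :: "('x \<Rightarrow> complex) set \<Rightarrow> 'x \<Rightarrow> ('x \<Rightarrow> 'e::chilbert \<Rightarrow> 'e) \<Rightarrow>
    'h::chilbert set \<Rightarrow> 'k::chilbert set \<Rightarrow> bool"
  where "block_realization \<Psi> x0 \<theta> H1 H2 \<longleftrightarrow>
    (\<exists>\<rho>. \<exists>B1\<in>bounded_ops H1 UNIV. \<exists>B2\<in>bounded_ops H2 UNIV.
      \<exists>C1\<in>bounded_ops UNIV H1. \<exists>C2\<in>bounded_ops UNIV H2.
      \<exists>D1\<in>bounded_ops H1 H1. \<exists>D2\<in>bounded_ops H2 H1. \<exists>D3\<in>bounded_ops H2 H2.
      \<exists>A1\<in>bounded_ops (UNIV :: 'e set) (UNIV :: 'e set). \<exists>A2\<in>bounded_ops (UNIV :: 'e set) (UNIV :: 'e set).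
      \<exists>X1\<in>bounded_ops UNIV H1. \<exists>Y2\<in>bounded_ops H2 UNIV.
      let A = \<theta> x0;
          B = (\<lambda>(h, k). B1 h + B2 k);
          C = (\<lambda>e. (C1 e, C2 e));
          D = (\<lambda>(h, k). (D1 h + D2 k, D3 k));
          U = (\<lambda>(e, v). (A e + B v, C e + D v))
      in reducible_rep \<Psi> H1 H2 \<rho> \<and>
        isometric_op (UNIV \<times> (H1 \<times> H2)) (UNIV \<times> (H1 \<times> H2)) U \<and>
        (\<forall>e. A e = A1 (A2 e)) \<and> (\<forall>k\<in>H2. B2 k = A1 (Y2 k)) \<and>
        (\<forall>e. C1 e = X1 (A2 e)) \<and> (\<forall>k\<in>H2. D2 k = X1 (Y2 k)) \<and>
        (\<forall>e. adj UNIV A1 (A1 e) + adj UNIV X1 (X1 e) = e) \<and>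
        inj_on (adj UNIV A2) ((\<lambda>h. adj UNIV A1 (B1 h) + adj UNIV X1 (D1 h)) ` H1) \<and>
        (\<forall>x e. \<theta> x e = A e + B (\<rho> (evaluation \<Psi> x)
          (the_inv_into (H1 \<times> H2) (\<lambda>v. v - D (\<rho> (evaluation \<Psi> x) v)) (C e)))))"

text \<open>
  HOL cannot quantify over types inside a formula, so an existential over Hilbert spaces ranges over
  the closed subspaces of one fixed large space. The following index type is large enough for the
  spaces occurring here: a space spanned by vectors indexed by \<open>g \<in> Cb \<Psi>\<close>, \<open>x :: 'x\<close> and \<open>e :: 'e\<close>
  consists, as a reproducing kernel space, of functions on the set of triples, and the factor
  \<^typ>\<open>nat\<close> leaves room for countably many copies. The implication from a block realization to a
  factorization does not depend on the choice and can be asserted for spaces in arbitrary types.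
\<close>

type_synonym ('x, 'e) universe = "(nat \<times> ((('x \<Rightarrow> complex) \<Rightarrow> complex) \<times> 'x \<times> 'e \<Rightarrow> complex)) ell2"

end

theory Submission
  imports Defs
begin

text \<open>
  An isometric colligation \<open>U\<close> together with a representation \<open>\<rho>\<close> has a transfer function in the
  Schur--Agler class, because \<open>\<rho>\<close> is completely positive; conversely every Schur--Agler function
  arises in this way. The block operator of the theorem is the product of two colligations, one for each
  state space, and the transfer function of a product is the product of the transfer functions. The
  conditions on \<open>A\<^sub>1\<close>, \<open>X\<^sub>1\<close> and \<open>A\<^sub>2\<^sup>*\<close> are exactly what makes both factors of an isometric
  product isometric.

  The converse is obtained by duality: if the defect \<open>\<langle>e, e'\<rangle> - \<langle>f(x) e, f(y) e'\<rangle>\<close> were not in the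
  closure of the cone of sums \<open>\<Sum> c\<^sub>k(a) cnj(c\<^sub>k(b)) (1 - \<psi>\<^sub>k(x) cnj(\<psi>\<^sub>k(y)))\<close> on a finite set, a
  separating functional would be an admissible kernel violating the Schur--Agler condition. A
  compactness argument turns the finite approximations into an exact decomposition of the defect, from
  which the state space, the representation and the isometry are read off.
\<close>

subsection \<open>Complex Hilbert spaces\<close>

text \<open>Two constraints shape the construction. The Schur-Agler condition is tested only against
  kernels with values in B(E), tensored with the defect; positivity is therefore handled by scalar
  kernels (\<open>psd\<close>) on enlarged point sets, where coefficients are absorbed into vectors
  and Schur products are available. Moreover, all state spaces have to be closed subspaces of one
  type fixed in advance. Comparing Gram matrices yields an isometry only between two subspaces of E
  + H, and it has to be extended to all of E + H without leaving H. So H consists from the outset of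
  infinitely many orthogonal copies of a module, and the partial isometry is completed by a shift,
  as in Hilbert's hotel; this suffices because U is only required to be isometric. Compactness needs
  bounds that do not depend on the finite set. They come from sup |\<psi>(x)| < 1, by which the
  diagonal values of an Agler sum control its coefficients. The condition E(x0) = 0 removes the
  state from the transfer functions at x0, so that \<theta>(x0) is the product of the two corner
  operators A1 and A2.\<close>

lemma scaleC_one [simp]: "1 *\<^sub>C x = (x :: 'a::chilbert)"
  using scaleR_scaleC[of 1 x] by simp

lemma scaleC_zero_right [simp]: "c *\<^sub>C 0 = (0 :: 'a::chilbert)"
  using scaleC_add_right[of c 0 "0 :: 'a"] by simp

lemma scaleC_minus1 [simp]: "(-1) *\<^sub>C x = - (x :: 'a::chilbert)"
  using scaleR_scaleC[of "-1" x] by simp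

lemma scaleC_minus_left: "(- c) *\<^sub>C x = - (c *\<^sub>C (x :: 'a::chilbert))"
  using scaleC_scaleC[of "-1" c x] by simp

lemma scaleC_minus_right: "c *\<^sub>C (- x) = - (c *\<^sub>C (x :: 'a::chilbert))"
  using scaleC_scaleC[of c "-1" x] scaleC_scaleC[of "-1" c x] by simp

lemma scaleC_diff_right: "c *\<^sub>C (x - y) = c *\<^sub>C x - c *\<^sub>C (y :: 'a::chilbert)"
  using scaleC_add_right[of c x "- y"] by (simp add: scaleC_minus_right)

lemma scaleC_sum_right: "c *\<^sub>C (\<Sum>i\<in>I. f i) = (\<Sum>i\<in>I. c *\<^sub>C (f i :: 'a::chilbert))"
  by (induction I rule: infinite_finite_induct) (simp_all add: scaleC_add_right)

lemma cinner_minus_right [simp]: "cinner (x :: 'a::chilbert) (- y) = - cinner x y"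
  using cinner_add_right[of x y "- y"] by (simp add: add_eq_0_iff)

lemma cinner_diff_right: "cinner z (x - y) = cinner z x - cinner z (y :: 'a::chilbert)"
  using cinner_add_right[of z x "- y"] by simp

lemma cinner_sum_right: "cinner (y :: 'a::chilbert) (\<Sum>i\<in>I. f i) = (\<Sum>i\<in>I. cinner y (f i))"
  by (induction I rule: infinite_finite_induct) (simp_all add: cinner_add_right)

lemma cinner_self_eq_zero [simp]: "cinner x x = 0 \<longleftrightarrow> x = (0 :: 'a::chilbert)"
  by (simp add: cinner_self)

lemma cinner_swap_zero: "cinner x y = 0 \<longleftrightarrow> cinner y (x :: 'a::chilbert) = 0"
  by (metis cinner_commute complex_cnj_zero)

lemma norm_scaleC: "norm (c *\<^sub>C x) = cmod c * norm (x :: 'a::chilbert)"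
proof -
  have "cinner (c *\<^sub>C x) (c *\<^sub>C x) = (c * cnj c) * cinner x x"
    by (simp add: cinner_scaleC_left cinner_scaleC_right)
  also have "\<dots> = complex_of_real ((cmod c * norm x)\<^sup>2)"
    by (simp only: cinner_self complex_norm_square[symmetric] power_mult_distrib of_real_mult of_real_power)
  finally have "(norm (c *\<^sub>C x))\<^sup>2 = (cmod c * norm x)\<^sup>2"
    by (simp only: cinner_self of_real_eq_iff)
  then show ?thesis
    by (simp add: power2_eq_iff_nonneg)
qed

lemma cinner_cmod_le: "cmod (cinner x y) \<le> norm x * norm (y :: 'a::chilbert)"
proof (cases "cinner x y = 0")
  case False
  define z where "z = cinner x y"
  \<comment> \<open>Rotating x by the phase s makes the inner product equal to its modulus, and the
    real Cauchy-Schwarz inequality applies.\<close>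
  define s where "s = cnj z / of_real (cmod z)"
  have "cmod s = 1"
    using False by (simp add: s_def z_def norm_divide)
  have "s * z = of_real (cmod z)"
    using complex_norm_square[of z] False by (simp add: s_def z_def field_simps power2_eq_square)
  then have "cmod z = Re (cinner (s *\<^sub>C x) y)"
    by (simp add: cinner_scaleC_left z_def)
  also have "\<dots> \<le> norm (s *\<^sub>C x) * norm y"
    using norm_cauchy_schwarz[of "s *\<^sub>C x" y] by (simp add: inner_cinner)
  finally show ?thesis
    using \<open>cmod s = 1\<close> by (simp add: norm_scaleC z_def)
qed simp

lemma bounded_bilinear_cinner: "bounded_bilinear (cinner :: 'a::chilbert \<Rightarrow> 'a \<Rightarrow> complex)"
proof (rule bounded_bilinear.intro)
  show "\<exists>K. \<forall>a b. cmod (cinner a b) \<le> norm (a :: 'a) * norm b * K"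
    by (rule exI[of _ 1]) (simp add: cinner_cmod_le)
qed (simp_all add: cinner_add_left cinner_add_right scaleR_scaleC cinner_scaleC_left
    cinner_scaleC_right scaleC_complex_def scaleR_conv_of_real)

lemmas tendsto_cinner = bounded_bilinear.tendsto[OF bounded_bilinear_cinner]
lemmas continuous_on_cinner [continuous_intros] = bounded_bilinear.continuous_on[OF bounded_bilinear_cinner]

lemma bounded_linear_scaleC: "bounded_linear (\<lambda>x :: 'a::chilbert. c *\<^sub>C x)"
  by (rule bounded_linear_intro[where K = "cmod c"])
    (simp_all add: scaleC_add_right norm_scaleC scaleR_scaleC scaleC_scaleC mult.commute)

lemmas tendsto_scaleC = bounded_linear.tendsto[OF bounded_linear_scaleC]

lemma norm_eqI_cinner: "cinner x x = cinner y y \<Longrightarrow> norm (x :: 'a::chilbert) = norm (y :: 'b::chilbert)"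
  unfolding cinner_self of_real_eq_iff by (simp add: power2_eq_iff_nonneg)

lemma pythagoras: "cinner x y = 0 \<Longrightarrow> (norm (x + y))\<^sup>2 = (norm x)\<^sup>2 + (norm (y :: 'a::chilbert))\<^sup>2"
proof -
  assume "cinner x y = 0"
  moreover from this have "cinner y x = 0"
    using cinner_swap_zero by blast
  ultimately have "cinner (x + y) (x + y) = cinner x x + cinner y y"
    by (simp add: cinner_add_left cinner_add_right)
  then have "complex_of_real ((norm (x + y))\<^sup>2) = of_real ((norm x)\<^sup>2 + (norm y)\<^sup>2)"
    by (simp add: cinner_self)
  then show ?thesis
    by (simp only: of_real_eq_iff)
qed

subsection \<open>Closed subspaces\<close>

lemma hilbert_spaceD:
  assumes "hilbert_space H"
  shows hilbert_space_closed: "closed H" and hilbert_space_zero: "0 \<in> H"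
    and hilbert_space_add: "x \<in> H \<Longrightarrow> y \<in> H \<Longrightarrow> x + y \<in> H"
    and hilbert_space_scaleC: "x \<in> H \<Longrightarrow> c *\<^sub>C x \<in> H"
    and hilbert_space_minus: "x \<in> H \<Longrightarrow> - x \<in> H"
    and hilbert_space_diff: "x \<in> H \<Longrightarrow> y \<in> H \<Longrightarrow> x - y \<in> H"
    and hilbert_space_scaleR: "x \<in> H \<Longrightarrow> r *\<^sub>R x \<in> H"
proof -
  show c: "x \<in> H \<Longrightarrow> c *\<^sub>C x \<in> H" for x c
    using assms by (simp add: hilbert_space_def)
  show a: "x \<in> H \<Longrightarrow> y \<in> H \<Longrightarrow> x + y \<in> H" for x y
    using assms by (simp add: hilbert_space_def)
  show m: "x \<in> H \<Longrightarrow> - x \<in> H" for x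
    using c[of x "-1"] by simp
  show "x \<in> H \<Longrightarrow> y \<in> H \<Longrightarrow> x - y \<in> H"
    using a[of x "- y"] m[of y] by simp
  show "x \<in> H \<Longrightarrow> r *\<^sub>R x \<in> H"
    by (simp add: scaleR_scaleC c)
  show "closed H" "0 \<in> H"
    using assms by (simp_all add: hilbert_space_def)
qed

lemma hilbert_space_sum:
  "hilbert_space H \<Longrightarrow> (\<And>i. i \<in> I \<Longrightarrow> f i \<in> H) \<Longrightarrow> (\<Sum>i\<in>I. f i) \<in> H"
  by (induction I rule: infinite_finite_induct) (auto simp: hilbert_space_zero hilbert_space_add)

lemma hilbert_space_UNIV [simp]: "hilbert_space UNIV"
  by (simp add: hilbert_space_def)

lemma hilbert_space_singleton_0 [simp]: "hilbert_space {0}"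
  by (simp add: hilbert_space_def)

lemma scaleC_Pair: "c *\<^sub>C (x, y) = (c *\<^sub>C x, c *\<^sub>C y)"
  by (simp add: scaleC_prod_def)

lemma cinner_Pair: "cinner (x, y) (x', y') = cinner x x' + cinner y y'"
  by (simp add: cinner_prod_def)

lemma norm_Pair_square: "(norm (x, y))\<^sup>2 = (norm x)\<^sup>2 + (norm y)\<^sup>2"
  by (simp add: norm_prod_def)

lemma hilbert_space_Times: "hilbert_space H \<Longrightarrow> hilbert_space K \<Longrightarrow> hilbert_space (H \<times> K)"
  unfolding hilbert_space_def by (auto simp: scaleC_Pair zero_prod_def closed_Times)

lemma hilbert_space_Inter: "(\<And>H. H \<in> \<H> \<Longrightarrow> hilbert_space H) \<Longrightarrow> hilbert_space (\<Inter>\<H>)"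
  unfolding hilbert_space_def by (auto intro: closed_Inter)

lemma hilbert_space_Collect_all:
  "(\<And>i. hilbert_space {x. P i x}) \<Longrightarrow> hilbert_space {x. \<forall>i. P i x}"
  unfolding hilbert_space_def by (auto intro: closed_Collect_all)

lemma hilbert_space_Collect_imp:
  "(Q \<Longrightarrow> hilbert_space {x. P x}) \<Longrightarrow> hilbert_space {x. Q \<longrightarrow> P x}"
  by (cases Q) (simp_all add: Collect_conv_if)

lemma hilbert_space_Collect_ball:
  "(\<And>i. i \<in> A \<Longrightarrow> hilbert_space {x. P i x}) \<Longrightarrow> hilbert_space {x. \<forall>i\<in>A. P i x}"
  unfolding Ball_def by (intro hilbert_space_Collect_all hilbert_space_Collect_imp)

lemma hilbert_space_ortho_left: "hilbert_space {x. cinner x y = 0}"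
  unfolding hilbert_space_def
  by (auto simp: cinner_add_left cinner_scaleC_left intro!: closed_Collect_eq continuous_intros)

lemma hilbert_space_ortho_right: "hilbert_space {y. cinner x y = 0}"
  unfolding hilbert_space_def
  by (auto simp: cinner_add_right cinner_scaleC_right intro!: closed_Collect_eq continuous_intros)

section \<open>Closed linear spans\<close>

definition hspan :: "'a::chilbert set \<Rightarrow> 'a set"
  where "hspan A = \<Inter>{H. hilbert_space H \<and> A \<subseteq> H}"

lemma hilbert_space_hspan [simp]: "hilbert_space (hspan A)"
  unfolding hspan_def by (rule hilbert_space_Inter) simp

lemma hspan_superset: "A \<subseteq> hspan A"
  unfolding hspan_def by blast

lemma hspan_base: "a \<in> A \<Longrightarrow> a \<in> hspan A"
  using hspan_superset by blast

lemma hspan_minimal: "hilbert_space H \<Longrightarrow> A \<subseteq> H \<Longrightarrow> hspan A \<subseteq> H"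
  unfolding hspan_def by blast

lemma hspan_mono: "A \<subseteq> B \<Longrightarrow> hspan A \<subseteq> hspan B"
  by (rule hspan_minimal) (use hspan_superset[of B] in auto)

lemma hspan_induct [consumes 1, case_names space base]:
  assumes "x \<in> hspan A" "hilbert_space {x. P x}" "\<And>a. a \<in> A \<Longrightarrow> P a"
  shows "P x"
  using hspan_minimal[OF assms(2), of A] assms(1,3) by blast

lemma hspan_ortho:
  assumes "x \<in> hspan A" "y \<in> hspan B" "\<And>a b. a \<in> A \<Longrightarrow> b \<in> B \<Longrightarrow> cinner a b = 0"
  shows "cinner x y = 0"
proof -
  have "\<forall>b\<in>B. cinner x b = 0"
    using assms(1) by (induction rule: hspan_induct)
      (auto intro!: hilbert_space_Collect_ball hilbert_space_ortho_left assms(3))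
  then show ?thesis
    using hspan_induct[OF assms(2) hilbert_space_ortho_right[of x]] by blast
qed

lemma hspan_eq_zero:
  assumes "x \<in> hspan A" "\<And>a. a \<in> A \<Longrightarrow> cinner x a = 0"
  shows "x = 0"
proof -
  have "cinner x x = 0"
    by (rule hspan_induct[OF assms(1), of "\<lambda>y. cinner x y = 0"])
      (auto intro: hilbert_space_ortho_right assms(2))
  then show ?thesis by simp
qed

lemma hspan_eqI:
  assumes "x \<in> hspan A" "y \<in> hspan A" "\<And>a. a \<in> A \<Longrightarrow> cinner x a = cinner y a"
  shows "x = y"
  using hspan_eq_zero[of "x - y" A] assms by (simp add: hilbert_space_diff cinner_diff_left)

text \<open>Links the span, defined as an intersection, with finite combinations, on which quadratic
  forms can be evaluated.\<close>

lemma hspan_range: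
  fixes v :: "'i \<Rightarrow> 'a::chilbert"
  shows "hspan (range v) = closure {\<Sum>i<n. c i *\<^sub>C v (x i) | (n::nat) c x. True}" (is "_ = closure ?C")
proof
  have zero: "0 \<in> ?C"
    by (rule CollectI, rule exI[of _ 0]) simp
  have add: "a + b \<in> ?C" if ab: "a \<in> ?C" "b \<in> ?C" for a b
  proof -
    obtain n :: nat and c x where a: "a = (\<Sum>i<n. c i *\<^sub>C v (x i))" using ab(1) by blast
    obtain m :: nat and d y where b: "b = (\<Sum>i<m. d i *\<^sub>C v (y i))" using ab(2) by blast
    \<comment> \<open>The two combinations are concatenated: indices from n on belong to b.\<close>
    define e where "e i = (if i < n then c i else d (i - n))" for i
    define z where "z i = (if i < n then x i else y (i - n))" for i
    have "(\<Sum>i<n + m. e i *\<^sub>C v (z i)) = (\<Sum>i<n. e i *\<^sub>C v (z i)) + (\<Sum>i<m. e (n + i) *\<^sub>C v (z (n + i)))"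
      by (induction m) (simp_all add: add.assoc)
    also have "\<dots> = a + b"
      by (simp add: a b e_def z_def)
    finally have "a + b = (\<Sum>i<n + m. e i *\<^sub>C v (z i))" ..
    then show ?thesis by blast
  qed
  have scale: "d *\<^sub>C a \<in> ?C" if a: "a \<in> ?C" for a d
  proof -
    obtain n :: nat and c x where a: "a = (\<Sum>i<n. c i *\<^sub>C v (x i))" using a by blast
    have "d *\<^sub>C a = (\<Sum>i<n. (d * c i) *\<^sub>C v (x i))"
      by (simp add: a scaleC_sum_right scaleC_scaleC)
    then show ?thesis by (intro CollectI exI conjI) auto
  qed
  define C where "C = ?C"
  note zero = zero[folded C_def] and add = add[folded C_def] and scale = scale[folded C_def]
  have "hilbert_space (closure C)"
    unfolding hilbert_space_def
  proof (intro conjI ballI allI)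
    show "0 \<in> closure C" using zero closure_subset by (rule rev_subsetD)
  next
    fix a b assume "a \<in> closure C" "b \<in> closure C"
    then obtain f g where f: "\<forall>n. f n \<in> C" "f \<longlonglongrightarrow> a" and g: "\<forall>n. g n \<in> C" "g \<longlonglongrightarrow> b"
      unfolding closure_sequential by blast
    have "\<forall>n. f n + g n \<in> C" "(\<lambda>n. f n + g n) \<longlonglongrightarrow> a + b"
      using add f g by (blast, intro tendsto_intros)
    then show "a + b \<in> closure C" unfolding closure_sequential by (intro exI conjI)
  next
    fix a and d :: complex assume "a \<in> closure C"
    then obtain f where f: "\<forall>n. f n \<in> C" "f \<longlonglongrightarrow> a"
      unfolding closure_sequential by blast
    have "\<forall>n. d *\<^sub>C f n \<in> C" "(\<lambda>n. d *\<^sub>C f n) \<longlonglongrightarrow> d *\<^sub>C a"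
      using scale f by (blast, intro tendsto_scaleC)
    then show "d *\<^sub>C a \<in> closure C" unfolding closure_sequential by (intro exI conjI)
  qed simp
  moreover have "v i \<in> C" for i
    unfolding C_def by (rule CollectI, intro exI[of _ "1 :: nat"] exI[of _ "\<lambda>_. 1"] exI[of _ "\<lambda>_. i"]) simp
  ultimately have "hspan (range v) \<subseteq> closure C"
    using closure_subset[of C] by (intro hspan_minimal) auto
  then show "hspan (range v) \<subseteq> closure ?C"
    by (simp only: C_def)
  have "C \<subseteq> hspan (range v)"
    unfolding C_def
    by clarify (rule hilbert_space_sum[OF hilbert_space_hspan],
        rule hilbert_space_scaleC[OF hilbert_space_hspan], rule hspan_base, simp)
  then have "closure C \<subseteq> hspan (range v)"
    by (simp add: closure_minimal hilbert_space_closed)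
  then show "closure ?C \<subseteq> hspan (range v)"
    by (simp only: C_def)
qed

subsection \<open>Closest points and orthogonal projections\<close>

lemma closest_point_ex:
  fixes S :: "'a::chilbert set"
  assumes "closed S" "convex S" "S \<noteq> {}"
  shows "\<exists>p\<in>S. \<forall>y\<in>S. norm (x - p) \<le> norm (x - y)"
proof -
  define d where "d = (INF y\<in>S. norm (x - y))"
  have bdd: "bdd_below ((\<lambda>y. norm (x - y)) ` S)"
    by (rule bdd_belowI[of _ 0]) auto
  have dle: "d \<le> norm (x - y)" if "y \<in> S" for y
    unfolding d_def by (rule cINF_lower[OF bdd that])
  have d0: "0 \<le> d"
    unfolding d_def by (rule cINF_greatest) (use assms in auto)
  have "\<exists>y\<in>S. norm (x - y) < d + inverse (real (Suc n))" for n
  proof -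
    have "\<exists>z\<in>(\<lambda>y. norm (x - y)) ` S. z < d + inverse (real (Suc n))"
      using assms(3) by (intro cInf_lessD) (auto simp: d_def[symmetric])
    then show ?thesis by blast
  qed
  then obtain y where y: "\<And>n. y n \<in> S" "\<And>n. norm (x - y n) < d + inverse (real (Suc n))"
    by metis
  \<comment> \<open>Parallelogram law: the midpoint of y m and y n lies in S and so has distance at
    least d from x, which forces a minimizing sequence to be Cauchy.\<close>
  have par: "(norm (y m - y n))\<^sup>2 \<le> 2 * (norm (x - y m))\<^sup>2 + 2 * (norm (x - y n))\<^sup>2 - 4 * d\<^sup>2" for m n
  proof -
    have "(1/2) *\<^sub>R y m + (1/2) *\<^sub>R y n \<in> S"
      using convexD[OF assms(2) y(1)[of m] y(1)[of n], of "1/2" "1/2"] by simp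
    from dle[OF this] have "d \<le> norm (x - ((1/2) *\<^sub>R y m + (1/2) *\<^sub>R y n))" .
    also have "x - ((1/2) *\<^sub>R y m + (1/2) *\<^sub>R y n) = (1/2) *\<^sub>R ((x - y m) + (x - y n))"
      by (simp add: scaleR_diff_right scaleR_add_right algebra_simps flip: scaleR_add_left)
    finally have "2 * d \<le> norm ((x - y m) + (x - y n))"
      by simp
    then have "(2 * d)\<^sup>2 \<le> (norm ((x - y m) + (x - y n)))\<^sup>2"
      using d0 by (intro power_mono) auto
    moreover have "(norm ((x - y m) + (x - y n)))\<^sup>2 + (norm ((x - y n) - (x - y m)))\<^sup>2
        = 2 * (norm (x - y m))\<^sup>2 + 2 * (norm (x - y n))\<^sup>2"
      unfolding power2_norm_eq_inner inner_add_left inner_add_right inner_diff_left inner_diff_right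
      by (simp add: inner_commute)
    ultimately show ?thesis by (simp add: power_mult_distrib)
  qed
  have lim: "(\<lambda>n. norm (x - y n)) \<longlonglongrightarrow> d"
  proof (rule tendsto_sandwich)
    show "\<forall>\<^sub>F n in sequentially. d \<le> norm (x - y n)"
      using dle y(1) by simp
    show "\<forall>\<^sub>F n in sequentially. norm (x - y n) \<le> d + inverse (real (Suc n))"
      by (intro always_eventually allI less_imp_le y(2))
    show "(\<lambda>n. d + inverse (real (Suc n))) \<longlonglongrightarrow> d"
      using tendsto_add[OF tendsto_const LIMSEQ_inverse_real_of_nat] by simp
  qed simp
  have "Cauchy y"
  proof (rule CauchyI)
    fix e :: real assume e: "e > 0"
    have "(\<lambda>n. (norm (x - y n))\<^sup>2) \<longlonglongrightarrow> d\<^sup>2"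
      using lim by (intro tendsto_intros)
    then obtain N where N: "\<And>n. n \<ge> N \<Longrightarrow> \<bar>(norm (x - y n))\<^sup>2 - d\<^sup>2\<bar> < e\<^sup>2 / 4"
      using e by (metis (no_types, lifting) LIMSEQ_D divide_pos_pos real_norm_def zero_less_numeral zero_less_power)
    have "norm (y m - y n) < e" if "m \<ge> N" "n \<ge> N" for m n
    proof -
      have "(norm (y m - y n))\<^sup>2 < e\<^sup>2"
        using par[of m n] N[OF that(1)] N[OF that(2)] by linarith
      then show ?thesis using e by (simp add: power_less_imp_less_base)
    qed
    then show "\<exists>M. \<forall>m\<ge>M. \<forall>n\<ge>M. norm (y m - y n) < e" by blast
  qed
  then obtain p where p: "y \<longlonglongrightarrow> p"
    using Cauchy_convergent convergent_def by blast
  have "p \<in> S"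
    using closed_sequentially[OF assms(1) _ p] y(1) by blast
  moreover have "norm (x - p) = d"
    by (rule LIMSEQ_unique[OF _ lim]) (intro tendsto_intros p)
  ultimately show ?thesis
    using dle by auto
qed

text \<open>Used for two kinds of sets: for subspaces it gives the orthogonal projection, for the
  closed cone of Agler sums it gives the separating functional.\<close>

lemma closest_point_variational:
  fixes S :: "'a::chilbert set"
  assumes "closed S" "convex S" "S \<noteq> {}"
  shows "\<exists>p\<in>S. \<forall>y\<in>S. inner (x - p) (y - p) \<le> 0"
proof -
  obtain p where p: "p \<in> S" "\<And>y. y \<in> S \<Longrightarrow> norm (x - p) \<le> norm (x - y)"
    using closest_point_ex[OF assms, of x] by blast
  have "inner (x - p) (y - p) \<le> 0" if y: "y \<in> S" for y
  proof (rule ccontr)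
    assume "\<not> ?thesis"
    then have a: "inner (x - p) (y - p) > 0" by simp
    then have "y - p \<noteq> 0" by auto
    then have n: "(norm (y - p))\<^sup>2 > 0" by simp
    \<comment> \<open>The minimizer of the distance to x along the line from p through y, cut off at
      the endpoint y of the segment.\<close>
    define t where "t = min 1 (inner (x - p) (y - p) / (norm (y - p))\<^sup>2)"
    have t: "0 < t" "t \<le> 1" "t * (norm (y - p))\<^sup>2 \<le> inner (x - p) (y - p)"
      using a n by (auto simp: t_def min_def field_simps)
    have "(1 - t) *\<^sub>R p + t *\<^sub>R y \<in> S"
      using convexD_alt[OF assms(2) p(1) y] t by simp
    from p(2)[OF this] have "(norm (x - p))\<^sup>2 \<le> (norm (x - ((1 - t) *\<^sub>R p + t *\<^sub>R y)))\<^sup>2"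
      by (simp add: power_mono)
    also have "x - ((1 - t) *\<^sub>R p + t *\<^sub>R y) = (x - p) - t *\<^sub>R (y - p)"
      by (simp add: algebra_simps)
    also have "(norm \<dots>)\<^sup>2 = (norm (x - p))\<^sup>2 - 2 * t * inner (x - p) (y - p) + t * (t * (norm (y - p))\<^sup>2)"
      unfolding power2_norm_eq_inner
      by (simp add: inner_diff_left inner_diff_right inner_commute algebra_simps)
    finally have "2 * t * inner (x - p) (y - p) \<le> t * (t * (norm (y - p))\<^sup>2)"
      by simp
    also have "\<dots> \<le> t * inner (x - p) (y - p)"
      using t by (intro mult_left_mono) auto
    finally show False
      using t(1) a by (simp add: mult_less_0_iff)
  qed
  with p(1) show ?thesis by blast
qed

lemma projection_ex:
  fixes H :: "'a::chilbert set"
  assumes "hilbert_space H"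
  shows "\<exists>!p. p \<in> H \<and> (\<forall>h\<in>H. cinner (x - p) h = 0)"
proof -
  note H = hilbert_spaceD[OF assms]
  have "convex H"
    unfolding convex_def by (auto intro!: H)
  moreover have "H \<noteq> {}"
    using H(2) by blast
  ultimately obtain p where p: "p \<in> H" "\<And>y. y \<in> H \<Longrightarrow> inner (x - p) (y - p) \<le> 0"
    using closest_point_variational[OF H(1), of x] by blast
  \<comment> \<open>In a subspace the direction h may be replaced by -h and by its multiples with i
    and -i, so this one-sided real inequality becomes complex orthogonality.\<close>
  have le: "Re (cinner (x - p) h) \<le> 0" if "h \<in> H" for h
    using p(2)[of "p + h"] H(3)[OF p(1) that] by (simp add: inner_cinner)
  have orth: "cinner (x - p) h = 0" if h: "h \<in> H" for h
  proof (rule complex_eqI)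
    show "Re (cinner (x - p) h) = Re 0"
      using le[OF h] le[OF H(5)[OF h]] by simp
    show "Im (cinner (x - p) h) = Im 0"
      using le[OF H(4)[OF h, of \<i>]] le[OF H(4)[OF h, of "- \<i>"]] by (simp add: cinner_scaleC_right)
  qed
  show ?thesis
  proof (rule ex1I[of _ p])
    show "p \<in> H \<and> (\<forall>h\<in>H. cinner (x - p) h = 0)"
      using p(1) orth by blast
    fix q assume "q \<in> H \<and> (\<forall>h\<in>H. cinner (x - q) h = 0)"
    then have q: "q \<in> H" "\<And>h. h \<in> H \<Longrightarrow> cinner (x - q) h = 0"
      by blast+
    have "cinner (q - p) (q - p) = cinner (x - p) (q - p) - cinner (x - q) (q - p)"
      by (simp add: cinner_diff_left)
    also have "\<dots> = 0"
      using orth q(2) H(6)[OF q(1) p(1)] by simp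
    finally show "q = p" by simp
  qed
qed

definition proj :: "'a::chilbert set \<Rightarrow> 'a \<Rightarrow> 'a"
  where "proj H x = (THE p. p \<in> H \<and> (\<forall>h\<in>H. cinner (x - p) h = 0))"

lemma proj:
  assumes "hilbert_space H"
  shows proj_mem: "proj H x \<in> H" and proj_ortho: "h \<in> H \<Longrightarrow> cinner (x - proj H x) h = 0"
  using theI'[OF projection_ex[OF assms, of x]] by (auto simp: proj_def)

lemma proj_eqI:
  assumes "hilbert_space H" "p \<in> H" "\<And>h. h \<in> H \<Longrightarrow> cinner (x - p) h = 0"
  shows "proj H x = p"
  unfolding proj_def by (rule the1_equality[OF projection_ex[OF assms(1)]]) (use assms in auto)

lemma norm_proj_le:
  assumes "hilbert_space H"
  shows "norm (proj H x) \<le> norm x"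
proof -
  have "(norm ((x - proj H x) + proj H x))\<^sup>2 = (norm (x - proj H x))\<^sup>2 + (norm (proj H x))\<^sup>2"
    by (rule pythagoras) (simp add: proj_ortho proj_mem assms)
  then have "(norm (proj H x))\<^sup>2 \<le> (norm x)\<^sup>2"
    by simp
  then show ?thesis
    by (simp add: power2_le_iff_abs_le)
qed

lemma proj_bounded_ops:
  assumes "hilbert_space H"
  shows "proj H \<in> bounded_ops UNIV H"
proof -
  have "proj H (x + y) = proj H x + proj H y" for x y
  proof (rule proj_eqI[OF assms])
    fix h assume h: "h \<in> H"
    have "x + y - (proj H x + proj H y) = (x - proj H x) + (y - proj H y)" by simp
    then show "cinner (x + y - (proj H x + proj H y)) h = 0"
      using h by (simp only: cinner_add_left proj_ortho[OF assms]) simp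
  qed (simp add: hilbert_space_add proj_mem assms)
  moreover have "proj H (c *\<^sub>C x) = c *\<^sub>C proj H x" for c x
    by (rule proj_eqI[OF assms]) (simp_all add: hilbert_space_scaleC proj_mem proj_ortho assms
        cinner_scaleC_left flip: scaleC_diff_right)
  ultimately show ?thesis
    using norm_proj_le[OF assms] proj_mem[OF assms]
    unfolding bounded_ops_def by (auto intro!: exI[of _ 1])
qed

subsection \<open>Bounded operators\<close>

lemma bounded_opsD:
  assumes "T \<in> bounded_ops H K"
  shows bounded_ops_mem: "x \<in> H \<Longrightarrow> T x \<in> K"
    and bounded_ops_add: "x \<in> H \<Longrightarrow> y \<in> H \<Longrightarrow> T (x + y) = T x + T y"
    and bounded_ops_scaleC: "x \<in> H \<Longrightarrow> T (c *\<^sub>C x) = c *\<^sub>C T x"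
    and bounded_ops_bound: "\<exists>M. M \<ge> 0 \<and> (\<forall>x\<in>H. norm (T x) \<le> M * norm x)"
proof -
  obtain M where M: "\<forall>x\<in>H. norm (T x) \<le> M * norm x"
    using assms by (auto simp: bounded_ops_def)
  have "\<forall>x\<in>H. norm (T x) \<le> \<bar>M\<bar> * norm x"
    using M by (metis abs_ge_self mult_right_mono norm_ge_zero order_trans)
  then show "\<exists>M. M \<ge> 0 \<and> (\<forall>x\<in>H. norm (T x) \<le> M * norm x)"
    by (intro exI[of _ "\<bar>M\<bar>"]) simp
qed (use assms in \<open>auto simp: bounded_ops_def\<close>)

lemma bounded_opsI:
  assumes "\<And>x. x \<in> H \<Longrightarrow> T x \<in> K" "\<And>x y. x \<in> H \<Longrightarrow> y \<in> H \<Longrightarrow> T (x + y) = T x + T y"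
    "\<And>c x. x \<in> H \<Longrightarrow> T (c *\<^sub>C x) = c *\<^sub>C T x" "\<And>x. x \<in> H \<Longrightarrow> norm (T x) \<le> M * norm x"
  shows "T \<in> bounded_ops H K"
  using assms unfolding bounded_ops_def by blast

lemma bounded_ops_zero: "T \<in> bounded_ops H K \<Longrightarrow> hilbert_space H \<Longrightarrow> T 0 = 0"
  using bounded_ops_scaleC[of T H K 0 0] by (simp add: hilbert_space_zero)

lemma bounded_ops_diff:
  "T \<in> bounded_ops H K \<Longrightarrow> hilbert_space H \<Longrightarrow> x \<in> H \<Longrightarrow> y \<in> H \<Longrightarrow> T (x - y) = T x - T y"
  using bounded_ops_add[of T H K x "- y"] bounded_ops_scaleC[of T H K y "-1"]
  by (simp add: hilbert_space_minus)

lemma bounded_ops_sum: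
  assumes "T \<in> bounded_ops H K" "hilbert_space H"
  shows "(\<And>i. i \<in> I \<Longrightarrow> f i \<in> H) \<Longrightarrow> T (\<Sum>i\<in>I. f i) = (\<Sum>i\<in>I. T (f i))"
  by (induction I rule: infinite_finite_induct)
    (simp_all add: bounded_ops_zero[OF assms] bounded_ops_add[OF assms(1)] hilbert_space_sum assms)

lemma bounded_ops_continuous:
  assumes "T \<in> bounded_ops H K" "hilbert_space H"
  shows "continuous_on H T"
proof -
  obtain M where M: "M \<ge> 0" "\<And>x. x \<in> H \<Longrightarrow> norm (T x) \<le> M * norm x"
    using bounded_ops_bound[OF assms(1)] by blast
  have "M-lipschitz_on H T"
    using M bounded_ops_diff[OF assms] hilbert_space_diff[OF assms(2)]
    by (intro lipschitz_onI) (auto simp: dist_norm simp flip: bounded_ops_diff[OF assms])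
  then show ?thesis
    by (rule lipschitz_on_continuous_on)
qed

lemma hilbert_space_Collect_eq:
  assumes "T \<in> bounded_ops H K" "S \<in> bounded_ops H K'" "hilbert_space H"
  shows "hilbert_space {x. x \<in> H \<and> T x = S x}"
proof -
  have "closed {x \<in> H. T x = S x}"
  proof -
    have "closedin (top_of_set H) {x \<in> H. T x = S x}"
    proof -
      have "{x \<in> H. T x = S x} = H \<inter> (\<lambda>x. T x - S x) -` {0}" by auto
      then show ?thesis
        using continuous_on_diff[OF bounded_ops_continuous[OF assms(1,3)] bounded_ops_continuous[OF assms(2,3)]]
        by (metis (no_types, lifting) closed_singleton continuous_closedin_preimage)
    qed
    then show ?thesis
      using hilbert_space_closed[OF assms(3)] closedin_closed_trans by blast
  qed
  then show ?thesis
    unfolding hilbert_space_def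
    using bounded_ops_zero[OF assms(1,3)] bounded_ops_zero[OF assms(2,3)]
      bounded_ops_add[OF assms(1)] bounded_ops_add[OF assms(2)]
      bounded_ops_scaleC[OF assms(1)] bounded_ops_scaleC[OF assms(2)]
    by (auto simp: hilbert_spaceD[OF assms(3)])
qed

lemma bounded_ops_eq_on_hspan:
  assumes "T \<in> bounded_ops (hspan A) K" "S \<in> bounded_ops (hspan A) K'"
    "\<And>a. a \<in> A \<Longrightarrow> T a = S a" "x \<in> hspan A"
  shows "T x = S x"
proof -
  have "x \<in> hspan A \<and> T x = S x"
    using assms(4) by (induction rule: hspan_induct)
      (auto intro!: hilbert_space_Collect_eq[OF assms(1,2)] hspan_base assms(3))
  then show ?thesis ..
qed

lemma bounded_ops_comp:
  assumes "T \<in> bounded_ops H K" "S \<in> bounded_ops K L"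
  shows "(\<lambda>x. S (T x)) \<in> bounded_ops H L"
proof -
  obtain M where M: "M \<ge> 0" "\<And>x. x \<in> H \<Longrightarrow> norm (T x) \<le> M * norm x"
    using bounded_ops_bound[OF assms(1)] by blast
  obtain N where N: "N \<ge> 0" "\<And>x. x \<in> K \<Longrightarrow> norm (S x) \<le> N * norm x"
    using bounded_ops_bound[OF assms(2)] by blast
  show ?thesis
  proof (rule bounded_opsI)
    show "norm (S (T x)) \<le> (N * M) * norm x" if "x \<in> H" for x
    proof -
      have "norm (S (T x)) \<le> N * norm (T x)"
        using N(2) bounded_ops_mem[OF assms(1) that] by blast
      also have "\<dots> \<le> N * (M * norm x)"
        using M(2)[OF that] N(1) by (rule mult_left_mono)
      finally show ?thesis by (simp add: mult.assoc)
    qed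
  qed (use bounded_opsD[OF assms(1)] bounded_opsD[OF assms(2)] in auto)
qed

lemma bounded_ops_add_op:
  assumes "T \<in> bounded_ops H K" "S \<in> bounded_ops H K" "hilbert_space K"
  shows "(\<lambda>x. T x + S x) \<in> bounded_ops H K"
proof -
  obtain M where M: "M \<ge> 0" "\<And>x. x \<in> H \<Longrightarrow> norm (T x) \<le> M * norm x"
    using bounded_ops_bound[OF assms(1)] by blast
  obtain N where N: "N \<ge> 0" "\<And>x. x \<in> H \<Longrightarrow> norm (S x) \<le> N * norm x"
    using bounded_ops_bound[OF assms(2)] by blast
  show ?thesis
  proof (rule bounded_opsI)
    show "norm (T x + S x) \<le> (M + N) * norm x" if "x \<in> H" for x
      using norm_triangle_ineq[of "T x" "S x"] M(2)[OF that] N(2)[OF that]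
      by (simp add: distrib_right)
  qed (use bounded_opsD[OF assms(1)] bounded_opsD[OF assms(2)] assms(3) in
      \<open>auto simp: hilbert_space_add scaleC_add_right\<close>)
qed

lemma bounded_ops_scaleC_op:
  assumes "T \<in> bounded_ops H K" "hilbert_space K"
  shows "(\<lambda>x. c *\<^sub>C T x) \<in> bounded_ops H K"
proof -
  obtain M where M: "M \<ge> 0" "\<And>x. x \<in> H \<Longrightarrow> norm (T x) \<le> M * norm x"
    using bounded_ops_bound[OF assms(1)] by blast
  show ?thesis
  proof (rule bounded_opsI)
    show "norm (c *\<^sub>C T x) \<le> (cmod c * M) * norm x" if "x \<in> H" for x
      using M(2)[OF that] by (simp add: norm_scaleC mult.assoc mult_left_mono)
  qed (use bounded_opsD[OF assms(1)] assms(2) in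
      \<open>auto simp: hilbert_space_scaleC scaleC_add_right scaleC_scaleC mult.commute\<close>)
qed

lemma bounded_ops_id: "(\<lambda>x. x) \<in> bounded_ops H H"
  by (rule bounded_opsI[where M = 1]) auto

lemma bounded_ops_diff_op:
  assumes "T \<in> bounded_ops H K" "S \<in> bounded_ops H K" "hilbert_space K"
  shows "(\<lambda>x. T x - S x) \<in> bounded_ops H K"
  using bounded_ops_add_op[OF assms(1) bounded_ops_scaleC_op[OF assms(2,3), of "-1"] assms(3)]
  by simp

lemma bounded_ops_Pair:
  assumes "T \<in> bounded_ops H K" "S \<in> bounded_ops H L"
  shows "(\<lambda>x. (T x, S x)) \<in> bounded_ops H (K \<times> L)"
proof -
  obtain M where M: "M \<ge> 0" "\<And>x. x \<in> H \<Longrightarrow> norm (T x) \<le> M * norm x"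
    using bounded_ops_bound[OF assms(1)] by blast
  obtain N where N: "N \<ge> 0" "\<And>x. x \<in> H \<Longrightarrow> norm (S x) \<le> N * norm x"
    using bounded_ops_bound[OF assms(2)] by blast
  show ?thesis
  proof (rule bounded_opsI)
    show "norm (T x, S x) \<le> (M + N) * norm x" if "x \<in> H" for x
      using norm_Pair_le[of "T x" "S x"] M(2)[OF that] N(2)[OF that]
      by (simp add: distrib_right)
  qed (use bounded_opsD[OF assms(1)] bounded_opsD[OF assms(2)] in \<open>auto simp: scaleC_Pair\<close>)
qed

lemma bounded_ops_fst: "fst \<in> bounded_ops (H \<times> K) H"
  by (rule bounded_opsI[where M = 1]) (auto simp: scaleC_Pair norm_fst_le)

lemma bounded_ops_snd: "snd \<in> bounded_ops (H \<times> K) K"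
  by (rule bounded_opsI[where M = 1]) (auto simp: scaleC_Pair norm_snd_le)

lemma bounded_ops_inl: "hilbert_space K \<Longrightarrow> (\<lambda>x. (x, 0)) \<in> bounded_ops H (H \<times> K)"
  by (rule bounded_opsI[where M = 1]) (auto simp: scaleC_Pair norm_Pair hilbert_space_zero)

lemma bounded_ops_inr: "hilbert_space H \<Longrightarrow> (\<lambda>x. (0, x)) \<in> bounded_ops K (H \<times> K)"
  by (rule bounded_opsI[where M = 1]) (auto simp: scaleC_Pair norm_Pair hilbert_space_zero)

lemma bounded_ops_mono: "T \<in> bounded_ops H K \<Longrightarrow> H' \<subseteq> H \<Longrightarrow> K \<subseteq> K' \<Longrightarrow> T \<in> bounded_ops H' K'"
  unfolding bounded_ops_def by (simp, meson subsetD)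

lemma hilbert_space_vimage:
  assumes "T \<in> bounded_ops H K" "hilbert_space H" "hilbert_space L"
  shows "hilbert_space {x \<in> H. T x \<in> L}"
proof -
  have "closedin (top_of_set H) (H \<inter> T -` L)"
    by (rule continuous_closedin_preimage[OF bounded_ops_continuous[OF assms(1,2)]])
      (rule hilbert_space_closed[OF assms(3)])
  then have "closed (H \<inter> T -` L)"
    using hilbert_space_closed[OF assms(2)] closedin_closed_trans by blast
  moreover have "H \<inter> T -` L = {x \<in> H. T x \<in> L}" by auto
  ultimately show ?thesis
    unfolding hilbert_space_def using bounded_ops_zero[OF assms(1,2)] bounded_opsD(2,3)[OF assms(1)]
    by (auto simp: hilbert_spaceD[OF assms(2)] hilbert_spaceD[OF assms(3)])
qed

section \<open>Riesz representation and adjoints\<close>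

lemma riesz_ex:
  assumes H: "hilbert_space H" and T: "T \<in> bounded_ops H K"
  shows "\<exists>x\<in>H. \<forall>h\<in>H. cinner (T h) y = cinner h x"
proof -
  define N where "N = {h \<in> H. T h \<in> {z. cinner z y = 0}}"
  have N: "hilbert_space N"
    unfolding N_def by (rule hilbert_space_vimage[OF T H hilbert_space_ortho_left])
  show ?thesis
  proof (cases "N = H")
    case True
    then show ?thesis
      using hilbert_space_zero[OF H] by (intro bexI[of _ 0]) (auto simp: N_def)
  next
    case False
    then obtain u where u: "u \<in> H" "cinner (T u) y \<noteq> 0"
      by (auto simp: N_def)
    \<comment> \<open>N is the kernel of the functional and has codimension one in H, so the part of
      u orthogonal to N represents the functional up to a scalar.\<close>
    define z where "z = u - proj N u"
    have pH: "proj N u \<in> H" and pN: "cinner (T (proj N u)) y = 0"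
      using proj_mem[OF N, of u] by (auto simp: N_def)
    have zH: "z \<in> H"
      unfolding z_def by (rule hilbert_space_diff[OF H u(1) pH])
    have Tz: "cinner (T z) y \<noteq> 0"
      using u(2) pN by (simp add: z_def bounded_ops_diff[OF T H u(1) pH] cinner_diff_left)
    have zN: "cinner h z = 0" if "h \<in> N" for h
      using proj_ortho[OF N that, of u] cinner_swap_zero unfolding z_def by blast
    have "z \<noteq> 0"
      using Tz bounded_ops_zero[OF T H] by auto
    then have nz: "cinner z z \<noteq> 0" by simp
    define \<phi> where "\<phi> h = cinner (T h) y" for h
    show ?thesis
    proof (intro bexI[of _ "cnj (\<phi> z / cinner z z) *\<^sub>C z"] ballI)
      fix h assume h: "h \<in> H"
      define k where "k = h - (\<phi> h / \<phi> z) *\<^sub>C z"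
      have kH: "k \<in> H"
        unfolding k_def by (intro hilbert_space_diff[OF H] hilbert_space_scaleC[OF H] h zH)
      have "T k = T h - (\<phi> h / \<phi> z) *\<^sub>C T z"
        unfolding k_def using h zH
        by (simp add: bounded_ops_diff[OF T H] hilbert_space_scaleC[OF H] bounded_ops_scaleC[OF T])
      then have "cinner (T k) y = 0"
        using Tz by (simp add: cinner_diff_left cinner_scaleC_left \<phi>_def)
      with kH have "k \<in> N" by (simp add: N_def)
      from zN[OF this] have "cinner h z = (\<phi> h / \<phi> z) * cinner z z"
        by (simp add: k_def cinner_diff_left cinner_scaleC_left)
      then show "cinner (T h) y = cinner h (cnj (\<phi> z / cinner z z) *\<^sub>C z)"
        using nz Tz by (simp add: cinner_scaleC_right \<phi>_def)
    qed (simp add: hilbert_space_scaleC[OF H] zH)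
  qed
qed

lemma adj_eqI:
  assumes "hilbert_space H" "x \<in> H" "\<And>h. h \<in> H \<Longrightarrow> cinner (T h) y = cinner h x"
  shows "adj H T y = x"
  unfolding adj_def
proof (rule the_equality)
  fix z assume z: "z \<in> H \<and> (\<forall>h\<in>H. cinner (T h) y = cinner h z)"
  then have "cinner (z - x) (z - x) = 0"
    using assms hilbert_space_diff[OF assms(1), of z x] by (simp add: cinner_diff_right)
  then show "z = x" by simp
qed (use assms in auto)

lemma cinner_adj:
  assumes "hilbert_space H" "T \<in> bounded_ops H K" "h \<in> H"
  shows "cinner (T h) y = cinner h (adj H T y)"
proof -
  obtain x where x: "x \<in> H" "\<forall>h\<in>H. cinner (T h) y = cinner h x"
    using riesz_ex[OF assms(1,2), of y] by blast
  then have "adj H T y = x"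
    by (intro adj_eqI assms(1)) auto
  with x assms(3) show ?thesis by auto
qed

lemma cinner_adj_right:
  assumes "hilbert_space H" "T \<in> bounded_ops H K" "h \<in> H"
  shows "cinner (adj H T y) h = cinner y (T h)"
  by (metis assms cinner_adj cinner_commute)

lemma adj_bounded_ops:
  assumes T: "T \<in> bounded_ops UNIV UNIV"
  shows "adj UNIV T \<in> bounded_ops UNIV UNIV"
proof -
  note adj = cinner_adj[OF hilbert_space_UNIV T UNIV_I]
  obtain M where M: "M \<ge> 0" "\<And>x. norm (T x) \<le> M * norm x"
    using bounded_ops_bound[OF T] by blast
  show ?thesis
  proof (rule bounded_opsI)
    show "adj UNIV T (x + y) = adj UNIV T x + adj UNIV T y" for x y
      by (rule adj_eqI) (simp_all add: cinner_add_right adj)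
    show "adj UNIV T (c *\<^sub>C x) = c *\<^sub>C adj UNIV T x" for c x
      by (rule adj_eqI) (simp_all add: cinner_scaleC_right adj)
    fix y
    let ?a = "adj UNIV T y"
    have "cinner ?a ?a = cinner (T ?a) y"
      by (simp add: adj)
    then have "(norm ?a)\<^sup>2 = cmod (cinner (T ?a) y)"
      by (metis cinner_self norm_of_real abs_power2)
    also have "\<dots> \<le> norm (T ?a) * norm y" by (rule cinner_cmod_le)
    also have "\<dots> \<le> (M * norm ?a) * norm y" by (intro mult_right_mono M) simp
    finally have "norm ?a * norm ?a \<le> norm ?a * (M * norm y)"
      by (simp add: power2_eq_square mult_ac)
    then show "norm ?a \<le> M * norm y"
      using M(1) by (cases "norm ?a = 0") (simp_all add: mult_le_cancel_left)
  qed simp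
qed

subsection \<open>Positive semidefinite scalar kernels\<close>

text \<open>The points x i may repeat; this is what makes positivity stable under reindexing along
  maps that are not injective.\<close>

definition psd :: "('i \<Rightarrow> 'i \<Rightarrow> complex) \<Rightarrow> bool"
  where "psd k \<longleftrightarrow> (\<forall>(n::nat) c x. (\<Sum>i<n. \<Sum>j<n. c i * cnj (c j) * k (x i) (x j)) \<in> \<real>\<^sub>\<ge>\<^sub>0)"

lemma psdD: "psd k \<Longrightarrow> (\<Sum>i<n. \<Sum>j<n. c i * cnj (c j) * k (x i) (x j)) \<in> \<real>\<^sub>\<ge>\<^sub>0" for n :: nat
  by (simp add: psd_def)

lemma psd_sum_nonneg:
  assumes "psd k" "finite I"
  shows "(\<Sum>i\<in>I. \<Sum>j\<in>I. c i * cnj (c j) * k (x i) (x j)) \<in> \<real>\<^sub>\<ge>\<^sub>0"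
proof -
  obtain h where h: "bij_betw h {0..<card I} I"
    using ex_bij_betw_nat_finite[OF assms(2)] by blast
  have r: "(\<Sum>i\<in>I. f i) = (\<Sum>i<card I. f (h i))" for f :: "_ \<Rightarrow> complex"
    using sum.reindex_bij_betw[OF h, of f] by (simp add: lessThan_atLeast0)
  show ?thesis
    unfolding r by (rule psdD[OF assms(1), of "\<lambda>i. c (h i)" "\<lambda>i. x (h i)"])
qed

text \<open>Hermitian symmetry is a consequence of the quadratic form being real at the coefficient
  vectors (1, 1) and (1, i).\<close>

lemma psd_commute:
  assumes "psd k"
  shows "k y x = cnj (k x y)"
proof -
  have xx: "Im (k x x) = 0" for x
    using psdD[OF assms, where n = 1 and c = "\<lambda>_. 1" and x = "\<lambda>_. x"]
    by (simp add: complex_nonneg_Reals_iff)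
  have "Im (k x y + k y x) = 0"
    using psdD[OF assms, where n = 2 and c = "\<lambda>_. 1" and x = "\<lambda>i. if i = 0 then x else y"]
    by (simp add: complex_nonneg_Reals_iff numeral_2_eq_2 xx)
  moreover have "Re (k x y) = Re (k y x)"
    using psdD[OF assms, where n = 2 and c = "\<lambda>i. if i = 0 then 1 else \<i>" and x = "\<lambda>i. if i = 0 then x else y"]
    by (simp add: complex_nonneg_Reals_iff numeral_2_eq_2 xx)
  ultimately show ?thesis
    by (simp add: complex_eq_iff)
qed

lemma cinner_sum_sum:
  "cinner (\<Sum>i\<in>I. c i *\<^sub>C v i) (\<Sum>j\<in>J. d j *\<^sub>C w j)
    = (\<Sum>i\<in>I. \<Sum>j\<in>J. c i * cnj (d j) * cinner (v i) (w j :: 'a::chilbert))"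
  unfolding cinner_sum_left cinner_scaleC_left
  unfolding cinner_sum_right cinner_scaleC_right sum_distrib_left by (simp only: mult.assoc)

lemma cinner_self_nonneg: "cinner x x \<in> \<real>\<^sub>\<ge>\<^sub>0" for x :: "'a::chilbert"
  by (simp add: cinner_self complex_nonneg_Reals_iff del: of_real_power)

lemma psd_cinner: "psd (\<lambda>i j. cinner (v i) (v j))"
  unfolding psd_def by (simp add: cinner_self_nonneg flip: cinner_sum_sum)

lemma psd_reindex:
  assumes "psd k"
  shows "psd (\<lambda>i j. k (f i) (f j))"
  unfolding psd_def by (intro allI) (rule psdD[OF assms, where x = "\<lambda>i. f (_ i)"])

lemma nonneg_Reals_sum: "(\<And>i. i \<in> I \<Longrightarrow> f i \<in> \<real>\<^sub>\<ge>\<^sub>0) \<Longrightarrow> (\<Sum>i\<in>I. f i) \<in> (\<real>\<^sub>\<ge>\<^sub>0 :: complex set)"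
  by (induction I rule: infinite_finite_induct) auto

lemma psd_sum:
  assumes "\<And>p. p \<in> P \<Longrightarrow> psd (k p)"
  shows "psd (\<lambda>i j. \<Sum>p\<in>P. k p i j)"
  unfolding psd_def
proof (intro allI)
  fix n :: nat and c x
  have "(\<Sum>i<n. \<Sum>j<n. c i * cnj (c j) * (\<Sum>p\<in>P. k p (x i) (x j)))
      = (\<Sum>i<n. \<Sum>p\<in>P. \<Sum>j<n. c i * cnj (c j) * k p (x i) (x j))"
    unfolding sum_distrib_left by (subst sum.swap) (rule refl)
  also have "\<dots> = (\<Sum>p\<in>P. \<Sum>i<n. \<Sum>j<n. c i * cnj (c j) * k p (x i) (x j))"
    by (rule sum.swap)
  also have "\<dots> \<in> \<real>\<^sub>\<ge>\<^sub>0"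
    by (intro nonneg_Reals_sum psdD assms)
  finally show "(\<Sum>i<n. \<Sum>j<n. c i * cnj (c j) * (\<Sum>p\<in>P. k p (x i) (x j))) \<in> \<real>\<^sub>\<ge>\<^sub>0" .
qed

lemma psd_scale_rank1: "psd k \<Longrightarrow> psd (\<lambda>i j. a i * cnj (a j) * k i j)"
  unfolding psd_def
proof (intro allI)
  fix n :: nat and c x
  assume "\<forall>(n::nat) c x. (\<Sum>i<n. \<Sum>j<n. c i * cnj (c j) * k (x i) (x j)) \<in> \<real>\<^sub>\<ge>\<^sub>0"
  from this[rule_format, of "\<lambda>i. c i * a (x i)" x n]
  show "(\<Sum>i<n. \<Sum>j<n. c i * cnj (c j) * (a (x i) * cnj (a (x j)) * k (x i) (x j))) \<in> \<real>\<^sub>\<ge>\<^sub>0"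
    by (simp add: mult_ac)
qed

text \<open>Each inequality involves finitely many points, so on every finite set the kernel may be
  replaced by one of a convenient form.\<close>

lemma psd_iff_locally:
  assumes "\<And>F. finite F \<Longrightarrow> \<exists>l. psd l \<and> (\<forall>i\<in>F. \<forall>j\<in>F. k i j = l i j)"
  shows "psd k"
  unfolding psd_def
proof (intro allI)
  fix n :: nat and c x
  obtain l where l: "psd l" "\<And>i j. i \<in> x ` {..<n} \<Longrightarrow> j \<in> x ` {..<n} \<Longrightarrow> k i j = l i j"
    using assms[of "x ` {..<n}"] by auto
  have "(\<Sum>i<n. \<Sum>j<n. c i * cnj (c j) * k (x i) (x j)) = (\<Sum>i<n. \<Sum>j<n. c i * cnj (c j) * l (x i) (x j))"
    by (intro sum.cong refl) (simp add: l(2))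
  also have "\<dots> \<in> \<real>\<^sub>\<ge>\<^sub>0" by (rule psdD[OF l(1)])
  finally show "(\<Sum>i<n. \<Sum>j<n. c i * cnj (c j) * k (x i) (x j)) \<in> \<real>\<^sub>\<ge>\<^sub>0" .
qed

text \<open>Schur product theorem with a Gram kernel as one factor: on a finite set a finite
  orthonormal system splits that factor into rank one kernels.\<close>

lemma psd_mult_cinner:
  fixes \<phi> :: "'i \<Rightarrow> 'a::chilbert"
  assumes "psd k"
  shows "psd (\<lambda>i j. k i j * cinner (\<phi> i) (\<phi> j))"
proof (rule psd_iff_locally)
  fix F :: "'i set" assume "finite F"
  then obtain P where P: "\<forall>b\<in>\<phi> ` F. (\<Sum>e\<in>P. cinner b e *\<^sub>C e) = b"
    using finite_orthonormal_expansion[of "\<phi> ` F"] by blast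
  have "k i j * cinner (\<phi> i) (\<phi> j) = (\<Sum>e\<in>P. cinner (\<phi> i) e * cnj (cinner (\<phi> j) e) * k i j)" if "i \<in> F" for i j
  proof -
    have "cinner (\<phi> i) (\<phi> j) = cinner (\<Sum>e\<in>P. cinner (\<phi> i) e *\<^sub>C e) (\<phi> j)"
      using P that by simp
    also have "\<dots> = (\<Sum>e\<in>P. cinner (\<phi> i) e * cnj (cinner (\<phi> j) e))"
      unfolding cinner_sum_left cinner_scaleC_left by (metis cinner_commute)
    finally show ?thesis
      by (simp add: sum_distrib_left mult_ac)
  qed
  moreover have "psd (\<lambda>i j. \<Sum>e\<in>P. cinner (\<phi> i) e * cnj (cinner (\<phi> j) e) * k i j)"
    by (intro psd_sum psd_scale_rank1 assms)
  ultimately show "\<exists>l. psd l \<and> (\<forall>i\<in>F. \<forall>j\<in>F. k i j * cinner (\<phi> i) (\<phi> j) = l i j)"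
    by (intro exI conjI ballI)
qed

text \<open>A block diagonal kernel is, on a finite set, the sum of its blocks, each compressed by
  the indicator function of its index.\<close>

lemma psd_direct_sum:
  fixes k :: "'n \<Rightarrow> 'i \<Rightarrow> 'i \<Rightarrow> complex"
  assumes "\<And>n. psd (k n)"
  shows "psd (\<lambda>a b. if fst a = fst b then k (fst a) (snd a) (snd b) else 0)"
proof (rule psd_iff_locally)
  fix F :: "('n \<times> 'i) set" assume F: "finite F"
  define l where "l = (\<lambda>a b. \<Sum>n\<in>fst ` F. (if fst a = n then 1 else 0) * cnj (if fst b = n then 1 else 0) * k n (snd a) (snd b))"
  have "psd l"
    unfolding l_def by (intro psd_sum psd_scale_rank1 psd_reindex[where f = snd] assms)
  moreover have "(if fst a = fst b then k (fst a) (snd a) (snd b) else 0) = l a b" if "a \<in> F" for a b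
  proof -
    have "l a b = (\<Sum>n\<in>fst ` F. if fst a = n then (if fst a = fst b then k n (snd a) (snd b) else 0) else 0)"
      unfolding l_def by (intro sum.cong) auto
    then show ?thesis
      using F that by (simp add: sum.delta)
  qed
  ultimately show "\<exists>l. psd l \<and> (\<forall>a\<in>F. \<forall>b\<in>F. (if fst a = fst b then k (fst a) (snd a) (snd b) else 0) = l a b)"
    by (intro exI[of _ l]) simp
qed

lemma psd_zero: "psd (\<lambda>_ _. 0)"
  by (simp add: psd_def)

subsection \<open>Operators defined on a total family\<close>

text \<open>Starting from a closed graph takes the place of extension by continuity: the bound makes
  second components unique and makes them converge along with the first ones, so the domain is
  closed.\<close>

lemma graph_operator:
  fixes G :: "('a::chilbert \<times> 'b::chilbert) set"
  assumes G: "hilbert_space G" and bound: "\<And>x y. (x, y) \<in> G \<Longrightarrow> norm y \<le> M * norm x"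
  obtains T where "hilbert_space (fst ` G)" "T \<in> bounded_ops (fst ` G) (snd ` G)"
    "\<And>x y. (x, y) \<in> G \<Longrightarrow> T x = y"
proof -
  note Gs = hilbert_spaceD[OF G]
  have uniq: "y = y'" if "(x, y) \<in> G" "(x, y') \<in> G" for x y y'
    using bound[of 0 "y - y'"] Gs(6)[OF that] by simp
  define T where "T x = (THE y. (x, y) \<in> G)" for x
  have T: "T x = y" if "(x, y) \<in> G" for x y
    unfolding T_def using that uniq by (intro the_equality) auto
  have TG: "(x, T x) \<in> G" if "x \<in> fst ` G" for x
    using that T by force
  have "closed (fst ` G)"
    unfolding closed_sequential_limits
  proof (intro allI impI, elim conjE)
    fix X l assume X: "\<forall>n. X n \<in> fst ` G" and l: "X \<longlonglongrightarrow> l"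
    have "Cauchy (\<lambda>n. T (X n))"
    proof (rule CauchyI)
      fix e :: real assume e: "e > 0"
      then have "e / (\<bar>M\<bar> + 1) > 0" by simp
      then obtain N where N: "\<And>m n. m \<ge> N \<Longrightarrow> n \<ge> N \<Longrightarrow> norm (X m - X n) < e / (\<bar>M\<bar> + 1)"
        using CauchyD[OF LIMSEQ_imp_Cauchy[OF l]] by blast
      have "norm (T (X m) - T (X n)) < e" if "m \<ge> N" "n \<ge> N" for m n
      proof -
        have "(X m - X n, T (X m) - T (X n)) \<in> G"
          using Gs(6)[OF TG TG] X by simp
        then have "norm (T (X m) - T (X n)) \<le> M * norm (X m - X n)"
          by (rule bound)
        also have "\<dots> \<le> (\<bar>M\<bar> + 1) * norm (X m - X n)"
          by (intro mult_right_mono) auto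
        also have "\<dots> < (\<bar>M\<bar> + 1) * (e / (\<bar>M\<bar> + 1))"
          using N[OF that] by (intro mult_strict_left_mono) auto
        finally show ?thesis
          by (simp add: add_nonneg_eq_0_iff)
      qed
      then show "\<exists>N. \<forall>m\<ge>N. \<forall>n\<ge>N. norm (T (X m) - T (X n)) < e" by blast
    qed
    then obtain y where y: "(\<lambda>n. T (X n)) \<longlonglongrightarrow> y"
      using Cauchy_convergent convergent_def by blast
    have "(\<lambda>n. (X n, T (X n))) \<longlonglongrightarrow> (l, y)"
      by (intro tendsto_Pair l y)
    then have "(l, y) \<in> G"
      using closed_sequentially[OF Gs(1), of "\<lambda>n. (X n, T (X n))"] TG X by blast
    then show "l \<in> fst ` G" by force
  qed
  moreover have add: "(x + y, T x + T y) \<in> G" if "x \<in> fst ` G" "y \<in> fst ` G" for x y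
    using Gs(3)[OF TG[OF that(1)] TG[OF that(2)]] by simp
  moreover have sc: "(c *\<^sub>C x, c *\<^sub>C T x) \<in> G" if "x \<in> fst ` G" for c x
    using Gs(4)[OF TG[OF that]] by (simp add: scaleC_Pair)
  moreover have "0 \<in> fst ` G"
    using Gs(2) by (metis fst_zero imageI)
  moreover have "x + y \<in> fst ` G" if "x \<in> fst ` G" "y \<in> fst ` G" for x y
    using imageI[OF add[OF that], of fst] by simp
  moreover have "c *\<^sub>C x \<in> fst ` G" if "x \<in> fst ` G" for c x
    using imageI[OF sc[OF that], of fst] by simp
  ultimately have "hilbert_space (fst ` G)"
    by (simp add: hilbert_space_def)
  moreover have "T \<in> bounded_ops (fst ` G) (snd ` G)"
  proof (rule bounded_opsI)
    fix x assume x: "x \<in> fst ` G"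
    show "T x \<in> snd ` G" using TG[OF x] by force
    show "norm (T x) \<le> M * norm x" using bound[OF TG[OF x]] .
    show "T (c *\<^sub>C x) = c *\<^sub>C T x" for c using T[OF sc[OF x]] .
    show "T (x + y) = T x + T y" if "y \<in> fst ` G" for y using T[OF add[OF x that]] .
  qed
  ultimately show ?thesis using that T by blast
qed

lemma extend_operator:
  fixes v :: "'i \<Rightarrow> 'a::chilbert" and w :: "'i \<Rightarrow> 'b::chilbert"
  assumes bound: "\<And>x y. (x, y) \<in> hspan (range (\<lambda>i. (v i, w i))) \<Longrightarrow> norm y \<le> M * norm x"
  obtains T where "T \<in> bounded_ops (hspan (range v)) (hspan (range w))" "\<And>i. T (v i) = w i"
    "\<And>x. x \<in> hspan (range v) \<Longrightarrow> (x, T x) \<in> hspan (range (\<lambda>i. (v i, w i)))"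
proof -
  let ?G = "hspan (range (\<lambda>i. (v i, w i)))"
  obtain T where T: "hilbert_space (fst ` ?G)" "T \<in> bounded_ops (fst ` ?G) (snd ` ?G)"
    "\<And>x y. (x, y) \<in> ?G \<Longrightarrow> T x = y"
    using graph_operator[OF hilbert_space_hspan bound] by blast
  have sub: "?G \<subseteq> hspan (range v) \<times> hspan (range w)"
    by (rule hspan_minimal) (auto intro!: hilbert_space_Times hspan_base)
  have base: "(v i, w i) \<in> ?G" for i
    by (rule hspan_base) simp
  have "v i \<in> fst ` ?G" for i
    using base[of i] by force
  then have dom: "hspan (range v) \<subseteq> fst ` ?G"
    by (intro hspan_minimal T(1)) auto
  have "snd ` ?G \<subseteq> hspan (range w)"
    using sub by auto
  then have "T \<in> bounded_ops (hspan (range v)) (hspan (range w))"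
    using bounded_ops_mono[OF T(2) dom] by blast
  moreover have "T (v i) = w i" for i
    using T(3)[OF base] .
  moreover have "(x, T x) \<in> ?G" if "x \<in> hspan (range v)" for x
    using dom that T(3) by force
  ultimately show ?thesis using that by blast
qed

text \<open>Positivity of this kernel says exactly that the norm of a combination of the w i is at
  most M times the norm of the same combination of the v i.\<close>

lemma extend_bounded:
  fixes v :: "'i \<Rightarrow> 'a::chilbert" and w :: "'i \<Rightarrow> 'b::chilbert"
  assumes M: "M \<ge> 0" and bound: "psd (\<lambda>i j. complex_of_real (M\<^sup>2) * cinner (v i) (v j) - cinner (w i) (w j))"
  obtains T where "T \<in> bounded_ops (hspan (range v)) (hspan (range w))" "\<And>i. T (v i) = w i"
    "\<And>x. x \<in> hspan (range v) \<Longrightarrow> norm (T x) \<le> M * norm x"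
proof -
  have "norm (snd p) \<le> M * norm (fst p)" if "p \<in> hspan (range (\<lambda>i. (v i, w i)))" for p
  proof -
    have "closed {p :: 'a \<times> 'b. norm (snd p) \<le> M * norm (fst p)}"
      by (intro closed_Collect_le continuous_intros)
    moreover have "norm (snd q) \<le> M * norm (fst q)"
      if q: "q = (\<Sum>i<n. c i *\<^sub>C (v (x i), w (x i)))" for q and n :: nat and c x
    proof -
      have fq: "fst q = (\<Sum>i<n. c i *\<^sub>C v (x i))" and sq: "snd q = (\<Sum>i<n. c i *\<^sub>C w (x i))"
        by (simp_all add: q fst_sum snd_sum scaleC_Pair)
      have "complex_of_real (M\<^sup>2) * cinner (fst q) (fst q) - cinner (snd q) (snd q) =
          (\<Sum>i<n. \<Sum>j<n. c i * cnj (c j) * (complex_of_real (M\<^sup>2) * cinner (v (x i)) (v (x j)) - cinner (w (x i)) (w (x j))))"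
        unfolding fq sq cinner_sum_sum
        by (simp add: sum_distrib_left sum_subtractf algebra_simps)
      also have "\<dots> \<in> \<real>\<^sub>\<ge>\<^sub>0"
        by (rule psdD[OF bound])
      finally have "complex_of_real (M\<^sup>2 * (norm (fst q))\<^sup>2 - (norm (snd q))\<^sup>2) \<in> \<real>\<^sub>\<ge>\<^sub>0"
        by (simp only: cinner_self of_real_mult of_real_diff)
      then have "(norm (snd q))\<^sup>2 \<le> (M * norm (fst q))\<^sup>2"
        by (simp add: complex_nonneg_Reals_iff power_mult_distrib del: of_real_diff of_real_mult of_real_power)
      then show ?thesis
        using M by (simp add: power2_le_iff_abs_le)
    qed
    ultimately have "closure {\<Sum>i<n. c i *\<^sub>C (v (x i), w (x i)) | (n::nat) c x. True} \<subseteq> {p. norm (snd p) \<le> M * norm (fst p)}"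
      by (intro closure_minimal) auto
    then show ?thesis
      using that unfolding hspan_range by blast
  qed
  then have *: "norm y \<le> M * norm x" if "(x, y) \<in> hspan (range (\<lambda>i. (v i, w i)))" for x y
    using that by fastforce
  show ?thesis
    by (rule extend_operator[of v w M, OF *]) (use that * in auto)
qed

text \<open>Equal Gram matrices mean that the pairs (v i, w i) are orthogonal to the pairs (- v j, w
  j). Orthogonality passes to closed spans, which gives preservation of inner products on the whole
  domain at once.\<close>

lemma extend_isometry:
  fixes v :: "'i \<Rightarrow> 'a::chilbert" and w :: "'i \<Rightarrow> 'b::chilbert"
  assumes gram: "\<And>i j. cinner (w i) (w j) = cinner (v i) (v j)"
  obtains T where "T \<in> bounded_ops (hspan (range v)) (hspan (range w))" "\<And>i. T (v i) = w i"
    "\<And>x y. x \<in> hspan (range v) \<Longrightarrow> y \<in> hspan (range v) \<Longrightarrow> cinner (T x) (T y) = cinner x y"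
proof -
  let ?G = "hspan (range (\<lambda>i. (v i, w i)))"
  have *: "cinner y y' = cinner x x'" if "(x, y) \<in> ?G" "(x', y') \<in> ?G" for x y x' y'
  proof -
    have "cinner p q = 0" if p: "p \<in> ?G" and q: "q \<in> hspan (range (\<lambda>i. (- v i, w i)))" for p q
      by (rule hspan_ortho[OF p q]) (auto simp: cinner_Pair gram)
    moreover have "(- x', y') \<in> hspan (range (\<lambda>i. (- v i, w i)))"
    proof -
      have neg: "(\<lambda>p. (- fst p, snd p)) \<in> bounded_ops (UNIV :: ('a \<times> 'b) set) UNIV"
        by (rule bounded_opsI[where M = 1]) (auto simp: scaleC_Pair scaleC_minus_right norm_prod_def)
      have "(x', y') \<in> {p \<in> UNIV. (- fst p, snd p) \<in> hspan (range (\<lambda>i. (- v i, w i)))}"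
        by (rule subsetD[OF hspan_minimal that(2)])
          (auto intro!: hspan_base hilbert_space_vimage[OF neg, of "hspan _", simplified])
      then show ?thesis by simp
    qed
    ultimately have "cinner (x, y) (- x', y') = 0" using that(1) by blast
    then show ?thesis by (simp add: cinner_Pair)
  qed
  have "norm y \<le> 1 * norm x" if "(x, y) \<in> ?G" for x y
    using norm_eqI_cinner[OF *[OF that that]] by simp
  then obtain T where T: "T \<in> bounded_ops (hspan (range v)) (hspan (range w))" "\<And>i. T (v i) = w i"
    "\<And>x. x \<in> hspan (range v) \<Longrightarrow> (x, T x) \<in> ?G"
    using extend_operator[of v w 1] by blast
  show ?thesis
    by (rule that[OF T(1,2)]) (rule *[OF T(3) T(3)])
qed

subsection \<open>Orthonormal bases\<close>

lemma orthonormal_basis_ex: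
  fixes H :: "'a::chilbert set"
  assumes H: "hilbert_space H"
  obtains B where "B \<subseteq> H" "\<And>b c. b \<in> B \<Longrightarrow> c \<in> B \<Longrightarrow> cinner b c = (if b = c then 1 else 0)" "hspan B = H"
proof -
  define \<A> where "\<A> = {B. B \<subseteq> H \<and> (\<forall>b\<in>B. \<forall>c\<in>B. cinner b c = (if b = c then 1 else 0))}"
  have "\<exists>M\<in>\<A>. \<forall>X\<in>\<A>. M \<subseteq> X \<longrightarrow> X = M"
  proof (rule subset_Zorn_nonempty)
    have "{} \<in> \<A>" by (simp add: \<A>_def)
    then show "\<A> \<noteq> {}" by blast
    fix C assume C: "C \<noteq> {}" "subset.chain \<A> C"
    have "cinner b c = (if b = c then 1 else 0)" if bc: "b \<in> \<Union>C" "c \<in> \<Union>C" for b c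
    proof -
      obtain X Y where XY: "X \<in> C" "b \<in> X" "Y \<in> C" "c \<in> Y" using bc by blast
      then have "X \<subseteq> Y \<or> Y \<subseteq> X" using C(2) by (auto simp: subset_chain_def)
      then obtain Z where "Z \<in> C" "b \<in> Z" "c \<in> Z" using XY by blast
      moreover have "Z \<in> \<A>" using C(2) \<open>Z \<in> C\<close> by (auto simp: subset_chain_def)
      ultimately show ?thesis by (simp add: \<A>_def)
    qed
    moreover have "\<Union>C \<subseteq> H" using C(2) by (auto simp: subset_chain_def \<A>_def)
    ultimately show "\<Union>C \<in> \<A>" by (simp add: \<A>_def)
  qed
  then obtain B where BA: "B \<in> \<A>" and max: "\<And>X. X \<in> \<A> \<Longrightarrow> B \<subseteq> X \<Longrightarrow> X = B" by blast
  have BH: "B \<subseteq> H" and B: "\<And>b c. b \<in> B \<Longrightarrow> c \<in> B \<Longrightarrow> cinner b c = (if b = c then 1 else 0)"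
    using BA by (auto simp: \<A>_def)
  have "h \<in> hspan B" if h: "h \<in> H" for h
  proof -
    \<comment> \<open>Were u nonzero, its normalization could be added to the maximal system
      B.\<close>
    define u where "u = h - proj (hspan B) h"
    have up: "cinner u b = 0" if "b \<in> B" for b
      unfolding u_def by (rule proj_ortho) (simp_all add: hspan_base that)
    have uH: "u \<in> H"
      unfolding u_def
      by (rule hilbert_space_diff[OF H h])
        (rule subsetD[OF hspan_minimal[OF H BH] proj_mem[OF hilbert_space_hspan]])
    have "u = 0"
    proof (rule ccontr)
      assume nz: "u \<noteq> 0"
      define e where "e = complex_of_real (inverse (norm u)) *\<^sub>C u"
      have eb: "cinner e b = 0" "cinner b e = 0" if "b \<in> B" for b
        using up[OF that] cinner_swap_zero[of b u] by (simp_all add: e_def cinner_scaleC_left cinner_scaleC_right)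
      have ee: "cinner e e = 1"
        using nz by (simp add: cinner_self e_def scaleR_scaleC[symmetric] del: of_real_inverse)
      have "e \<in> H" unfolding e_def by (rule hilbert_space_scaleC[OF H uH])
      moreover have "e \<notin> B" using eb(1)[of e] ee by auto
      then have "cinner e b = (if e = b then 1 else 0)" "cinner b e = (if b = e then 1 else 0)"
        if "b \<in> B" for b
        using eb[OF that] that by auto
      ultimately have "insert e B \<in> \<A>"
        using BH B ee unfolding \<A>_def mem_Collect_eq by (simp only: ball_simps insert_subset) simp
      then have "e \<in> B" using max by blast
      with \<open>e \<notin> B\<close> show False ..
    qed
    then have "h = proj (hspan B) h" by (simp add: u_def)
    then show ?thesis using proj_mem[OF hilbert_space_hspan, of B h] by simp
  qed
  moreover have "hspan B \<subseteq> H" by (rule hspan_minimal[OF H BH])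
  ultimately show ?thesis using that BH B by blast
qed

subsection \<open>Kolmogorov decompositions\<close>

text \<open>
  A type class can only fix one kernel per type. Making the kernel a component of the points turns
  all positive semidefinite kernels on a type into restrictions of a single one.
\<close>

datatype 'i kernel_point = KPoint "'i \<Rightarrow> 'i \<Rightarrow> complex" 'i

lemma psd_sum_list_nonneg:
  assumes "psd k"
  shows "0 \<le> Re (\<Sum>(c, x)\<leftarrow>us. \<Sum>(d, y)\<leftarrow>us. c * cnj d * k x y)"
proof -
  have r: "(\<Sum>(c, x)\<leftarrow>us. f c x) = (\<Sum>i<length us. f (fst (us ! i)) (snd (us ! i)))" for f :: "complex \<Rightarrow> 'a \<Rightarrow> complex"
    unfolding sum_list_sum_nth by (simp add: atLeast0LessThan case_prod_beta)
  show ?thesis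
    unfolding r using psdD[OF assms, where n = "length us" and c = "\<lambda>i. fst (us ! i)" and x = "\<lambda>i. snd (us ! i)"]
    by (simp add: complex_nonneg_Reals_iff)
qed

instantiation kernel_point :: (type) pd_kernel
begin

text \<open>Points with different kernels are made orthogonal and a kernel that is not positive is
  replaced by 0, which leaves a block diagonal kernel that is positive on the whole type.\<close>

definition pdk_kernel_point :: "'a kernel_point \<Rightarrow> 'a kernel_point \<Rightarrow> complex"
  where "pdk_kernel_point p q = (case p of KPoint k x \<Rightarrow> case q of KPoint l y \<Rightarrow>
    if k = l then (if psd k then k x y else 0) else 0)"

instance
proof -
  let ?code = "\<lambda>p. case p of KPoint k x \<Rightarrow> (k, x)"
  let ?k = "\<lambda>(l :: 'a \<Rightarrow> 'a \<Rightarrow> complex) x y. if psd l then l x y else 0"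
  have "psd (?k l)" for l
    by (cases "psd l") (simp_all add: psd_zero)
  note psd_direct_sum[of ?k, OF this]
  from psd_reindex[OF this, of ?code]
  have "psd (pdk :: 'a kernel_point \<Rightarrow> 'a kernel_point \<Rightarrow> complex)"
    by (rule back_subst[of psd]) (auto simp: fun_eq_iff pdk_kernel_point_def split: kernel_point.split)
  then show "OFCLASS('a kernel_point, pd_kernel_class)"
    by intro_classes (rule psd_commute, assumption, rule psd_sum_list_nonneg)
qed

end

text \<open>The target space is prescribed. A vector of an orthonormal basis of the span is
  determined by its inner products with the generators, hence by a function on the points; the
  injection m turns this function into an index of the prescribed l2 space.\<close>

lemma kolmogorov_decomposition:
  fixes k :: "'i \<Rightarrow> 'i \<Rightarrow> complex" and m :: "('i \<Rightarrow> complex) \<Rightarrow> 'j"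
  assumes k: "psd k" and m: "inj m"
  obtains \<gamma> :: "'i \<Rightarrow> 'j ell2" where "\<And>i j. cinner (\<gamma> i) (\<gamma> j) = k i j"
proof -
  define v where "v i = kvec (KPoint k i)" for i
  have v: "cinner (v i) (v j) = k i j" for i j
    using k by (simp add: v_def cinner_kvec pdk_kernel_point_def)
  obtain B where B: "B \<subseteq> hspan (range v)" "\<And>b c. b \<in> B \<Longrightarrow> c \<in> B \<Longrightarrow> cinner b c = (if b = c then 1 else 0)"
    "hspan B = hspan (range v)"
    using orthonormal_basis_ex[OF hilbert_space_hspan, of "range v"] by blast
  define code where "code b = m (\<lambda>i. cinner b (v i))" for b
  have inj: "b = c" if bc: "b \<in> B" "c \<in> B" and eq: "code b = code c" for b c
  proof -
    have "(\<lambda>i. cinner b (v i)) = (\<lambda>i. cinner c (v i))"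
      using eq m unfolding code_def by (simp only: inj_eq)
    then have "cinner b (v i) = cinner c (v i)" for i
      by metis
    then show ?thesis
      using hspan_eqI[of b "range v" c] bc B(1) by blast
  qed
  show ?thesis
  proof (cases "B = {}")
    case True
    have "hilbert_space {0 :: 'i kernel_point rkhs}" by simp
    then have "hspan (range v) \<subseteq> {0}"
      using hspan_minimal[of "{0}" B] B(3) True by simp
    then have "v i = 0" for i
      using hspan_base[of "v i" "range v"] by blast
    then have "k i j = 0" for i j
      using v[of i j] by simp
    then show ?thesis using that[of "\<lambda>_. 0"] by simp
  next
    case False
    then obtain b0 where b0: "b0 \<in> B" by blast
    \<comment> \<open>Lists B as a family over the whole type, the form required by
      \<open>extend_isometry\<close>; b0 is the default outside B.\<close>
    define r where "r b = (if b \<in> B then b else b0)" for b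
    have rB: "r b \<in> B" for b using b0 by (simp add: r_def)
    have range_r: "range r = B"
    proof
      show "range r \<subseteq> B" using rB by blast
      show "B \<subseteq> range r" by (metis r_def rangeI subsetI)
    qed
    have gram: "cinner (kvec (Index (code (r b)))) (kvec (Index (code (r c)))) = cinner (r b) (r c)" for b c
    proof -
      have "code (r b) = code (r c) \<longleftrightarrow> r b = r c"
        using inj[OF rB rB, of b c] by auto
      then show ?thesis
        unfolding cinner_kvec pdk_index_def B(2)[OF rB rB] by simp
    qed
    obtain J where J: "J \<in> bounded_ops (hspan (range r)) (hspan (range (\<lambda>b. kvec (Index (code (r b))))))"
      "\<And>b. J (r b) = kvec (Index (code (r b)))" "\<And>x y. x \<in> hspan (range r) \<Longrightarrow> y \<in> hspan (range r) \<Longrightarrow> cinner (J x) (J y) = cinner x y"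
      by (rule extend_isometry[of "\<lambda>b. kvec (Index (code (r b)))" r, OF gram]) (rule that)
    have "v i \<in> hspan (range r)" for i
      unfolding range_r B(3) by (rule hspan_base) simp
    then show ?thesis
      using that[of "\<lambda>i. J (v i)"] J(3) v by simp
  qed
qed

subsection \<open>Tensor products of operators\<close>

lemma hspan_tensors: "hspan (range (\<lambda>p. fst p \<otimes>\<^sub>H snd p)) = (UNIV :: ('a::chilbert, 'b::chilbert) htensor set)"
proof -
  have "(\<Sum>(a, b)\<leftarrow>us. a \<otimes>\<^sub>H b) \<in> hspan (range (\<lambda>p. fst p \<otimes>\<^sub>H snd p))" for us :: "('a \<times> 'b) list"
  proof (induction us)
    case (Cons p us)
    have "fst p \<otimes>\<^sub>H snd p \<in> hspan (range (\<lambda>p. fst p \<otimes>\<^sub>H snd p))"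
      by (rule hspan_base) simp
    then show ?case
      using Cons by (simp add: case_prod_beta hilbert_space_add)
  qed (simp add: hilbert_space_zero)
  then have "closure (range (\<lambda>us. \<Sum>(a, b)\<leftarrow>us. (a :: 'a) \<otimes>\<^sub>H (b :: 'b))) \<subseteq> hspan (range (\<lambda>p. fst p \<otimes>\<^sub>H snd p))"
    by (intro closure_minimal hilbert_space_closed hilbert_space_hspan) auto
  then show ?thesis
    unfolding tensor_total by auto
qed

text \<open>Converse of \<open>extend_bounded\<close>: an operator bound becomes a positive kernel,
  to which Schur products can be applied.\<close>

lemma psd_bounded_op:
  assumes T: "T \<in> bounded_ops H K" and H: "hilbert_space H" and v: "\<And>i. v i \<in> H"
    and M: "M \<ge> 0" "\<And>x. x \<in> H \<Longrightarrow> norm (T x) \<le> M * norm x"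
  shows "psd (\<lambda>i j. complex_of_real (M\<^sup>2) * cinner (v i) (v j) - cinner (T (v i)) (T (v j)))"
  unfolding psd_def
proof (intro allI)
  fix n :: nat and c x
  define s where "s = (\<Sum>i<n. c i *\<^sub>C v (x i))"
  have sH: "s \<in> H"
    unfolding s_def by (intro hilbert_space_sum[OF H] hilbert_space_scaleC[OF H] v)
  have Ts: "T s = (\<Sum>i<n. c i *\<^sub>C T (v (x i)))"
    unfolding s_def
    by (subst bounded_ops_sum[OF T H]) (simp_all add: hilbert_space_scaleC[OF H] v bounded_ops_scaleC[OF T])
  have "(\<Sum>i<n. \<Sum>j<n. c i * cnj (c j) * (complex_of_real (M\<^sup>2) * cinner (v (x i)) (v (x j)) - cinner (T (v (x i))) (T (v (x j)))))
      = complex_of_real (M\<^sup>2) * cinner s s - cinner (T s) (T s)"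
    unfolding Ts unfolding s_def cinner_sum_sum
    by (simp add: sum_distrib_left sum_subtractf algebra_simps)
  also have "\<dots> = complex_of_real (M\<^sup>2 * (norm s)\<^sup>2 - (norm (T s))\<^sup>2)"
    by (simp add: cinner_self)
  also have "\<dots> \<in> \<real>\<^sub>\<ge>\<^sub>0"
  proof -
    have "(norm (T s))\<^sup>2 \<le> (M * norm s)\<^sup>2"
      by (intro power_mono M sH) simp
    then show ?thesis
      by (simp add: complex_nonneg_Reals_iff power_mult_distrib del: of_real_diff of_real_mult of_real_power)
  qed
  finally show "(\<Sum>i<n. \<Sum>j<n. c i * cnj (c j) * (complex_of_real (M\<^sup>2) * cinner (v (x i)) (v (x j)) - cinner (T (v (x i))) (T (v (x j))))) \<in> \<real>\<^sub>\<ge>\<^sub>0" .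
qed

text \<open>The kernel expressing the bound of A, multiplied by the Gram kernel of the second
  factor, stays positive by the Schur product theorem and expresses the same bound for A tensor
  identity.\<close>

lemma tensor_op_left_ex:
  assumes A: "(A :: 'a::chilbert \<Rightarrow> 'a) \<in> bounded_ops UNIV UNIV"
  obtains T where "T \<in> bounded_ops UNIV UNIV" "\<And>a (b :: 'b::chilbert). T (a \<otimes>\<^sub>H b) = A a \<otimes>\<^sub>H b"
proof -
  obtain M where M: "M \<ge> 0" "\<And>x. norm (A x) \<le> M * norm x"
    using bounded_ops_bound[OF A] by blast
  have p: "psd (\<lambda>i j. (complex_of_real (M\<^sup>2) * cinner (fst i) (fst j) - cinner (A (fst i)) (A (fst j)))
      * cinner (snd i) (snd j :: 'b))"
    by (rule psd_mult_cinner) (rule psd_bounded_op[OF A], auto intro: M)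
  obtain T where T: "T \<in> bounded_ops (hspan (range (\<lambda>p. fst p \<otimes>\<^sub>H (snd p :: 'b)))) (hspan (range (\<lambda>p. A (fst p) \<otimes>\<^sub>H snd p)))"
    "\<And>p. T (fst p \<otimes>\<^sub>H (snd p :: 'b)) = A (fst p) \<otimes>\<^sub>H snd p"
  proof (rule extend_bounded[OF M(1), of "\<lambda>p. fst p \<otimes>\<^sub>H (snd p :: 'b)" "\<lambda>p. A (fst p) \<otimes>\<^sub>H snd p"])
    show "psd (\<lambda>i j. complex_of_real (M\<^sup>2) * cinner (fst i \<otimes>\<^sub>H snd i) (fst j \<otimes>\<^sub>H (snd j :: 'b)) -
        cinner (A (fst i) \<otimes>\<^sub>H snd i) (A (fst j) \<otimes>\<^sub>H snd j))"
      using p by (simp add: cinner_tensor algebra_simps)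
  qed (rule that)
  show ?thesis
    by (rule that[of T]) (use T(1) T(2)[of "(_, _)"] in \<open>auto simp: hspan_tensors intro: bounded_ops_mono\<close>)
qed

lemma tensor_op_right_ex:
  assumes B: "(B :: 'b::chilbert \<Rightarrow> 'b) \<in> bounded_ops UNIV UNIV"
  obtains T where "T \<in> bounded_ops UNIV UNIV" "\<And>(a :: 'a::chilbert) b. T (a \<otimes>\<^sub>H b) = a \<otimes>\<^sub>H B b"
proof -
  obtain M where M: "M \<ge> 0" "\<And>x. norm (B x) \<le> M * norm x"
    using bounded_ops_bound[OF B] by blast
  have p: "psd (\<lambda>i j. (complex_of_real (M\<^sup>2) * cinner (snd i) (snd j) - cinner (B (snd i)) (B (snd j)))
      * cinner (fst i) (fst j :: 'a))"
    by (rule psd_mult_cinner) (rule psd_bounded_op[OF B], auto intro: M)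
  obtain T where T: "T \<in> bounded_ops (hspan (range (\<lambda>p. (fst p :: 'a) \<otimes>\<^sub>H snd p))) (hspan (range (\<lambda>p. fst p \<otimes>\<^sub>H B (snd p))))"
    "\<And>p. T ((fst p :: 'a) \<otimes>\<^sub>H snd p) = fst p \<otimes>\<^sub>H B (snd p)"
  proof (rule extend_bounded[OF M(1), of "\<lambda>p. (fst p :: 'a) \<otimes>\<^sub>H snd p" "\<lambda>p. fst p \<otimes>\<^sub>H B (snd p)"])
    show "psd (\<lambda>i j. complex_of_real (M\<^sup>2) * cinner (fst i \<otimes>\<^sub>H snd i) ((fst j :: 'a) \<otimes>\<^sub>H snd j) -
        cinner (fst i \<otimes>\<^sub>H B (snd i)) (fst j \<otimes>\<^sub>H B (snd j)))"
      using p by (simp add: cinner_tensor algebra_simps)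
  qed (rule that)
  show ?thesis
    by (rule that[of T]) (use T(1) T(2)[of "(_, _)"] in \<open>auto simp: hspan_tensors intro: bounded_ops_mono\<close>)
qed

text \<open>Makes the definite description usable: existence comes from composing A tensor identity
  with identity tensor B, uniqueness from the totality of elementary tensors.\<close>

lemma tensor_op:
  assumes A: "(A :: 'a::chilbert \<Rightarrow> 'a) \<in> bounded_ops UNIV UNIV"
    and B: "(B :: 'b::chilbert \<Rightarrow> 'b) \<in> bounded_ops UNIV UNIV"
  shows tensor_op_bounded_ops: "tensor_op A B \<in> bounded_ops UNIV UNIV"
    and tensor_op_tensor: "tensor_op A B (a \<otimes>\<^sub>H b) = A a \<otimes>\<^sub>H B b"
proof -
  obtain T where T: "T \<in> bounded_ops UNIV UNIV" "\<And>a (b :: 'b). T (a \<otimes>\<^sub>H b) = A a \<otimes>\<^sub>H b"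
    by (rule tensor_op_left_ex[OF A, where 'b = 'b]) (rule that)
  obtain S where S: "S \<in> bounded_ops UNIV UNIV" "\<And>(a :: 'a) b. S (a \<otimes>\<^sub>H b) = a \<otimes>\<^sub>H B b"
    by (rule tensor_op_right_ex[OF B, where 'a = 'a]) (rule that)
  let ?P = "\<lambda>T. T \<in> bounded_ops UNIV UNIV \<and> (\<forall>a b. T (a \<otimes>\<^sub>H b) = A a \<otimes>\<^sub>H B b)"
  have ex: "?P (\<lambda>x. S (T x))"
    using bounded_ops_comp[OF T(1) S(1)] by (simp add: T S)
  have uniq: "R = (\<lambda>x. S (T x))" if R: "?P R" for R
  proof
    fix x :: "('a, 'b) htensor"
    have "x \<in> hspan (range (\<lambda>p. fst p \<otimes>\<^sub>H snd p))"
      by (simp add: hspan_tensors)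
    then show "R x = S (T x)"
      by (rule bounded_ops_eq_on_hspan[rotated 3])
        (use R bounded_ops_comp[OF T(1) S(1)] in \<open>auto simp: hspan_tensors T S\<close>)
  qed
  have "tensor_op A B = (\<lambda>x. S (T x))"
    unfolding tensor_op_def by (rule the_equality[where P = ?P, OF ex uniq])
  then show "tensor_op A B \<in> bounded_ops UNIV UNIV" "tensor_op A B (a \<otimes>\<^sub>H b) = A a \<otimes>\<^sub>H B b"
    using ex by simp_all
qed

subsection \<open>Positive operator kernels as scalar kernels\<close>

text \<open>Over pairs of a point and a vector, scalar coefficients are absorbed into the
  vectors.\<close>

lemma positive_kernel_iff_psd:
  "positive_kernel K \<longleftrightarrow> (\<forall>x y. K x y \<in> bounded_ops UNIV UNIV) \<and>
    psd (\<lambda>p q. cinner (K (fst p) (fst q) (snd p)) (snd q))" (is "_ \<longleftrightarrow> ?B \<and> psd ?k")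
proof (cases ?B)
  case True
  have "(\<forall>N (x :: nat \<Rightarrow> _) (h :: nat \<Rightarrow> _). (\<Sum>i<N. \<Sum>j<N. cinner (K (x i) (x j) (h i)) (h j)) \<in> \<real>\<^sub>\<ge>\<^sub>0) \<longleftrightarrow> psd ?k"
  proof
    assume *: "\<forall>N (x :: nat \<Rightarrow> _) (h :: nat \<Rightarrow> _). (\<Sum>i<N. \<Sum>j<N. cinner (K (x i) (x j) (h i)) (h j)) \<in> \<real>\<^sub>\<ge>\<^sub>0"
    show "psd ?k"
      unfolding psd_def
    proof (intro allI)
      fix n :: nat and c z
      have sc: "K x y (d *\<^sub>C h) = d *\<^sub>C K x y h" for x y d h
        using True bounded_ops_scaleC[of "K x y" UNIV UNIV] by blast
      show "(\<Sum>i<n. \<Sum>j<n. c i * cnj (c j) * cinner (K (fst (z i)) (fst (z j)) (snd (z i))) (snd (z j))) \<in> \<real>\<^sub>\<ge>\<^sub>0"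
        using *[rule_format, where x = "\<lambda>i. fst (z i)" and h = "\<lambda>i. c i *\<^sub>C snd (z i)" and N = n]
        by (simp add: sc cinner_scaleC_left cinner_scaleC_right mult_ac)
    qed
  next
    assume psd: "psd ?k"
    show "\<forall>N (x :: nat \<Rightarrow> _) (h :: nat \<Rightarrow> _). (\<Sum>i<N. \<Sum>j<N. cinner (K (x i) (x j) (h i)) (h j)) \<in> \<real>\<^sub>\<ge>\<^sub>0"
      using psdD[OF psd, where c = "\<lambda>_. 1" and x = "\<lambda>i. (_ i, _ i)"] by simp
  qed
  then show ?thesis
    using True by (simp add: positive_kernel_def)
next
  case False
  then show ?thesis
    unfolding positive_kernel_def by (simp only: simp_thms)
qed

definition tensor_kernel ::
    "('x \<Rightarrow> 'x \<Rightarrow> 'a::chilbert \<Rightarrow> 'a) \<Rightarrow> ('x \<Rightarrow> 'x \<Rightarrow> 'b::chilbert \<Rightarrow> 'b) \<Rightarrow> 'x \<times> 'a \<times> 'b \<Rightarrow> 'x \<times> 'a \<times> 'b \<Rightarrow> complex"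
  where "tensor_kernel K S = (\<lambda>(x, a, b) (y, c, d). cinner (K x y a) c * cinner (S x y b) d)"

text \<open>Positivity needs to be tested on elementary tensors only: finite sums of them reduce to
  a larger index set, and general vectors are limits of such sums, along which the closed condition
  persists.\<close>

lemma positive_kernel_tensor_iff:
  assumes K: "\<And>x y. K x y \<in> bounded_ops UNIV UNIV" and S: "\<And>x y. S x y \<in> bounded_ops UNIV UNIV"
  shows "positive_kernel (\<lambda>x y. tensor_op (K x y) (S x y)) \<longleftrightarrow> psd (tensor_kernel K S)"
proof
  assume "positive_kernel (\<lambda>x y. tensor_op (K x y) (S x y))"
  then have "psd (\<lambda>p q. cinner (tensor_op (K (fst p) (fst q)) (S (fst p) (fst q)) (snd p)) (snd q))"
    by (simp add: positive_kernel_iff_psd)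
  from psd_reindex[OF this, of "\<lambda>(x, a, b). (x, a \<otimes>\<^sub>H b)"]
  show "psd (tensor_kernel K S)"
    by (simp add: tensor_kernel_def case_prod_beta' tensor_op_tensor[OF K S] cinner_tensor)
next
  assume psd: "psd (tensor_kernel K S)"
  let ?T = "\<lambda>x y. tensor_op (K x y) (S x y)"
  have T: "?T x y \<in> bounded_ops UNIV UNIV" for x y
    by (rule tensor_op_bounded_ops[OF K S])
  have pure: "(\<Sum>i<N. \<Sum>j<N. cinner (?T (x i) (x j) (\<Sum>(a, b)\<leftarrow>us i. a \<otimes>\<^sub>H b)) (\<Sum>(a, b)\<leftarrow>us j. a \<otimes>\<^sub>H b)) \<in> \<real>\<^sub>\<ge>\<^sub>0"
    for N :: nat and x us
  proof -
    have r: "(\<Sum>(a, b)\<leftarrow>ws. a \<otimes>\<^sub>H b) = (\<Sum>k<length ws. fst (ws ! k) \<otimes>\<^sub>H snd (ws ! k))" for ws :: "('b \<times> 'c) list"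
      unfolding sum_list_sum_nth by (simp add: atLeast0LessThan case_prod_beta)
    \<comment> \<open>The pair (i, k) stands for the k-th elementary tensor in the i-th
      vector.\<close>
    define I where "I = (SIGMA i:{..<N}. {..<length (us i)})"
    define z where "z = (\<lambda>(i, k). (x i, fst (us i ! k), snd (us i ! k)))"
    have "finite I" by (simp add: I_def)
    have "(\<Sum>i<N. \<Sum>j<N. cinner (?T (x i) (x j) (\<Sum>(a, b)\<leftarrow>us i. a \<otimes>\<^sub>H b)) (\<Sum>(a, b)\<leftarrow>us j. a \<otimes>\<^sub>H b))
        = (\<Sum>i<N. \<Sum>j<N. \<Sum>k<length (us i). \<Sum>l<length (us j). tensor_kernel K S (z (i, k)) (z (j, l)))"
      unfolding r bounded_ops_sum[OF T hilbert_space_UNIV UNIV_I] cinner_sum_left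
      unfolding cinner_sum_right tensor_op_tensor[OF K S] cinner_tensor
      by (simp add: tensor_kernel_def z_def case_prod_beta)
    also have "\<dots> = (\<Sum>i<N. \<Sum>k<length (us i). \<Sum>j<N. \<Sum>l<length (us j). tensor_kernel K S (z (i, k)) (z (j, l)))"
      by (intro sum.cong refl sum.swap)
    also have "\<dots> = (\<Sum>p\<in>I. \<Sum>q\<in>I. 1 * cnj 1 * tensor_kernel K S (z p) (z q))"
      unfolding I_def by (subst sum.Sigma) (auto simp: sum.Sigma intro!: sum.cong)
    also have "\<dots> \<in> \<real>\<^sub>\<ge>\<^sub>0"
      by (rule psd_sum_nonneg[OF psd \<open>finite I\<close>])
    finally show ?thesis .
  qed
  show "positive_kernel ?T"
    unfolding positive_kernel_def
  proof (intro conjI allI T)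
    fix N and x :: "nat \<Rightarrow> 'a" and h :: "nat \<Rightarrow> ('b, 'c) htensor"
    have "\<exists>u. (\<lambda>n. \<Sum>(a, b)\<leftarrow>u n. a \<otimes>\<^sub>H b) \<longlonglongrightarrow> h i" for i
    proof -
      have "h i \<in> closure (range (\<lambda>us. \<Sum>(a, b)\<leftarrow>us. a \<otimes>\<^sub>H b))"
        by (simp add: tensor_total)
      then obtain f where f: "\<forall>n. f n \<in> range (\<lambda>us. \<Sum>(a, b)\<leftarrow>us. a \<otimes>\<^sub>H b)" "f \<longlonglongrightarrow> h i"
        unfolding closure_sequential by auto
      from f(1) obtain u where "\<forall>n. f n = (\<Sum>(a, b)\<leftarrow>u n. a \<otimes>\<^sub>H b)"
        unfolding image_iff by metis
      then have "f = (\<lambda>n. \<Sum>(a, b)\<leftarrow>u n. a \<otimes>\<^sub>H b)" by blast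
      with f(2) show ?thesis by (intro exI[of _ u]) simp
    qed
    then obtain u where u: "\<And>i. (\<lambda>n. \<Sum>(a, b)\<leftarrow>u i n. a \<otimes>\<^sub>H b) \<longlonglongrightarrow> h i"
      by metis
    have Tc: "isCont (?T x y) p" for x y p
      using bounded_ops_continuous[OF T hilbert_space_UNIV] by (simp add: continuous_on_eq_continuous_at)
    have "(\<lambda>n. \<Sum>i<N. \<Sum>j<N. cinner (?T (x i) (x j) (\<Sum>(a, b)\<leftarrow>u i n. a \<otimes>\<^sub>H b)) (\<Sum>(a, b)\<leftarrow>u j n. a \<otimes>\<^sub>H b))
        \<longlonglongrightarrow> (\<Sum>i<N. \<Sum>j<N. cinner (?T (x i) (x j) (h i)) (h j))"
      by (intro tendsto_sum tendsto_cinner isCont_tendsto_compose[OF Tc] u)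
    then show "(\<Sum>i<N. \<Sum>j<N. cinner (?T (x i) (x j) (h i)) (h j)) \<in> \<real>\<^sub>\<ge>\<^sub>0"
      by (rule closed_sequentially[OF closed_nonneg_Reals_complex, rotated]) (rule pure)
  qed
qed

subsection \<open>The Schur--Agler class\<close>

text \<open>The kernel of the Schur-Agler condition tested on elementary tensors of a and b at x,
  with the adjoint of f(y) moved to the other side.\<close>

definition schur_kernel :: "('x \<Rightarrow> 'e::chilbert \<Rightarrow> 'e) \<Rightarrow> real \<Rightarrow> ('x \<Rightarrow> 'x \<Rightarrow> 'e \<Rightarrow> 'e) \<Rightarrow> 'x \<times> 'e \<times> 'e \<Rightarrow> 'x \<times> 'e \<times> 'e \<Rightarrow> complex"
  where "schur_kernel f C S = (\<lambda>(x, a, b) (y, c, d).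
    (complex_of_real (C\<^sup>2) * cinner a c - cinner (f x a) (f y c)) * cinner (S x y b) d)"

lemma admissible_kernels_bounded: "S \<in> admissible_kernels \<Psi> \<Longrightarrow> S x y \<in> bounded_ops UNIV UNIV"
  by (simp add: admissible_kernels_def positive_kernel_def)

lemma schur_agler_bounds_iff:
  assumes f: "\<And>x. f x \<in> bounded_ops UNIV UNIV"
  shows "C \<in> schur_agler_bounds \<Psi> f \<longleftrightarrow> 0 \<le> C \<and> (\<forall>S\<in>admissible_kernels \<Psi>. psd (schur_kernel f C S))"
proof -
  have "positive_kernel (\<lambda>x y. tensor_op (\<lambda>v. complex_of_real (C\<^sup>2) *\<^sub>C v - adj UNIV (f y) (f x v)) (S x y))
      \<longleftrightarrow> psd (schur_kernel f C S)" if S: "S \<in> admissible_kernels \<Psi>" for S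
  proof -
    have adj: "cinner (adj UNIV (f y) u) c = cinner u (f y c)" for y u c
      by (rule cinner_adj_right[OF hilbert_space_UNIV f]) simp
    have "(\<lambda>v. complex_of_real (C\<^sup>2) *\<^sub>C v - adj UNIV (f y) (f x v)) \<in> bounded_ops UNIV UNIV" for x y
      by (intro bounded_ops_diff_op bounded_ops_scaleC_op bounded_ops_id
          bounded_ops_comp[OF f adj_bounded_ops[OF f]] hilbert_space_UNIV)
    from positive_kernel_tensor_iff[OF this admissible_kernels_bounded[OF S]] show ?thesis
      by (simp add: tensor_kernel_def schur_kernel_def cinner_diff_left cinner_scaleC_left adj)
  qed
  then show ?thesis
    by (simp add: schur_agler_bounds_def)
qed

text \<open>The bound 1 is itself admissible when the infimum is at most 1: for fixed S, points and
  coefficients the condition reads \<beta> \<le> C^2 \<alpha> with \<alpha> \<ge> 0, which passes to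
  the limit.\<close>

lemma schur_agler_class_iff:
  "f \<in> schur_agler_class \<Psi> \<longleftrightarrow> (\<forall>x. f x \<in> bounded_ops UNIV UNIV) \<and>
    (\<forall>S\<in>admissible_kernels \<Psi>. psd (schur_kernel f 1 S))"
proof (cases "\<forall>x. f x \<in> bounded_ops UNIV UNIV")
  case True
  note iff = schur_agler_bounds_iff[of f, OF True[rule_format]]
  have bdd: "bdd_below (schur_agler_bounds \<Psi> f)"
    by (rule bdd_belowI[of _ 0]) (simp add: schur_agler_bounds_def)
  have "schur_agler_bounds \<Psi> f \<noteq> {} \<and> Inf (schur_agler_bounds \<Psi> f) \<le> 1 \<longleftrightarrow> 1 \<in> schur_agler_bounds \<Psi> f"
  proof
    assume "1 \<in> schur_agler_bounds \<Psi> f"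
    then show "schur_agler_bounds \<Psi> f \<noteq> {} \<and> Inf (schur_agler_bounds \<Psi> f) \<le> 1"
      using cInf_lower[OF _ bdd] by auto
  next
    assume *: "schur_agler_bounds \<Psi> f \<noteq> {} \<and> Inf (schur_agler_bounds \<Psi> f) \<le> 1"
    have "psd (schur_kernel f 1 S)" if S: "S \<in> admissible_kernels \<Psi>" for S
      unfolding psd_def
    proof (intro allI)
      fix n :: nat and c :: "nat \<Rightarrow> complex" and z :: "nat \<Rightarrow> 'a \<times> 'b \<times> 'b"
      define \<alpha> where "\<alpha> = (\<Sum>i<n. \<Sum>j<n. c i * cnj (c j) * (cinner (S (fst (z i)) (fst (z j)) (snd (snd (z i)))) (snd (snd (z j)))
          * cinner (fst (snd (z i))) (fst (snd (z j)))))"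
      define \<beta> where "\<beta> = (\<Sum>i<n. \<Sum>j<n. c i * cnj (c j) * (cinner (f (fst (z i)) (fst (snd (z i)))) (f (fst (z j)) (fst (snd (z j))))
          * cinner (S (fst (z i)) (fst (z j)) (snd (snd (z i)))) (snd (snd (z j)))))"
      have eq: "(\<Sum>i<n. \<Sum>j<n. c i * cnj (c j) * schur_kernel f C S (z i) (z j)) = complex_of_real (C\<^sup>2) * \<alpha> - \<beta>" for C
        unfolding \<alpha>_def \<beta>_def schur_kernel_def case_prod_beta
        by (simp add: sum_distrib_left algebra_simps flip: sum_subtractf)
      have "psd (\<lambda>p q. cinner (S (fst p) (fst q) (snd p)) (snd q))"
        using S by (simp add: admissible_kernels_def positive_kernel_iff_psd)
      from psd_mult_cinner[OF psd_reindex[OF this, of "\<lambda>z. (fst z, snd (snd z))"], of "\<lambda>z. fst (snd z)"]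
      have "psd (\<lambda>p q. cinner (S (fst p) (fst q) (snd (snd p))) (snd (snd q)) * cinner (fst (snd p)) (fst (snd q)))"
        by simp
      then have \<alpha>: "\<alpha> \<in> \<real>\<^sub>\<ge>\<^sub>0"
        unfolding \<alpha>_def by (rule psdD)
      have C: "0 \<le> C" "complex_of_real (C\<^sup>2) * \<alpha> - \<beta> \<in> \<real>\<^sub>\<ge>\<^sub>0" if "C \<in> schur_agler_bounds \<Psi> f" for C
        using that S unfolding iff eq[symmetric] psd_def by blast+
      obtain C0 where "C0 \<in> schur_agler_bounds \<Psi> f"
        using * by blast
      then have im: "Im \<alpha> = 0" "Im \<beta> = 0"
        using \<alpha> C(2)[of C0] by (simp_all add: complex_nonneg_Reals_iff)
      have le: "Re \<beta> \<le> (1 + e)\<^sup>2 * Re \<alpha>" if "e > 0" for e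
      proof -
        obtain C where C': "C \<in> schur_agler_bounds \<Psi> f" "C < 1 + e"
          using cInf_lessD[of "schur_agler_bounds \<Psi> f" "1 + e"] * \<open>e > 0\<close> by auto
        have "Re \<beta> \<le> C\<^sup>2 * Re \<alpha>"
          using C(2)[OF C'(1)] im by (simp add: complex_nonneg_Reals_iff flip: of_real_power)
        also have "\<dots> \<le> (1 + e)\<^sup>2 * Re \<alpha>"
          using C(1)[OF C'(1)] C'(2) \<alpha> by (intro mult_right_mono power_mono) (auto simp: complex_nonneg_Reals_iff)
        finally show ?thesis .
      qed
      have "Re \<beta> \<le> Re \<alpha>"
      proof (rule tendsto_lowerbound[of "\<lambda>e. (1 + e)\<^sup>2 * Re \<alpha>" _ "at_right 0"])
        have "((\<lambda>e. (1 + e)\<^sup>2 * Re \<alpha>) \<longlongrightarrow> (1 + 0)\<^sup>2 * Re \<alpha>) (at_right 0)"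
          by (intro tendsto_intros)
        then show "((\<lambda>e. (1 + e)\<^sup>2 * Re \<alpha>) \<longlongrightarrow> Re \<alpha>) (at_right 0)" by simp
        show "\<forall>\<^sub>F e in at_right 0. Re \<beta> \<le> (1 + e)\<^sup>2 * Re \<alpha>"
          using le by (auto simp: eventually_at_filter)
      qed simp
      then show "(\<Sum>i<n. \<Sum>j<n. c i * cnj (c j) * schur_kernel f 1 S (z i) (z j)) \<in> \<real>\<^sub>\<ge>\<^sub>0"
        unfolding eq using im by (simp add: complex_nonneg_Reals_iff)
    qed
    then show "1 \<in> schur_agler_bounds \<Psi> f"
      by (simp add: iff)
  qed
  then show ?thesis
    using True by (simp add: schur_agler_class_def H_infty_def iff[of 1])
next
  case False
  then show ?thesis
    unfolding schur_agler_class_def H_infty_def by blast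
qed

subsection \<open>Representations of the algebra of bounded continuous functions\<close>

lemma CbI:
  assumes "continuous_on \<Psi> f" "\<And>\<psi>. \<psi> \<in> \<Psi> \<Longrightarrow> cmod (f \<psi>) \<le> M"
  shows "restrict f \<Psi> \<in> Cb \<Psi>"
proof -
  have "continuous_on \<Psi> (restrict f \<Psi>)"
    by (rule continuous_on_eq[OF assms(1)]) simp
  moreover have "bounded (restrict f \<Psi> ` \<Psi>)"
    unfolding bounded_iff using assms(2) by (intro exI[of _ M]) simp
  ultimately show ?thesis
    by (simp add: Cb_def)
qed

lemma Cb_continuous: "g \<in> Cb \<Psi> \<Longrightarrow> continuous_on \<Psi> g"
  by (simp add: Cb_def)

lemma Cb_bound:
  assumes "g \<in> Cb \<Psi>"
  obtains M where "M \<ge> 0" "\<And>\<psi>. \<psi> \<in> \<Psi> \<Longrightarrow> cmod (g \<psi>) \<le> M"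
proof -
  obtain M where M: "\<And>\<psi>. \<psi> \<in> \<Psi> \<Longrightarrow> cmod (g \<psi>) \<le> M"
    using assms by (auto simp: Cb_def bounded_iff)
  show ?thesis
    by (rule that[of "\<bar>M\<bar>"]) (use M in force)+
qed

lemma Cb_const: "(\<lambda>\<psi>\<in>\<Psi>. c) \<in> Cb \<Psi>"
  by (rule CbI[where M = "cmod c"]) (auto intro: continuous_intros)

lemma Cb_mult:
  assumes "f \<in> Cb \<Psi>" "g \<in> Cb \<Psi>"
  shows "(\<lambda>\<psi>\<in>\<Psi>. f \<psi> * g \<psi>) \<in> Cb \<Psi>"
proof -
  obtain M N where "M \<ge> 0" "\<And>\<psi>. \<psi> \<in> \<Psi> \<Longrightarrow> cmod (f \<psi>) \<le> M" "N \<ge> 0" "\<And>\<psi>. \<psi> \<in> \<Psi> \<Longrightarrow> cmod (g \<psi>) \<le> N"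
    using Cb_bound[OF assms(1)] Cb_bound[OF assms(2)] by metis
  then show ?thesis
    by (intro CbI[where M = "M * N"] continuous_intros Cb_continuous assms)
      (auto simp: norm_mult intro: mult_mono)
qed

lemma Cb_add:
  assumes "f \<in> Cb \<Psi>" "g \<in> Cb \<Psi>"
  shows "(\<lambda>\<psi>\<in>\<Psi>. f \<psi> + g \<psi>) \<in> Cb \<Psi>"
proof -
  obtain M N where "\<And>\<psi>. \<psi> \<in> \<Psi> \<Longrightarrow> cmod (f \<psi>) \<le> M" "\<And>\<psi>. \<psi> \<in> \<Psi> \<Longrightarrow> cmod (g \<psi>) \<le> N"
    using Cb_bound[OF assms(1)] Cb_bound[OF assms(2)] by metis
  then show ?thesis
    by (intro CbI[where M = "M + N"] continuous_intros Cb_continuous assms)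
      (auto intro: norm_triangle_mono)
qed

lemma Cb_scale: "g \<in> Cb \<Psi> \<Longrightarrow> (\<lambda>\<psi>\<in>\<Psi>. c * g \<psi>) \<in> Cb \<Psi>"
  using Cb_mult[OF Cb_const[where c = c], of g \<Psi>] by (simp cong: restrict_cong)

lemma Cb_cnj:
  assumes "g \<in> Cb \<Psi>"
  shows "(\<lambda>\<psi>\<in>\<Psi>. cnj (g \<psi>)) \<in> Cb \<Psi>"
proof -
  obtain M where "\<And>\<psi>. \<psi> \<in> \<Psi> \<Longrightarrow> cmod (g \<psi>) \<le> M"
    using Cb_bound[OF assms] by metis
  then show ?thesis
    by (intro CbI[where M = M] continuous_intros Cb_continuous assms) auto
qed

lemma Cb_diff:
  assumes "f \<in> Cb \<Psi>" "g \<in> Cb \<Psi>"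
  shows "(\<lambda>\<psi>\<in>\<Psi>. f \<psi> - g \<psi>) \<in> Cb \<Psi>"
  using Cb_add[OF assms(1) Cb_scale[OF assms(2), where c = "-1"]] by (simp cong: restrict_cong)

lemma Cb_mult_cnj:
  assumes "f \<in> Cb \<Psi>" "g \<in> Cb \<Psi>"
  shows "(\<lambda>\<psi>\<in>\<Psi>. f \<psi> * cnj (g \<psi>)) \<in> Cb \<Psi>"
  using Cb_mult[OF assms(1) Cb_cnj[OF assms(2)]] by (simp cong: restrict_cong)

lemma test_functions_bound:
  assumes "test_functions \<Psi>"
  obtains r where "0 \<le> r" "r < 1" "\<And>\<psi>. \<psi> \<in> \<Psi> \<Longrightarrow> cmod (\<psi> x) \<le> r"
proof -
  have bdd: "bdd_above ((\<lambda>\<psi>. cmod (\<psi> x)) ` \<Psi>)" and lt: "(SUP \<psi>\<in>\<Psi>. cmod (\<psi> x)) < 1"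
    using assms by (simp_all add: test_functions_def)
  show ?thesis
  \<comment> \<open>The maximum with 0 covers an empty \<Psi>, where the supremum carries no
    information.\<close>
  proof (rule that[of "max 0 (SUP \<psi>\<in>\<Psi>. cmod (\<psi> x))"])
    show "cmod (\<psi> x) \<le> max 0 (SUP \<psi>\<in>\<Psi>. cmod (\<psi> x))" if "\<psi> \<in> \<Psi>" for \<psi>
      using cSUP_upper[OF that bdd] by simp
  qed (use lt in auto)
qed

lemma evaluation_Cb:
  assumes "test_functions \<Psi>"
  shows "evaluation \<Psi> x \<in> Cb \<Psi>"
proof -
  obtain r where r: "\<And>\<psi>. \<psi> \<in> \<Psi> \<Longrightarrow> cmod (\<psi> x) \<le> r"
    using test_functions_bound[OF assms, of x] by metis
  have "continuous_on \<Psi> (\<lambda>\<psi>. \<psi> x)"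
    by (rule continuous_on_subset[OF continuous_on_product_coordinates]) simp
  then show ?thesis
    unfolding evaluation_def by (rule CbI[OF _ r])
qed

locale star_rep =
  fixes \<Psi> :: "('x \<Rightarrow> complex) set" and H :: "'h::chilbert set"
    and \<rho> :: "(('x \<Rightarrow> complex) \<Rightarrow> complex) \<Rightarrow> 'h \<Rightarrow> 'h"
  assumes H: "hilbert_space H" and rep: "unital_star_rep \<Psi> H \<rho>"
begin

lemma bounded: "g \<in> Cb \<Psi> \<Longrightarrow> \<rho> g \<in> bounded_ops H H"
  using rep by (simp add: unital_star_rep_def)

lemma mem: "g \<in> Cb \<Psi> \<Longrightarrow> v \<in> H \<Longrightarrow> \<rho> g v \<in> H"
  by (rule bounded_ops_mem[OF bounded])

lemma one: "v \<in> H \<Longrightarrow> \<rho> (\<lambda>\<psi>\<in>\<Psi>. 1) v = v"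
  using rep by (simp add: unital_star_rep_def)

lemma add: "f \<in> Cb \<Psi> \<Longrightarrow> g \<in> Cb \<Psi> \<Longrightarrow> v \<in> H \<Longrightarrow> \<rho> (\<lambda>\<psi>\<in>\<Psi>. f \<psi> + g \<psi>) v = \<rho> f v + \<rho> g v"
  using rep by (simp add: unital_star_rep_def)

lemma scale: "g \<in> Cb \<Psi> \<Longrightarrow> v \<in> H \<Longrightarrow> \<rho> (\<lambda>\<psi>\<in>\<Psi>. c * g \<psi>) v = c *\<^sub>C \<rho> g v"
  using rep by (simp add: unital_star_rep_def)

lemma mult: "f \<in> Cb \<Psi> \<Longrightarrow> g \<in> Cb \<Psi> \<Longrightarrow> v \<in> H \<Longrightarrow> \<rho> (\<lambda>\<psi>\<in>\<Psi>. f \<psi> * g \<psi>) v = \<rho> f (\<rho> g v)"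
  using rep by (simp add: unital_star_rep_def)

lemma zero: "v \<in> H \<Longrightarrow> \<rho> (\<lambda>\<psi>\<in>\<Psi>. 0) v = 0"
  using scale[OF Cb_const, of v 0 1] by (simp cong: restrict_cong)

lemma diff: "f \<in> Cb \<Psi> \<Longrightarrow> g \<in> Cb \<Psi> \<Longrightarrow> v \<in> H \<Longrightarrow> \<rho> (\<lambda>\<psi>\<in>\<Psi>. f \<psi> - g \<psi>) v = \<rho> f v - \<rho> g v"
  using add[OF _ Cb_scale, of f g v "-1"] scale[of g v "-1"] by (simp cong: restrict_cong)

lemma cinner_rep: "g \<in> Cb \<Psi> \<Longrightarrow> v \<in> H \<Longrightarrow> w \<in> H \<Longrightarrow> cinner (\<rho> g v) w = cinner v (\<rho> (\<lambda>\<psi>\<in>\<Psi>. cnj (g \<psi>)) w)"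
  using rep cinner_adj[OF H bounded] by (simp add: unital_star_rep_def)

lemma cinner_rep_rep:
  assumes f: "f \<in> Cb \<Psi>" and g: "g \<in> Cb \<Psi>" and v: "v \<in> H" and w: "w \<in> H"
  shows "cinner (\<rho> f v) (\<rho> g w) = cinner (\<rho> (\<lambda>\<psi>\<in>\<Psi>. f \<psi> * cnj (g \<psi>)) v) w"
proof -
  have "cinner (\<rho> f v) (\<rho> g w) = cnj (cinner (\<rho> g w) (\<rho> f v))"
    by (rule cinner_commute)
  also have "\<dots> = cnj (cinner w (\<rho> (\<lambda>\<psi>\<in>\<Psi>. cnj (g \<psi>)) (\<rho> f v)))"
    by (simp add: cinner_rep g w mem f v)
  also have "\<dots> = cinner (\<rho> (\<lambda>\<psi>\<in>\<Psi>. cnj (g \<psi>)) (\<rho> f v)) w"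
    by (rule cinner_commute[symmetric])
  also have "\<rho> (\<lambda>\<psi>\<in>\<Psi>. cnj (g \<psi>)) (\<rho> f v) = \<rho> (\<lambda>\<psi>\<in>\<Psi>. f \<psi> * cnj (g \<psi>)) v"
    using mult[OF Cb_cnj[OF g] f v] by (simp add: mult.commute cong: restrict_cong)
  finally show ?thesis .
qed

text \<open>
  Complete positivity: uniformly positive definite matrices over \<open>Cb \<Psi>\<close> are eliminated row by row
  (Cholesky). Splitting off the rank one part \<open>q\<^sub>i cnj(q\<^sub>j)\<close> leaves the Schur complement, which has the
  same lower bound.
\<close>

lemma positive_definite:
  fixes n :: nat
  assumes "\<epsilon> > 0" "\<And>i j. P i j \<in> Cb \<Psi>" "\<And>i j \<psi>. \<psi> \<in> \<Psi> \<Longrightarrow> P j i \<psi> = cnj (P i j \<psi>)"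
    and "\<And>\<psi> c. \<psi> \<in> \<Psi> \<Longrightarrow> (\<Sum>i<n. \<Sum>j<n. c i * cnj (c j) * P i j \<psi>) - (\<Sum>i<n. of_real (\<epsilon> * (cmod (c i))\<^sup>2)) \<in> \<real>\<^sub>\<ge>\<^sub>0"
    and v: "\<And>i. v i \<in> H"
  shows "(\<Sum>i<n. \<Sum>j<n. cinner (\<rho> (P i j) (v i)) (v j)) \<in> \<real>\<^sub>\<ge>\<^sub>0"
  using assms(2-4)
proof (induct n arbitrary: P)
  case 0
  show ?case by simp
next
  case (Suc n)
  note P = Suc.prems
  define p where "p \<psi> = Re (P n n \<psi>)" for \<psi>
  \<comment> \<open>Testing with the last unit vector: the corner entry is real and at least
    \<epsilon>, so division by its square root stays inside \<open>Cb \<Psi>\<close>.\<close>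
  have pn: "P n n \<psi> = of_real (p \<psi>)" "p \<psi> \<ge> \<epsilon>" if "\<psi> \<in> \<Psi>" for \<psi>
  proof -
    have "(\<Sum>i<n. \<Sum>j<n. (if i = n then 1 else 0) * cnj (if j = n then 1 else 0) * P i j \<psi>) = 0"
      by (intro sum.neutral ballI) auto
    moreover have "(\<Sum>i<n. complex_of_real (\<epsilon> * (cmod (if i = n then 1 else 0))\<^sup>2)) = 0"
      "(\<Sum>i<n. (if i = n then 1 else 0) * P i n \<psi>) = 0"
      "(\<Sum>j<n. cnj (if j = n then 1 else 0) * P n j \<psi>) = 0"
      by (intro sum.neutral ballI; auto)+
    ultimately have "P n n \<psi> - of_real \<epsilon> \<in> \<real>\<^sub>\<ge>\<^sub>0"
      using P(3)[OF that, of "\<lambda>i. if i = n then 1 else 0"] by (simp add: sum.distrib)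
    then show "P n n \<psi> = of_real (p \<psi>)" "p \<psi> \<ge> \<epsilon>"
      by (simp_all add: complex_nonneg_Reals_iff p_def complex_eq_iff)
  qed
  define q where "q i = (\<lambda>\<psi>\<in>\<Psi>. P i n \<psi> / of_real (sqrt (p \<psi>)))" for i
  have q: "q i \<in> Cb \<Psi>" for i
  proof -
    obtain M where M: "M \<ge> 0" "\<And>\<psi>. \<psi> \<in> \<Psi> \<Longrightarrow> cmod (P i n \<psi>) \<le> M"
      using Cb_bound[OF P(1)[of i n]] by blast
    show ?thesis
      unfolding q_def
    proof (rule CbI)
      show "continuous_on \<Psi> (\<lambda>\<psi>. P i n \<psi> / of_real (sqrt (p \<psi>)))"
        unfolding p_def using pn(2) assms(1)
        by (intro continuous_intros Cb_continuous P(1)) (force simp: p_def)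
      show "cmod (P i n \<psi> / of_real (sqrt (p \<psi>))) \<le> M / sqrt \<epsilon>" if "\<psi> \<in> \<Psi>" for \<psi>
        using M pn(2)[OF that] assms(1) that by (auto simp: norm_divide intro!: frac_le)
    qed
  qed
  have qq: "q i \<psi> * cnj (q j \<psi>) = P i n \<psi> * cnj (P j n \<psi>) / of_real (p \<psi>)" if "\<psi> \<in> \<Psi>" for i j \<psi>
    using that pn(2)[OF that] assms(1) by (simp add: q_def flip: of_real_mult)
  have pnz: "complex_of_real (p \<psi>) \<noteq> 0" if "\<psi> \<in> \<Psi>" for \<psi>
    using pn(2)[OF that] assms(1) by auto
  define P' where "P' i j = (\<lambda>\<psi>\<in>\<Psi>. P i j \<psi> - q i \<psi> * cnj (q j \<psi>))" for i j
  have P': "P' i j \<in> Cb \<Psi>" for i j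
    using Cb_diff[OF P(1) Cb_mult_cnj[OF q q], of i j i j] by (simp add: P'_def cong: restrict_cong)
  have P'n: "P' i j = (\<lambda>\<psi>\<in>\<Psi>. 0)" if "i = n \<or> j = n" for i j
    unfolding P'_def
  proof (intro restrict_ext)
    fix \<psi> assume \<psi>: "\<psi> \<in> \<Psi>"
    show "P i j \<psi> - q i \<psi> * cnj (q j \<psi>) = 0"
      using that pnz[OF \<psi>] P(2)[OF \<psi>, of n j] unfolding qq[OF \<psi>] by (auto simp: pn(1)[OF \<psi>])
  qed
  have IH: "(\<Sum>i<n. \<Sum>j<n. cinner (\<rho> (P' i j) (v i)) (v j)) \<in> \<real>\<^sub>\<ge>\<^sub>0"
  proof (rule Suc.hyps[OF P'])
    fix i j \<psi> assume \<psi>: "\<psi> \<in> \<Psi>"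
    show "P' j i \<psi> = cnj (P' i j \<psi>)"
      using \<psi> P(2)[OF \<psi>, of i j] by (simp add: P'_def mult.commute)
  next
    fix \<psi> and c :: "nat \<Rightarrow> complex" assume \<psi>: "\<psi> \<in> \<Psi>"
    define w where "w = (\<Sum>i<n. c i * P i n \<psi>)"
    \<comment> \<open>The last coefficient that minimizes the form of P when the others are fixed;
      the minimum is the form of the Schur complement P'.\<close>
    define t where "t = - w / of_real (p \<psi>)"
    have cw: "(\<Sum>j<n. cnj (c j) * P n j \<psi>) = cnj w"
      unfolding w_def cnj_sum complex_cnj_mult by (intro sum.cong refl) (simp add: P(2)[OF \<psi>, of _ n])
    have wt: "(\<Sum>i<n. c i * cnj t * P i n \<psi>) = w * cnj t" "(\<Sum>j<n. t * cnj (c j) * P n j \<psi>) = t * cnj w"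
      unfolding cw[symmetric] unfolding w_def sum_distrib_left sum_distrib_right
      by (intro sum.cong refl; simp only: mult_ac)+
    have "(\<Sum>i<Suc n. \<Sum>j<Suc n. d i * cnj (d j) * P i j \<psi>)
        = (\<Sum>i<n. \<Sum>j<n. d i * cnj (d j) * P i j \<psi>) + (\<Sum>i<n. d i * cnj (d n) * P i n \<psi>)
          + (\<Sum>j<n. d n * cnj (d j) * P n j \<psi>) + d n * cnj (d n) * P n n \<psi>" for d
      by (simp add: sum.distrib)
    from this[of "c(n := t)"]
    have *: "(\<Sum>i<Suc n. \<Sum>j<Suc n. (c(n := t)) i * cnj ((c(n := t)) j) * P i j \<psi>)
        = (\<Sum>i<n. \<Sum>j<n. c i * cnj (c j) * P i j \<psi>) + w * cnj t + t * cnj w + t * cnj t * of_real (p \<psi>)"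
      by (simp add: wt pn(1)[OF \<psi>] del: sum.lessThan_Suc)
    have "(\<Sum>i<n. \<Sum>j<n. c i * cnj (c j) * P' i j \<psi>)
        = (\<Sum>i<n. \<Sum>j<n. c i * cnj (c j) * P i j \<psi>) - (\<Sum>i<n. \<Sum>j<n. (c i * P i n \<psi>) * cnj (c j * P j n \<psi>)) / of_real (p \<psi>)"
      using \<psi> by (simp add: P'_def qq[OF \<psi>] sum_subtractf sum_divide_distrib algebra_simps)
    also have "(\<Sum>i<n. \<Sum>j<n. (c i * P i n \<psi>) * cnj (c j * P j n \<psi>)) = w * cnj w"
      by (simp add: w_def sum_product cnj_sum)
    also have "(\<Sum>i<n. \<Sum>j<n. c i * cnj (c j) * P i j \<psi>) - w * cnj w / of_real (p \<psi>)
        = (\<Sum>i<n. \<Sum>j<n. c i * cnj (c j) * P i j \<psi>) + w * cnj t + t * cnj w + t * cnj t * of_real (p \<psi>)"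
      using pnz[OF \<psi>] by (simp add: t_def field_simps)
    finally have eq: "(\<Sum>i<n. \<Sum>j<n. c i * cnj (c j) * P' i j \<psi>) = (\<Sum>i<Suc n. \<Sum>j<Suc n. (c(n := t)) i * cnj ((c(n := t)) j) * P i j \<psi>)"
      unfolding * .
    \<comment> \<open>Dropping the coefficient t leaves a nonnegative surplus \<epsilon> |t|^2, so
      the lower bound \<epsilon> is inherited.\<close>
    have "(\<Sum>i<n. \<Sum>j<n. c i * cnj (c j) * P' i j \<psi>) - (\<Sum>i<n. of_real (\<epsilon> * (cmod (c i))\<^sup>2))
        = ((\<Sum>i<Suc n. \<Sum>j<Suc n. (c(n := t)) i * cnj ((c(n := t)) j) * P i j \<psi>)
          - (\<Sum>i<Suc n. of_real (\<epsilon> * (cmod ((c(n := t)) i))\<^sup>2))) + of_real (\<epsilon> * (cmod t)\<^sup>2)"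
      unfolding eq by simp
    also have "\<dots> \<in> \<real>\<^sub>\<ge>\<^sub>0"
      using assms(1) by (intro nonneg_Reals_add_I P(3)[OF \<psi>]) simp
    finally show "(\<Sum>i<n. \<Sum>j<n. c i * cnj (c j) * P' i j \<psi>) - (\<Sum>i<n. of_real (\<epsilon> * (cmod (c i))\<^sup>2)) \<in> \<real>\<^sub>\<ge>\<^sub>0" .
  qed
  have split: "cinner (\<rho> (P i j) (v i)) (v j) = cinner (\<rho> (P' i j) (v i)) (v j) + cinner (\<rho> (q i) (v i)) (\<rho> (q j) (v j))" for i j
  proof -
    have "\<rho> (P' i j) (v i) = \<rho> (P i j) (v i) - \<rho> (\<lambda>\<psi>\<in>\<Psi>. q i \<psi> * cnj (q j \<psi>)) (v i)"
      using diff[OF P(1) Cb_mult_cnj[OF q q] v, of i j i j i] by (simp add: P'_def cong: restrict_cong)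
    then show ?thesis
      unfolding cinner_rep_rep[OF q q v v] by (simp add: cinner_diff_left)
  qed
  have "(\<Sum>i<Suc n. \<Sum>j<Suc n. cinner (\<rho> (P' i j) (v i)) (v j)) = (\<Sum>i<n. \<Sum>j<n. cinner (\<rho> (P' i j) (v i)) (v j))"
    by (simp add: P'n zero v)
  then have "(\<Sum>i<Suc n. \<Sum>j<Suc n. cinner (\<rho> (P i j) (v i)) (v j))
      = (\<Sum>i<n. \<Sum>j<n. cinner (\<rho> (P' i j) (v i)) (v j))
        + cinner (\<Sum>i<Suc n. \<rho> (q i) (v i)) (\<Sum>i<Suc n. \<rho> (q i) (v i))"
    unfolding split sum.distrib cinner_sum_left unfolding cinner_sum_right by simp
  also have "\<dots> \<in> \<real>\<^sub>\<ge>\<^sub>0"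
    by (intro nonneg_Reals_add_I IH cinner_self_nonneg)
  finally show ?case .
qed

text \<open>Adding \<epsilon> times the identity matrix makes P uniformly definite and changes the
  sum by \<epsilon> times the sum of the squared norms of the v i; then \<epsilon> tends to
  0.\<close>

lemma completely_positive:
  fixes n :: nat
  assumes P: "\<And>i j. P i j \<in> Cb \<Psi>" "\<And>i j \<psi>. \<psi> \<in> \<Psi> \<Longrightarrow> P j i \<psi> = cnj (P i j \<psi>)"
    and pos: "\<And>\<psi> c. \<psi> \<in> \<Psi> \<Longrightarrow> (\<Sum>i<n. \<Sum>j<n. c i * cnj (c j) * P i j \<psi>) \<in> \<real>\<^sub>\<ge>\<^sub>0"
    and v: "\<And>i. v i \<in> H"
  shows "(\<Sum>i<n. \<Sum>j<n. cinner (\<rho> (P i j) (v i)) (v j)) \<in> \<real>\<^sub>\<ge>\<^sub>0"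
proof -
  define S where "S = (\<Sum>i<n. \<Sum>j<n. cinner (\<rho> (P i j) (v i)) (v j))"
  define K where "K = (\<Sum>i<n. (norm (v i))\<^sup>2)"
  have K: "K \<ge> 0" by (simp add: K_def sum_nonneg)
  have *: "S + of_real (\<epsilon> * K) \<in> \<real>\<^sub>\<ge>\<^sub>0" if \<epsilon>: "\<epsilon> > 0" for \<epsilon>
  proof -
    define \<delta> where "\<delta> i j = (if i = j then complex_of_real \<epsilon> else 0)" for i j :: nat
    define Q where "Q i j = (\<lambda>\<psi>\<in>\<Psi>. P i j \<psi> + (\<lambda>\<psi>\<in>\<Psi>. \<delta> i j) \<psi>)" for i j
    have Q: "Q i j \<in> Cb \<Psi>" for i j
      unfolding Q_def by (rule Cb_add[OF P(1) Cb_const])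
    have "(\<Sum>i<n. \<Sum>j<n. cinner (\<rho> (Q i j) (v i)) (v j)) \<in> \<real>\<^sub>\<ge>\<^sub>0"
    proof (rule positive_definite[OF \<epsilon> Q _ _ v])
      show "Q j i \<psi> = cnj (Q i j \<psi>)" if "\<psi> \<in> \<Psi>" for i j \<psi>
        using P(2)[OF that, of i j] that by (simp add: Q_def \<delta>_def)
    next
      fix \<psi> and c :: "nat \<Rightarrow> complex" assume \<psi>: "\<psi> \<in> \<Psi>"
      have "(\<Sum>i<n. \<Sum>j<n. c i * cnj (c j) * \<delta> i j) = (\<Sum>i<n. complex_of_real (\<epsilon> * (cmod (c i))\<^sup>2))"
      proof (rule sum.cong[OF refl])
        fix i assume "i \<in> {..<n}"
        have "(\<Sum>j<n. c i * cnj (c j) * \<delta> i j) = (\<Sum>j<n. if i = j then c i * cnj (c i) * of_real \<epsilon> else 0)"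
          by (intro sum.cong) (auto simp: \<delta>_def)
        then show "(\<Sum>j<n. c i * cnj (c j) * \<delta> i j) = complex_of_real (\<epsilon> * (cmod (c i))\<^sup>2)"
          using \<open>i \<in> {..<n}\<close> complex_norm_square[of "c i"] by (simp add: sum.delta')
      qed
      then show "(\<Sum>i<n. \<Sum>j<n. c i * cnj (c j) * Q i j \<psi>) - (\<Sum>i<n. of_real (\<epsilon> * (cmod (c i))\<^sup>2)) \<in> \<real>\<^sub>\<ge>\<^sub>0"
        using pos[OF \<psi>, of c] \<psi> by (simp add: Q_def distrib_left sum.distrib)
    qed
    also have "(\<Sum>i<n. \<Sum>j<n. cinner (\<rho> (Q i j) (v i)) (v j)) = S + of_real (\<epsilon> * K)"
    proof -
      have "\<rho> (Q i j) (v i) = \<rho> (P i j) (v i) + \<delta> i j *\<^sub>C v i" for i j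
        using scale[OF Cb_const v, of "\<delta> i j" 1 i] add[OF P(1) Cb_const v, of i j "\<delta> i j" i] one[OF v]
        by (simp add: Q_def cong: restrict_cong)
      moreover have "(\<Sum>i<n. \<Sum>j<n. \<delta> i j * cinner (v i) (v j)) = of_real (\<epsilon> * K)"
        by (simp add: \<delta>_def K_def if_distrib[of "\<lambda>x. x * _"] sum.delta' cinner_self sum_distrib_left cong: if_cong)
      ultimately show ?thesis
        by (simp add: S_def cinner_add_left cinner_scaleC_left sum.distrib)
    qed
    finally show ?thesis .
  qed
  have "Im S = 0"
    using *[of 1] by (simp add: complex_nonneg_Reals_iff)
  moreover have "0 \<le> Re S"
  proof (rule field_le_epsilon)
    fix e :: real assume e: "e > 0"
    have "0 \<le> Re S + e / (K + 1) * K"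
      using *[of "e / (K + 1)"] e K by (simp add: complex_nonneg_Reals_iff)
    also have "e / (K + 1) * K \<le> e"
      using e K by (simp add: field_simps)
    finally show "0 \<le> Re S + e" by simp
  qed
  ultimately show ?thesis
    by (simp add: S_def complex_nonneg_Reals_iff)
qed

text \<open>Boundedness of \<rho> g supplies only some constant. The sharp one is the case n = 1 of
  complete positivity, applied to m^2 - |g|^2.\<close>

lemma norm_le:
  assumes g: "g \<in> Cb \<Psi>" "\<And>\<psi>. \<psi> \<in> \<Psi> \<Longrightarrow> cmod (g \<psi>) \<le> m" and m: "m \<ge> 0" and v: "v \<in> H"
  shows "norm (\<rho> g v) \<le> m * norm v"
proof -
  define P where "P = (\<lambda>\<psi>\<in>\<Psi>. complex_of_real (m\<^sup>2) - g \<psi> * cnj (g \<psi>))"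
  have P: "P \<in> Cb \<Psi>"
    using Cb_diff[OF Cb_const Cb_mult_cnj[OF g(1) g(1)], of "of_real (m\<^sup>2)"]
    by (simp add: P_def cong: restrict_cong)
  have "(\<Sum>i<(1::nat). \<Sum>j<(1::nat). cinner (\<rho> P v) v) \<in> \<real>\<^sub>\<ge>\<^sub>0"
  proof (rule completely_positive[of "\<lambda>_ _. P", OF P])
    show "P \<psi> = cnj (P \<psi>)" if "\<psi> \<in> \<Psi>" for \<psi>
      using that by (simp add: P_def)
    show "(\<Sum>i<(1::nat). \<Sum>j<(1::nat). c i * cnj (c j) * P \<psi>) \<in> \<real>\<^sub>\<ge>\<^sub>0" if "\<psi> \<in> \<Psi>" for \<psi> c
    proof -
      have "(cmod (g \<psi>))\<^sup>2 \<le> m\<^sup>2"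
        using g(2)[OF that] by (intro power_mono) auto
      moreover have "P \<psi> = of_real (m\<^sup>2 - (cmod (g \<psi>))\<^sup>2)" "c 0 * cnj (c 0) = of_real ((cmod (c 0))\<^sup>2)"
        using that complex_norm_square[of "g \<psi>"] complex_norm_square[of "c 0"] by (simp_all add: P_def)
      ultimately show ?thesis
        by (simp add: complex_nonneg_Reals_iff del: of_real_diff of_real_power)
    qed
  qed (rule v)
  moreover have "\<rho> P v = of_real (m\<^sup>2) *\<^sub>C v - \<rho> (\<lambda>\<psi>\<in>\<Psi>. g \<psi> * cnj (g \<psi>)) v"
    using diff[OF Cb_const Cb_mult_cnj[OF g(1) g(1)] v, of "of_real (m\<^sup>2)"]
      scale[OF Cb_const v, of "of_real (m\<^sup>2)" 1] one[OF v]
    by (simp add: P_def cong: restrict_cong)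
  ultimately have "of_real (m\<^sup>2) * cinner v v - cinner (\<rho> g v) (\<rho> g v) \<in> \<real>\<^sub>\<ge>\<^sub>0"
    using cinner_rep_rep[OF g(1) g(1) v v] by (simp add: cinner_diff_left cinner_scaleC_left)
  then have "complex_of_real (m\<^sup>2 * (norm v)\<^sup>2 - (norm (\<rho> g v))\<^sup>2) \<in> \<real>\<^sub>\<ge>\<^sub>0"
    by (simp only: cinner_self of_real_mult of_real_diff)
  then have "(norm (\<rho> g v))\<^sup>2 \<le> (m * norm v)\<^sup>2"
    by (simp add: complex_nonneg_Reals_iff power_mult_distrib del: of_real_diff of_real_mult of_real_power)
  then show ?thesis
    using m by (simp add: power2_le_iff_abs_le)
qed

end

lemma unital_star_repI:
  assumes H: "hilbert_space H"
    and bounded: "\<And>g. g \<in> Cb \<Psi> \<Longrightarrow> \<rho> g \<in> bounded_ops H H"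
    and one: "\<And>v. v \<in> H \<Longrightarrow> \<rho> (\<lambda>\<psi>\<in>\<Psi>. 1) v = v"
    and add: "\<And>f g v. f \<in> Cb \<Psi> \<Longrightarrow> g \<in> Cb \<Psi> \<Longrightarrow> v \<in> H \<Longrightarrow> \<rho> (\<lambda>\<psi>\<in>\<Psi>. f \<psi> + g \<psi>) v = \<rho> f v + \<rho> g v"
    and scale: "\<And>c g v. g \<in> Cb \<Psi> \<Longrightarrow> v \<in> H \<Longrightarrow> \<rho> (\<lambda>\<psi>\<in>\<Psi>. c * g \<psi>) v = c *\<^sub>C \<rho> g v"
    and mult: "\<And>f g v. f \<in> Cb \<Psi> \<Longrightarrow> g \<in> Cb \<Psi> \<Longrightarrow> v \<in> H \<Longrightarrow> \<rho> (\<lambda>\<psi>\<in>\<Psi>. f \<psi> * g \<psi>) v = \<rho> f (\<rho> g v)"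
    and star: "\<And>g v w. g \<in> Cb \<Psi> \<Longrightarrow> v \<in> H \<Longrightarrow> w \<in> H \<Longrightarrow> cinner (\<rho> g v) w = cinner v (\<rho> (\<lambda>\<psi>\<in>\<Psi>. cnj (g \<psi>)) w)"
  shows "unital_star_rep \<Psi> H \<rho>"
proof -
  have "\<rho> (\<lambda>\<psi>\<in>\<Psi>. cnj (g \<psi>)) w = adj H (\<rho> g) w" if "g \<in> Cb \<Psi>" "w \<in> H" for g w
    by (rule adj_eqI[symmetric, OF H])
      (use that star bounded_ops_mem[OF bounded[OF Cb_cnj]] in auto)
  then show ?thesis
    unfolding unital_star_rep_def by (simp add: bounded one add scale mult)
qed

lemma reducible_rep_restrict:
  assumes red: "reducible_rep \<Psi> H K \<rho>" and hH: "hilbert_space H" and hK: "hilbert_space K"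
  shows "unital_star_rep \<Psi> H (\<lambda>g h. fst (\<rho> g (h, 0)))" (is "unital_star_rep _ _ ?\<rho>1")
    and "unital_star_rep \<Psi> K (\<lambda>g k. snd (\<rho> g (0, k)))" (is "unital_star_rep _ _ ?\<rho>2")
    and "g \<in> Cb \<Psi> \<Longrightarrow> h \<in> H \<Longrightarrow> k \<in> K \<Longrightarrow> \<rho> g (h, k) = (fst (\<rho> g (h, 0)), snd (\<rho> g (0, k)))"
proof -
  have HK: "hilbert_space (H \<times> K)"
    by (rule hilbert_space_Times[OF hH hK])
  interpret star_rep \<Psi> "H \<times> K" \<rho>
    by (rule star_rep.intro[OF HK]) (use red in \<open>simp add: reducible_rep_def\<close>)
  note H0 = hilbert_space_zero[OF hH] and K0 = hilbert_space_zero[OF hK]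
  have e1: "\<rho> g (h, 0) = (?\<rho>1 g h, 0)" if "g \<in> Cb \<Psi>" "h \<in> H" for g h
  proof -
    have "\<rho> g (h, 0) \<in> H \<times> {0}"
      using red that by (auto simp: reducible_rep_def image_subset_iff)
    then show ?thesis by (auto simp: prod_eq_iff)
  qed
  have e2: "\<rho> g (0, k) = (0, ?\<rho>2 g k)" if "g \<in> Cb \<Psi>" "k \<in> K" for g k
  proof -
    have "\<rho> g (0, k) \<in> {0} \<times> K"
      using red that by (auto simp: reducible_rep_def image_subset_iff)
    then show ?thesis by (auto simp: prod_eq_iff)
  qed
  show "\<rho> g (h, k) = (?\<rho>1 g h, ?\<rho>2 g k)" if "g \<in> Cb \<Psi>" "h \<in> H" "k \<in> K" for g h k
  proof -
    have "\<rho> g (h, k) = \<rho> g (h, 0) + \<rho> g (0, k)"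
      using bounded_ops_add[OF bounded[OF that(1)], of "(h, 0)" "(0, k)"] that H0 K0 by simp
    also have "\<dots> = (?\<rho>1 g h, 0) + (0, ?\<rho>2 g k)"
      by (rule arg_cong2[OF e1[OF that(1,2)] e2[OF that(1,3)]])
    finally show ?thesis by simp
  qed
  show "unital_star_rep \<Psi> H ?\<rho>1"
  proof (rule unital_star_repI[OF hH])
    show "?\<rho>1 g \<in> bounded_ops H H" if "g \<in> Cb \<Psi>" for g
      by (rule bounded_ops_comp[OF bounded_ops_comp[OF bounded_ops_inl[OF hK] bounded[OF that]] bounded_ops_fst])
    show "cinner (?\<rho>1 g v) w = cinner v (?\<rho>1 (\<lambda>\<psi>\<in>\<Psi>. cnj (g \<psi>)) w)"
      if "g \<in> Cb \<Psi>" "v \<in> H" "w \<in> H" for g v w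
      using cinner_rep[OF that(1), of "(v, 0)" "(w, 0)"] that K0
      by (simp add: cinner_prod_def)
    show "?\<rho>1 (\<lambda>\<psi>\<in>\<Psi>. f \<psi> * g \<psi>) v = ?\<rho>1 f (?\<rho>1 g v)" if "f \<in> Cb \<Psi>" "g \<in> Cb \<Psi>" "v \<in> H" for f g v
      using mult[OF that(1,2), of "(v, 0)"] arg_cong[OF e1[OF that(2,3)], of "\<rho> f"] that K0 by simp
  qed (use K0 one add scale in \<open>simp_all add: scaleC_prod_def\<close>)
  show "unital_star_rep \<Psi> K ?\<rho>2"
  proof (rule unital_star_repI[OF hK])
    show "?\<rho>2 g \<in> bounded_ops K K" if "g \<in> Cb \<Psi>" for g
      by (rule bounded_ops_comp[OF bounded_ops_comp[OF bounded_ops_inr[OF hH] bounded[OF that]] bounded_ops_snd])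
    show "cinner (?\<rho>2 g v) w = cinner v (?\<rho>2 (\<lambda>\<psi>\<in>\<Psi>. cnj (g \<psi>)) w)"
      if "g \<in> Cb \<Psi>" "v \<in> K" "w \<in> K" for g v w
      using cinner_rep[OF that(1), of "(0, v)" "(0, w)"] that H0
      by (simp add: cinner_prod_def)
    show "?\<rho>2 (\<lambda>\<psi>\<in>\<Psi>. f \<psi> * g \<psi>) v = ?\<rho>2 f (?\<rho>2 g v)" if "f \<in> Cb \<Psi>" "g \<in> Cb \<Psi>" "v \<in> K" for f g v
      using mult[OF that(1,2), of "(0, v)"] arg_cong[OF e2[OF that(2,3)], of "\<rho> f"] that H0 by simp
  qed (use H0 one add scale in \<open>simp_all add: scaleC_prod_def\<close>)
qed

lemma reducible_rep_Times:
  assumes "star_rep \<Psi> H \<rho>" "star_rep \<Psi> K \<sigma>"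
  shows "reducible_rep \<Psi> H K (\<lambda>g p. (\<rho> g (fst p), \<sigma> g (snd p)))"
proof -
  interpret \<rho>: star_rep \<Psi> H \<rho> by fact
  interpret \<sigma>: star_rep \<Psi> K \<sigma> by fact
  have "unital_star_rep \<Psi> (H \<times> K) (\<lambda>g p. (\<rho> g (fst p), \<sigma> g (snd p)))"
  proof (rule unital_star_repI[OF hilbert_space_Times[OF \<rho>.H \<sigma>.H]])
    show "(\<lambda>p. (\<rho> g (fst p), \<sigma> g (snd p))) \<in> bounded_ops (H \<times> K) (H \<times> K)" if "g \<in> Cb \<Psi>" for g
      by (rule bounded_ops_Pair[OF bounded_ops_comp[OF bounded_ops_fst \<rho>.bounded[OF that]]
            bounded_ops_comp[OF bounded_ops_snd \<sigma>.bounded[OF that]]])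
    show "cinner (\<rho> g (fst v), \<sigma> g (snd v)) w = cinner v (\<rho> (\<lambda>\<psi>\<in>\<Psi>. cnj (g \<psi>)) (fst w), \<sigma> (\<lambda>\<psi>\<in>\<Psi>. cnj (g \<psi>)) (snd w))"
      if "g \<in> Cb \<Psi>" "v \<in> H \<times> K" "w \<in> H \<times> K" for g v w
      using that by (auto simp: cinner_prod_def \<rho>.cinner_rep \<sigma>.cinner_rep)
  qed (auto simp: \<rho>.one \<sigma>.one \<rho>.add \<sigma>.add \<rho>.scale \<sigma>.scale \<rho>.mult \<sigma>.mult scaleC_Pair)
  moreover have "\<rho> g 0 = 0" "\<sigma> g 0 = 0" if "g \<in> Cb \<Psi>" for g
    using bounded_ops_zero[OF \<rho>.bounded[OF that] \<rho>.H] bounded_ops_zero[OF \<sigma>.bounded[OF that] \<sigma>.H] by auto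
  ultimately show ?thesis
    by (auto simp: reducible_rep_def \<rho>.mem \<sigma>.mem)
qed

subsection \<open>Isometric colligations\<close>

lemma isometric_opI:
  assumes "T \<in> bounded_ops H K" "\<And>x. x \<in> H \<Longrightarrow> cinner (T x) (T x) = cinner x x"
  shows "isometric_op H K T"
  using assms norm_eqI_cinner unfolding isometric_op_def by blast

lemma isometric_op_cinner:
  assumes T: "isometric_op H K T" and H: "hilbert_space H" and x: "x \<in> H" and y: "y \<in> H"
  shows "cinner (T x) (T y) = cinner x y"
proof -
  have b: "T \<in> bounded_ops H K" and n: "\<And>x. x \<in> H \<Longrightarrow> norm (T x) = norm x"
    using T by (auto simp: isometric_op_def)
  have re: "Re (cinner (T x) (T y)) = Re (cinner x y)" if "x \<in> H" "y \<in> H" for x y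
  proof -
    have "(norm (T x + T y))\<^sup>2 = (norm (x + y))\<^sup>2"
      using n[of "x + y"] that by (simp add: bounded_ops_add[OF b] hilbert_space_add[OF H])
    then have "inner (T x) (T y) = inner x y"
      using n that unfolding dot_norm by simp
    then show ?thesis by (simp add: inner_cinner)
  qed
  \<comment> \<open>The imaginary part of an inner product is the real part of the one with y
    multiplied by i.\<close>
  have "Im (cinner (T x) (T y)) = Im (cinner x y)"
    using re[OF x hilbert_space_scaleC[OF H y], of \<i>] y
    by (simp add: bounded_ops_scaleC[OF b] cinner_scaleC_right)
  with re[OF x y] show ?thesis
    by (simp add: complex_eq_iff)
qed

text \<open>Banach's fixed point theorem takes the place of the Neumann series for the inverse of I
  - T.\<close>

lemma contraction_solution_ex:
  assumes H: "hilbert_space H" and T: "T \<in> bounded_ops H H" and r: "0 \<le> r" "r < 1"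
    and le: "\<And>x. x \<in> H \<Longrightarrow> norm (T x) \<le> r * norm x" and c: "c \<in> H"
  shows "\<exists>w\<in>H. w = c + T w"
proof -
  have "\<exists>!w\<in>H. c + T w = w"
  proof (rule Banach_fix[OF _ _ r])
    show "complete H"
      using hilbert_space_closed[OF H] by (simp add: complete_eq_closed)
    show "H \<noteq> {}"
      using c by blast
    show "(\<lambda>w. c + T w) ` H \<subseteq> H"
      using bounded_ops_mem[OF T] hilbert_space_add[OF H c] by blast
    show "dist (c + T x) (c + T y) \<le> r * dist x y" if "x \<in> H" "y \<in> H" for x y
      using le[OF hilbert_space_diff[OF H that]] by (simp add: dist_norm bounded_ops_diff[OF T H that])
  qed
  then show ?thesis by metis
qed

text \<open>Implicit form of the transfer function: with Z = \<rho>(E(x)) the vector w is the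
  internal state, and eliminating it from U(e, Z w) = (f(x) e, w) gives A + B Z (I - D Z)^(-1) C for
  the blocks of U.\<close>

definition realization :: "('x \<Rightarrow> complex) set \<Rightarrow> 'h::chilbert set \<Rightarrow>
    ((('x \<Rightarrow> complex) \<Rightarrow> complex) \<Rightarrow> 'h \<Rightarrow> 'h) \<Rightarrow> ('e::chilbert \<times> 'h \<Rightarrow> 'e \<times> 'h) \<Rightarrow> ('x \<Rightarrow> 'e \<Rightarrow> 'e) \<Rightarrow> bool"
  where "realization \<Psi> H \<rho> U f \<longleftrightarrow> star_rep \<Psi> H \<rho> \<and> isometric_op (UNIV \<times> H) (UNIV \<times> H) U \<and>
    (\<forall>x e. \<exists>w\<in>H. U (e, \<rho> (evaluation \<Psi> x) w) = (f x e, w))"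

context star_rep
begin

lemma evaluation_contraction:
  assumes "test_functions \<Psi>"
  obtains r where "0 \<le> r" "r < 1" "\<And>v. v \<in> H \<Longrightarrow> norm (\<rho> (evaluation \<Psi> x) v) \<le> r * norm v"
proof -
  obtain r where r: "0 \<le> r" "r < 1" "\<And>\<psi>. \<psi> \<in> \<Psi> \<Longrightarrow> cmod (\<psi> x) \<le> r"
    using test_functions_bound[OF assms, of x] by metis
  show ?thesis
  proof (rule that[OF r(1,2)])
    show "norm (\<rho> (evaluation \<Psi> x) v) \<le> r * norm v" if "v \<in> H" for v
      by (rule norm_le[OF evaluation_Cb[OF assms] _ r(1) that]) (simp add: evaluation_def r)
  qed
qed

lemma realization_ex:
  assumes \<Psi>: "test_functions \<Psi>" and U: "isometric_op (UNIV \<times> H) (UNIV \<times> H) U"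
  shows "\<exists>f. realization \<Psi> H \<rho> U f"
proof -
  have UH: "hilbert_space (UNIV \<times> H)"
    by (intro hilbert_space_Times hilbert_space_UNIV H)
  have b: "U \<in> bounded_ops (UNIV \<times> H) (UNIV \<times> H)" and n: "\<And>x. x \<in> UNIV \<times> H \<Longrightarrow> norm (U x) = norm x"
    using U by (auto simp: isometric_op_def)
  have "\<exists>g w. w \<in> H \<and> U (e, \<rho> (evaluation \<Psi> x) w) = (g, w)" for x e
  proof -
    let ?Z = "\<rho> (evaluation \<Psi> x)"
    have Z: "?Z \<in> bounded_ops H H"
      by (rule bounded[OF evaluation_Cb[OF \<Psi>]])
    obtain r where r: "0 \<le> r" "r < 1" "\<And>v. v \<in> H \<Longrightarrow> norm (?Z v) \<le> r * norm v"
      using evaluation_contraction[OF \<Psi>, of x] by metis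
    \<comment> \<open>The state equation w = C e + D Z w is solvable because D is a corner of an
      isometry and Z shrinks norms by r < 1.\<close>
    have "\<exists>w\<in>H. w = snd (U (e, 0)) + snd (U (0, ?Z w))"
    proof (rule contraction_solution_ex[OF H _ r(1,2)])
      show "(\<lambda>w. snd (U (0, ?Z w))) \<in> bounded_ops H H"
        by (rule bounded_ops_comp[OF bounded_ops_comp[OF bounded_ops_comp[OF Z bounded_ops_inr[OF hilbert_space_UNIV]] b] bounded_ops_snd])
      show "norm (snd (U (0, ?Z w))) \<le> r * norm w" if "w \<in> H" for w
      proof -
        have "norm (snd (U (0, ?Z w))) \<le> norm (U (0, ?Z w))"
          by (metis norm_snd_le prod.collapse)
        also have "\<dots> = norm (?Z w)"
          using n[of "(0, ?Z w)"] bounded_ops_mem[OF Z that] by (simp add: norm_Pair)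
        also have "\<dots> \<le> r * norm w" by (rule r(3)[OF that])
        finally show ?thesis .
      qed
      show "snd (U (e, 0)) \<in> H"
        using bounded_ops_mem[OF b, of "(e, 0)"] hilbert_space_zero[OF H] by auto
    qed
    then obtain w where w: "w \<in> H" "w = snd (U (e, 0)) + snd (U (0, ?Z w))" by blast
    have "U (e, ?Z w) = U (e, 0) + U (0, ?Z w)"
      using bounded_ops_add[OF b, of "(e, 0)" "(0, ?Z w)"] bounded_ops_mem[OF Z w(1)] hilbert_space_zero[OF H] by simp
    then have "snd (U (e, ?Z w)) = w"
      using w(2) by simp
    then show ?thesis
      using w(1) by (intro exI[of _ "fst (U (e, ?Z w))"] exI[of _ w]) (simp add: prod_eq_iff)
  qed
  then have "\<forall>x. \<exists>h. \<forall>e. \<exists>w\<in>H. U (e, \<rho> (evaluation \<Psi> x) w) = (h e, w)"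
    by (intro allI choice) blast
  from choice[OF this] show ?thesis
    unfolding realization_def using star_rep_axioms U by blast
qed

text \<open>Passes from the implicit form to \<open>the_inv_into\<close>: the composite of D and
  \<rho>(E(x)) is strictly contractive, so the state is the only preimage of c.\<close>

lemma resolvent_eqI:
  assumes \<Psi>: "test_functions \<Psi>" and D: "D \<in> bounded_ops H H" "\<And>v. v \<in> H \<Longrightarrow> norm (D v) \<le> norm v"
    and w: "w \<in> H" "w - D (\<rho> (evaluation \<Psi> x) w) = c"
  shows "the_inv_into H (\<lambda>v. v - D (\<rho> (evaluation \<Psi> x) v)) c = w"
proof (rule the_inv_into_f_eq)
  let ?Z = "\<rho> (evaluation \<Psi> x)"
  have Z: "?Z \<in> bounded_ops H H"
    by (rule bounded[OF evaluation_Cb[OF \<Psi>]])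
  obtain r where r: "0 \<le> r" "r < 1" "\<And>v. v \<in> H \<Longrightarrow> norm (?Z v) \<le> r * norm v"
    using evaluation_contraction[OF \<Psi>, of x] by metis
  show "inj_on (\<lambda>v. v - D (?Z v)) H"
  proof (rule inj_onI)
    fix u v assume uv: "u \<in> H" "v \<in> H" "u - D (?Z u) = v - D (?Z v)"
    have "D (?Z (u - v)) = D (?Z u) - D (?Z v)"
      by (simp add: bounded_ops_diff[OF Z H] bounded_ops_diff[OF D(1) H] bounded_ops_mem[OF Z] uv(1,2))
    also have "\<dots> = u - v"
      using uv(3) by (simp add: algebra_simps)
    finally have "norm (u - v) \<le> norm (?Z (u - v))"
      using D(2)[OF bounded_ops_mem[OF Z hilbert_space_diff[OF H uv(1,2)]]] by simp
    also have "\<dots> \<le> r * norm (u - v)"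
      by (rule r(3)[OF hilbert_space_diff[OF H uv(1,2)]])
    finally have "(1 - r) * norm (u - v) \<le> 0"
      by (simp add: algebra_simps)
    then show "u = v"
      using r(2) by (simp add: mult_le_0_iff)
  qed
qed (use w in auto)

end

text \<open>Isometry of U turns the defect of f into inner products of states against \<rho>(1 -
  E(x) cnj(E(y))). Multiplied by the entries of an admissible S, these functions form a matrix over
  \<open>Cb \<Psi>\<close> that is positive at each \<psi>, and complete positivity of \<rho>
  applies.\<close>

lemma realization_schur_agler:
  fixes f :: "'x \<Rightarrow> 'e::chilbert \<Rightarrow> 'e"
  assumes \<Psi>: "test_functions \<Psi>" and real: "realization \<Psi> H \<rho> U f"
  shows "f \<in> schur_agler_class \<Psi>"
proof -
  interpret star_rep \<Psi> H \<rho>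
    using real by (simp add: realization_def)
  have UH: "hilbert_space (UNIV \<times> H)"
    by (intro hilbert_space_Times hilbert_space_UNIV H)
  have U: "isometric_op (UNIV \<times> H) (UNIV \<times> H) U"
    using real by (simp add: realization_def)
  then have b: "U \<in> bounded_ops (UNIV \<times> H) (UNIV \<times> H)" and n: "\<And>x. x \<in> UNIV \<times> H \<Longrightarrow> norm (U x) = norm x"
    by (auto simp: isometric_op_def)
  define Z where "Z x = \<rho> (evaluation \<Psi> x)" for x
  have Z: "Z x \<in> bounded_ops H H" for x
    unfolding Z_def by (rule bounded[OF evaluation_Cb[OF \<Psi>]])
  have "\<forall>x e. \<exists>w. w \<in> H \<and> U (e, Z x w) = (f x e, w)"
    using real by (auto simp: realization_def Z_def)
  then obtain w where w: "\<And>x e. w x e \<in> H" "\<And>x e. U (e, Z x (w x e)) = (f x e, w x e)"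
    by metis
  have contr: "\<exists>r. 0 \<le> r \<and> r < 1 \<and> (\<forall>v\<in>H. norm (Z x v) \<le> r * norm v)" for x
    using evaluation_contraction[OF \<Psi>, of x] unfolding Z_def by metis
  \<comment> \<open>The states are only known to exist for each input. Uniqueness for input 0 makes
    f linear.\<close>
  have unique: "u = 0 \<and> g = 0" if u: "u \<in> H" and eq: "U (0, Z x u) = (g, u)" for x u g
  proof -
    obtain r where r: "0 \<le> r" "r < 1" "\<forall>v\<in>H. norm (Z x v) \<le> r * norm v"
      using contr[of x] by blast
    have eqn: "norm (g, u) = norm (Z x u)"
      using n[of "(0, Z x u)"] bounded_ops_mem[OF Z u] by (simp add: eq norm_Pair)
    have "norm u \<le> norm (g, u)" by (rule norm_snd_le)
    also have "\<dots> \<le> r * norm u" using eqn r(3) u by simp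
    finally have "(1 - r) * norm u \<le> 0" by (simp add: algebra_simps)
    then have "u = 0" using r(2) by (simp add: mult_le_0_iff)
    moreover from this have "norm (g, u) = 0"
      using eqn bounded_ops_zero[OF Z H] by simp
    ultimately show ?thesis by (simp add: zero_prod_def)
  qed
  have lin: "f x (c *\<^sub>C a + b) = c *\<^sub>C f x a + f x b" for x a b c
  proof -
    let ?u = "w x (c *\<^sub>C a + b) - (c *\<^sub>C w x a + w x b)"
    have uH: "?u \<in> H"
      by (intro hilbert_space_diff[OF H] hilbert_space_add[OF H] hilbert_space_scaleC[OF H] w(1))
    have "(0, Z x ?u) = (c *\<^sub>C a + b, Z x (w x (c *\<^sub>C a + b))) - (c *\<^sub>C (a, Z x (w x a)) + (b, Z x (w x b)))"
      by (simp add: bounded_ops_diff[OF Z H] bounded_ops_add[OF Z] bounded_ops_scaleC[OF Z] w(1) scaleC_Pair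
          hilbert_space_add[OF H] hilbert_space_scaleC[OF H])
    then have "U (0, Z x ?u) = U (c *\<^sub>C a + b, Z x (w x (c *\<^sub>C a + b))) - (c *\<^sub>C U (a, Z x (w x a)) + U (b, Z x (w x b)))"
      by (simp add: bounded_ops_diff[OF b UH] bounded_ops_add[OF b] bounded_ops_scaleC[OF b] w(1) bounded_ops_mem[OF Z]
          hilbert_space_add[OF UH] hilbert_space_scaleC[OF UH])
    then have "U (0, Z x ?u) = (f x (c *\<^sub>C a + b) - (c *\<^sub>C f x a + f x b), ?u)"
      by (simp add: w(2) scaleC_Pair)
    from unique[OF uH this] show ?thesis by simp
  qed
  have f: "f x \<in> bounded_ops UNIV UNIV" for x
  proof (rule bounded_opsI[where M = 1])
    have f0: "f x 0 = 0"
      using lin[of x 0 0 0] lin[of x 1 0 0] by simp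
    show "f x (a + b) = f x a + f x b" for a b
      using lin[of x 1 a b] by simp
    show "f x (c *\<^sub>C a) = c *\<^sub>C f x a" for c a
      using lin[of x c a 0] by (simp add: f0)
    fix e
    obtain r where r: "0 \<le> r" "r < 1" "\<forall>v\<in>H. norm (Z x v) \<le> r * norm v"
      using contr[of x] by blast
    have "norm (Z x (w x e)) \<le> 1 * norm (w x e)"
      using r w(1)[of x e] by (meson less_imp_le mult_right_mono norm_ge_zero order_trans)
    then have "(norm (Z x (w x e)))\<^sup>2 \<le> (norm (w x e))\<^sup>2"
      by (intro power_mono) auto
    moreover have "(norm (f x e, w x e))\<^sup>2 = (norm (e, Z x (w x e)))\<^sup>2"
      using n[of "(e, Z x (w x e))"] bounded_ops_mem[OF Z w(1)] by (simp add: w(2))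
    ultimately have "(norm (f x e))\<^sup>2 \<le> (norm e)\<^sup>2"
      unfolding norm_Pair_square by linarith
    then show "norm (f x e) \<le> 1 * norm e"
      by (simp add: power2_le_iff_abs_le del: power_mono_iff)
  qed simp
  have gram: "cinner a c - cinner (f x a) (f y c)
      = cinner (w x a) (w y c) - cinner (Z x (w x a)) (Z y (w y c))" for x y a c
    using isometric_op_cinner[OF U UH, of "(a, Z x (w x a))" "(c, Z y (w y c))"]
      bounded_ops_mem[OF Z w(1)]
    by (simp add: w(2) cinner_Pair algebra_simps)
  have "psd (schur_kernel f 1 S)" if S: "S \<in> admissible_kernels \<Psi>" for S
    unfolding psd_def
  proof (intro allI)
    fix n :: nat and c :: "nat \<Rightarrow> complex" and z :: "nat \<Rightarrow> 'x \<times> 'e \<times> 'e"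
    define X where "X i = fst (z i)" for i
    define v where "v i = w (X i) (fst (snd (z i)))" for i
    define k where "k p q = cinner (S (fst p) (fst q) (snd p)) (snd q)" for p q
    define s where "s i j = k (X i, snd (snd (z i))) (X j, snd (snd (z j)))" for i j
    define t where "t i j = c i * cnj (c j) * s i j" for i j
    have k: "psd k"
      using S by (simp add: admissible_kernels_def positive_kernel_iff_psd k_def[abs_def])
    have tc: "t j i = cnj (t i j)" for i j
    proof -
      have "s j i = cnj (s i j)"
        unfolding s_def by (rule psd_commute[OF k])
      then show ?thesis
        unfolding t_def by (simp add: mult.commute)
    qed
    define P where "P i j = (\<lambda>\<psi>\<in>\<Psi>. t i j * (1 - evaluation \<Psi> (X i) \<psi> * cnj (evaluation \<Psi> (X j) \<psi>)))" for i j
    have EE: "(\<lambda>\<psi>\<in>\<Psi>. evaluation \<Psi> (X i) \<psi> * cnj (evaluation \<Psi> (X j) \<psi>)) \<in> Cb \<Psi>" for i j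
      by (intro Cb_mult_cnj evaluation_Cb \<Psi>)
    have EE1: "(\<lambda>\<psi>\<in>\<Psi>. 1 - evaluation \<Psi> (X i) \<psi> * cnj (evaluation \<Psi> (X j) \<psi>)) \<in> Cb \<Psi>" for i j
      using Cb_diff[OF Cb_const[where c = 1] EE, of i j] by (simp cong: restrict_cong)
    have P: "P i j \<in> Cb \<Psi>" for i j
      using Cb_scale[OF EE1, of "t i j" i j] by (simp add: P_def cong: restrict_cong)
    have vH: "v i \<in> H" for i
      by (simp add: v_def w(1))
    have val: "cinner (\<rho> (P i j) (v i)) (v j) = c i * cnj (c j) * schur_kernel f 1 S (z i) (z j)" for i j
    proof -
      have "\<rho> (P i j) (v i) = t i j *\<^sub>C (v i - \<rho> (\<lambda>\<psi>\<in>\<Psi>. evaluation \<Psi> (X i) \<psi> * cnj (evaluation \<Psi> (X j) \<psi>)) (v i))"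
        using scale[OF EE1 vH, of "t i j" i j i] diff[OF Cb_const[where c = 1] EE vH, of i j i] one[OF vH, of i]
        by (simp add: P_def cong: restrict_cong)
      then have "cinner (\<rho> (P i j) (v i)) (v j) = t i j * (cinner (v i) (v j) - cinner (Z (X i) (v i)) (Z (X j) (v j)))"
        unfolding Z_def cinner_rep_rep[OF evaluation_Cb[OF \<Psi>] evaluation_Cb[OF \<Psi>] vH vH]
        by (simp add: cinner_scaleC_left cinner_diff_left)
      then show ?thesis
        by (simp add: schur_kernel_def case_prod_beta gram t_def s_def k_def v_def X_def mult_ac)
    qed
    have "(\<Sum>i<n. \<Sum>j<n. cinner (\<rho> (P i j) (v i)) (v j)) \<in> \<real>\<^sub>\<ge>\<^sub>0"
    proof (rule completely_positive[OF P _ _ vH])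
      show "P j i \<psi> = cnj (P i j \<psi>)" if "\<psi> \<in> \<Psi>" for i j \<psi>
        using that unfolding P_def tc[of j i] by (simp add: mult.commute)
      fix \<psi> and d :: "nat \<Rightarrow> complex" assume \<psi>: "\<psi> \<in> \<Psi>"
      have "psd (\<lambda>p q. cinner ((1 - \<psi> (fst p) * cnj (\<psi> (fst q))) *\<^sub>C S (fst p) (fst q) (snd p)) (snd q))"
        using S \<psi> by (simp add: admissible_kernels_def positive_kernel_iff_psd)
      from psdD[OF this, where n = n and c = "\<lambda>i. d i * c i" and x = "\<lambda>i. (X i, snd (snd (z i)))"]
      show "(\<Sum>i<n. \<Sum>j<n. d i * cnj (d j) * P i j \<psi>) \<in> \<real>\<^sub>\<ge>\<^sub>0"
        using \<psi> by (simp add: P_def evaluation_def t_def s_def k_def cinner_scaleC_left mult_ac)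
    qed
    then show "(\<Sum>i<n. \<Sum>j<n. c i * cnj (c j) * schur_kernel f 1 S (z i) (z j)) \<in> \<real>\<^sub>\<ge>\<^sub>0"
      by (simp only: val)
  qed
  then show ?thesis
    by (simp add: schur_agler_class_iff f)
qed

subsection \<open>Block realizations and products\<close>

lemma realization_components:
  assumes real: "realization \<Psi> H \<rho> U f"
  obtains A B C D where "A \<in> bounded_ops UNIV UNIV" "B \<in> bounded_ops H UNIV" "C \<in> bounded_ops UNIV H"
    "D \<in> bounded_ops H H" "\<And>e h. h \<in> H \<Longrightarrow> U (e, h) = (A e + B h, C e + D h)"
proof -
  interpret star_rep \<Psi> H \<rho>
    using real by (simp add: realization_def)
  have U: "U \<in> bounded_ops (UNIV \<times> H) (UNIV \<times> H)"
    using real by (simp add: realization_def isometric_op_def)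
  note inl = bounded_ops_comp[OF bounded_ops_inl[OF H] U] and inr = bounded_ops_comp[OF bounded_ops_inr[OF hilbert_space_UNIV] U]
  show ?thesis
  proof (rule that)
    show "(\<lambda>e. fst (U (e, 0))) \<in> bounded_ops UNIV UNIV" by (rule bounded_ops_comp[OF inl bounded_ops_fst])
    show "(\<lambda>h. fst (U (0, h))) \<in> bounded_ops H UNIV" by (rule bounded_ops_comp[OF inr bounded_ops_fst])
    show "(\<lambda>e. snd (U (e, 0))) \<in> bounded_ops UNIV H" by (rule bounded_ops_comp[OF inl bounded_ops_snd])
    show "(\<lambda>h. snd (U (0, h))) \<in> bounded_ops H H" by (rule bounded_ops_comp[OF inr bounded_ops_snd])
    show "U (e, h) = (fst (U (e, 0)) + fst (U (0, h)), snd (U (e, 0)) + snd (U (0, h)))" if "h \<in> H" for e h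
      using bounded_ops_add[OF U, of "(e, 0)" "(0, h)"] that hilbert_space_zero[OF H]
      by (simp add: prod_eq_iff)
  qed
qed

lemma isometric_op_colligation:
  fixes A :: "'e::chilbert \<Rightarrow> 'e"
  assumes H: "hilbert_space H" and ops: "A \<in> bounded_ops UNIV UNIV" "B \<in> bounded_ops H UNIV"
    "C \<in> bounded_ops UNIV H" "D \<in> bounded_ops H H"
    and gram: "\<And>e h. h \<in> H \<Longrightarrow> cinner (A e + B h) (A e + B h) + cinner (C e + D h) (C e + D h) = cinner e e + cinner h h"
  shows "isometric_op (UNIV \<times> H) (UNIV \<times> H) (\<lambda>p. (A (fst p) + B (snd p), C (fst p) + D (snd p)))"
proof (rule isometric_opI)
  note f = bounded_ops_fst[of UNIV H] and s = bounded_ops_snd[of UNIV H]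
  show "(\<lambda>p. (A (fst p) + B (snd p), C (fst p) + D (snd p))) \<in> bounded_ops (UNIV \<times> H) (UNIV \<times> H)"
    by (intro bounded_ops_Pair bounded_ops_add_op hilbert_space_UNIV H bounded_ops_comp[OF f ops(1)]
        bounded_ops_comp[OF s ops(2)] bounded_ops_comp[OF f ops(3)] bounded_ops_comp[OF s ops(4)])
  show "cinner (A (fst x) + B (snd x), C (fst x) + D (snd x)) (A (fst x) + B (snd x), C (fst x) + D (snd x)) = cinner x x"
    if "x \<in> UNIV \<times> H" for x
    using gram[of "snd x" "fst x"] that by (auto simp: cinner_Pair)
qed

text \<open>The resolvent equation of the block colligation is solved by the pair of the solutions for the two factors.\<close>

lemma cascade_transfer_function:
  assumes \<Psi>: "test_functions \<Psi>" and red: "reducible_rep \<Psi> H1 H2 \<rho>"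
    and H1: "hilbert_space H1" and H2: "hilbert_space H2"
    and B: "B1 \<in> bounded_ops H1 UNIV"
    and D: "D1 \<in> bounded_ops H1 H1" "D2 \<in> bounded_ops H2 H1" "D3 \<in> bounded_ops H2 H2"
    and ops: "A1 \<in> bounded_ops UNIV UNIV" "X1 \<in> bounded_ops UNIV H1" "Y2 \<in> bounded_ops H2 UNIV"
    and fac: "\<And>k. k \<in> H2 \<Longrightarrow> B2 k = A1 (Y2 k)" "\<And>k. k \<in> H2 \<Longrightarrow> D2 k = X1 (Y2 k)"
    and contr: "\<And>h k. h \<in> H1 \<Longrightarrow> k \<in> H2 \<Longrightarrow> norm (D1 h + D2 k, D3 k) \<le> norm (h, k)"
    and w1: "w1 \<in> H1" "A1 u + B1 (fst (\<rho> (evaluation \<Psi> x) (w1, 0))) = v" "X1 u + D1 (fst (\<rho> (evaluation \<Psi> x) (w1, 0))) = w1"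
    and w2: "w2 \<in> H2" "A2 e + Y2 (snd (\<rho> (evaluation \<Psi> x) (0, w2))) = u" "C2 e + D3 (snd (\<rho> (evaluation \<Psi> x) (0, w2))) = w2"
  shows "A1 (A2 e) + (\<lambda>(h, k). B1 h + B2 k) (\<rho> (evaluation \<Psi> x) (the_inv_into (H1 \<times> H2)
      (\<lambda>v. v - (\<lambda>(h, k). (D1 h + D2 k, D3 k)) (\<rho> (evaluation \<Psi> x) v)) (X1 (A2 e), C2 e))) = v"
proof -
  interpret star_rep \<Psi> "H1 \<times> H2" \<rho>
    by (rule star_rep.intro) (use red hilbert_space_Times[OF H1 H2] in \<open>simp_all add: reducible_rep_def\<close>)
  have E: "evaluation \<Psi> x \<in> Cb \<Psi>" by (rule evaluation_Cb[OF \<Psi>])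
  define z1 where "z1 = fst (\<rho> (evaluation \<Psi> x) (w1, 0))"
  define z2 where "z2 = snd (\<rho> (evaluation \<Psi> x) (0, w2))"
  have z: "\<rho> (evaluation \<Psi> x) (w1, w2) = (z1, z2)"
    unfolding z1_def z2_def by (rule reducible_rep_restrict(3)[OF red H1 H2 E w1(1) w2(1)])
  have zH: "z1 \<in> H1" "z2 \<in> H2"
    using mem[OF E, of "(w1, w2)"] w1(1) w2(1) by (simp_all add: z)
  note X1 = bounded_ops_add[OF ops(2) UNIV_I UNIV_I] and A1 = bounded_ops_add[OF ops(1) UNIV_I UNIV_I]
  have "the_inv_into (H1 \<times> H2) (\<lambda>v. v - (\<lambda>(h, k). (D1 h + D2 k, D3 k)) (\<rho> (evaluation \<Psi> x) v)) (X1 (A2 e), C2 e) = (w1, w2)"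
  proof (rule resolvent_eqI[OF \<Psi>])
    note f = bounded_ops_fst[of H1 H2] and s = bounded_ops_snd[of H1 H2]
    have "(\<lambda>p. (D1 (fst p) + D2 (snd p), D3 (snd p))) \<in> bounded_ops (H1 \<times> H2) (H1 \<times> H2)"
      by (intro bounded_ops_Pair bounded_ops_add_op H1 bounded_ops_comp[OF f D(1)]
          bounded_ops_comp[OF s D(2)] bounded_ops_comp[OF s D(3)])
    then show "(\<lambda>(h, k). (D1 h + D2 k, D3 k)) \<in> bounded_ops (H1 \<times> H2) (H1 \<times> H2)"
      by (simp add: case_prod_beta')
    show "norm ((\<lambda>(h, k). (D1 h + D2 k, D3 k)) v) \<le> norm v" if "v \<in> H1 \<times> H2" for v
      using contr that by auto
    have "X1 u = X1 (A2 e) + D2 z2"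
      using w2(2) X1[of "A2 e" "Y2 z2"] fac(2)[OF zH(2)] by (simp add: z2_def[symmetric])
    then show "(w1, w2) - (\<lambda>(h, k). (D1 h + D2 k, D3 k)) (\<rho> (evaluation \<Psi> x) (w1, w2)) = (X1 (A2 e), C2 e)"
      using w1(3) w2(3) by (auto simp: z z1_def[symmetric] z2_def[symmetric] algebra_simps)
  qed (use w1 w2 in auto)
  moreover have "A1 u = A1 (A2 e) + B2 z2"
    using w2(2) A1[of "A2 e" "Y2 z2"] fac(1)[OF zH(2)] by (simp add: z2_def[symmetric])
  ultimately show ?thesis
    using w1(2) by (simp add: z z1_def[symmetric] algebra_simps)
qed

text \<open>U first sends (e, k) to (u, C2 e + D3 k) and then (u, h) to (A1 u + B1 h, X1 u + D1 h).
  The column condition on A1 and X1 lets the first map inherit isometry from U; for the second the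
  cross term \<open>g h\<close> between u and h has to vanish as well.\<close>

lemma block_realization_factor:
  fixes \<theta> :: "'x \<Rightarrow> 'e::chilbert \<Rightarrow> 'e" and H1 :: "'h::chilbert set" and H2 :: "'k::chilbert set"
  assumes \<Psi>: "test_functions \<Psi>" and H1: "hilbert_space H1" and H2: "hilbert_space H2"
    and block: "block_realization \<Psi> x0 \<theta> H1 H2"
  shows "\<exists>f1\<in>schur_agler_class \<Psi>. \<exists>f2\<in>schur_agler_class \<Psi>. \<forall>x. \<theta> x = f1 x \<circ> f2 x"
proof -
  obtain \<rho> B1 B2 C1 C2 D1 D2 D3 A1 A2 X1 Y2 where ops:
    "B1 \<in> bounded_ops H1 UNIV" "B2 \<in> bounded_ops H2 UNIV"
    "C1 \<in> bounded_ops UNIV H1" "C2 \<in> bounded_ops UNIV H2"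
    "D1 \<in> bounded_ops H1 H1" "D2 \<in> bounded_ops H2 H1" "D3 \<in> bounded_ops H2 H2"
    "A1 \<in> bounded_ops (UNIV :: 'e set) (UNIV :: 'e set)" "A2 \<in> bounded_ops (UNIV :: 'e set) (UNIV :: 'e set)"
    "X1 \<in> bounded_ops UNIV H1" "Y2 \<in> bounded_ops H2 UNIV"
    and red: "reducible_rep \<Psi> H1 H2 \<rho>"
    and U: "isometric_op (UNIV \<times> (H1 \<times> H2)) (UNIV \<times> (H1 \<times> H2))
      (\<lambda>(e, v). (\<theta> x0 e + (case v of (h, k) \<Rightarrow> B1 h + B2 k), (C1 e, C2 e) + (case v of (h, k) \<Rightarrow> (D1 h + D2 k, D3 k))))"
    and fac': "\<forall>e. \<theta> x0 e = A1 (A2 e)" "\<forall>k\<in>H2. B2 k = A1 (Y2 k)"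
      "\<forall>e. C1 e = X1 (A2 e)" "\<forall>k\<in>H2. D2 k = X1 (Y2 k)"
    and col': "\<forall>e. adj UNIV A1 (A1 e) + adj UNIV X1 (X1 e) = e"
    and inj: "inj_on (adj UNIV A2) ((\<lambda>h. adj UNIV A1 (B1 h) + adj UNIV X1 (D1 h)) ` H1)"
    and \<theta>': "\<forall>x e. \<theta> x e = \<theta> x0 e + (\<lambda>(h, k). B1 h + B2 k) (\<rho> (evaluation \<Psi> x)
          (the_inv_into (H1 \<times> H2) (\<lambda>v. v - (\<lambda>(h, k). (D1 h + D2 k, D3 k)) (\<rho> (evaluation \<Psi> x) v)) (C1 e, C2 e)))"
    using block unfolding block_realization_def Let_def by (elim exE bexE conjE) (rule that; assumption)
  note fac = fac'(1)[THEN spec] fac'(2)[THEN bspec] fac'(3)[THEN spec] fac'(4)[THEN bspec]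
    and col = col'[THEN spec] and \<theta> = \<theta>'[THEN spec, THEN spec]
  note z1 = hilbert_space_zero[OF H1] and z2 = hilbert_space_zero[OF H2]
  note op0 = bounded_ops_zero[OF ops(1) H1] bounded_ops_zero[OF ops(2) H2] bounded_ops_zero[OF ops(5) H1]
    bounded_ops_zero[OF ops(6) H2] bounded_ops_zero[OF ops(7) H2] bounded_ops_zero[OF ops(11) H2]
    bounded_ops_zero[OF ops(8) hilbert_space_UNIV] bounded_ops_zero[OF ops(9) hilbert_space_UNIV]
    bounded_ops_zero[OF ops(10) hilbert_space_UNIV] bounded_ops_zero[OF ops(4) hilbert_space_UNIV]
  have hU: "hilbert_space (UNIV \<times> (H1 \<times> H2))"
    by (intro hilbert_space_Times hilbert_space_UNIV H1 H2)
  \<comment> \<open>The output of the factor on H2, fed into the factor on H1.\<close>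
  define u where "u e k = A2 e + Y2 k" for e k
  have Ueq: "(\<lambda>(e, v). (\<theta> x0 e + (case v of (h, k) \<Rightarrow> B1 h + B2 k), (C1 e, C2 e) + (case v of (h, k) \<Rightarrow> (D1 h + D2 k, D3 k)))) (e, (h, k))
      = (A1 (u e k) + B1 h, (X1 (u e k) + D1 h, C2 e + D3 k))" if "k \<in> H2" for e h k
    using that by (simp add: fac u_def bounded_ops_add[OF ops(8)] bounded_ops_add[OF ops(10)] ac_simps)
  have gram: "cinner (A1 (u e k) + B1 h) (A1 (u e' k') + B1 h') + (cinner (X1 (u e k) + D1 h) (X1 (u e' k') + D1 h')
      + cinner (C2 e + D3 k) (C2 e' + D3 k')) = cinner e e' + (cinner h h' + cinner k k')"
    if "h \<in> H1" "k \<in> H2" "h' \<in> H1" "k' \<in> H2" for e h k e' h' k'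
    using isometric_op_cinner[OF U hU, of "(e, (h, k))" "(e', (h', k'))"] that
    unfolding Ueq[OF that(2)] Ueq[OF that(4)] by (simp add: cinner_Pair)
  have AX: "cinner (A1 a) (A1 b) + cinner (X1 a) (X1 b) = cinner a b" for a b
    using arg_cong[OF col[of b], of "cinner a"]
    by (simp add: cinner_add_right cinner_adj[OF hilbert_space_UNIV ops(8) UNIV_I] cinner_adj[OF hilbert_space_UNIV ops(10) UNIV_I])
  define g where "g h = adj UNIV A1 (B1 h) + adj UNIV X1 (D1 h)" for h
  have cg: "cinner (A1 a) (B1 h) + cinner (X1 a) (D1 h) = cinner a (g h)" for a h
    by (simp add: g_def cinner_add_right cinner_adj[OF hilbert_space_UNIV ops(8) UNIV_I] cinner_adj[OF hilbert_space_UNIV ops(10) UNIV_I])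
  \<comment> \<open>The inputs e and h are orthogonal and so are their images under U, but this only
    says that the adjoint of A2 annihilates g h. Since 0 = g 0 lies in the same range, injectivity
    there gives g h = 0.\<close>
  have "adj UNIV A2 (g h) = 0" if h: "h \<in> H1" for h
  proof (rule adj_eqI)
    show "cinner (A2 e) (g h) = cinner e 0" for e
      using gram[OF z1 z2 h z2, of e 0] by (simp add: op0 u_def flip: cg)
  qed simp_all
  then have "adj UNIV A2 (g h) = adj UNIV A2 (g 0)" if "h \<in> H1" for h
    using that z1 by simp
  then have "g h = g 0" if "h \<in> H1" for h
    using inj_onD[OF inj[folded g_def]] that z1 by blast
  moreover have "g 0 = 0"
    using bounded_ops_zero[OF adj_bounded_ops[OF ops(8)] hilbert_space_UNIV]
      adj_eqI[OF hilbert_space_UNIV, of 0 X1 0] by (simp add: g_def op0)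
  ultimately have g0: "g h = 0" if "h \<in> H1" for h
    using that by simp
  have AB: "cinner (A1 a) (B1 h) + cinner (X1 a) (D1 h) = 0" "cinner (B1 h) (A1 a) + cinner (D1 h) (X1 a) = 0" if "h \<in> H1" for a h
  proof -
    show *: "cinner (A1 a) (B1 h) + cinner (X1 a) (D1 h) = 0"
      using cg[of a h] g0[OF that] by simp
    show "cinner (B1 h) (A1 a) + cinner (D1 h) (X1 a) = 0"
      using arg_cong[OF *, of cnj] unfolding complex_cnj_add by (simp flip: cinner_commute)
  qed
  interpret \<rho>1: star_rep \<Psi> H1 "\<lambda>g h. fst (\<rho> g (h, 0))"
    by (rule star_rep.intro[OF H1 reducible_rep_restrict(1)[OF red H1 H2]])
  interpret \<rho>2: star_rep \<Psi> H2 "\<lambda>g k. snd (\<rho> g (0, k))"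
    by (rule star_rep.intro[OF H2 reducible_rep_restrict(2)[OF red H1 H2]])
  have "isometric_op (UNIV \<times> H1) (UNIV \<times> H1) (\<lambda>p. (A1 (fst p) + B1 (snd p), X1 (fst p) + D1 (snd p)))"
  proof (rule isometric_op_colligation[OF H1 ops(8) ops(1) ops(10) ops(5)])
    fix e h assume h: "h \<in> H1"
    have BD: "cinner (B1 h) (B1 h) + cinner (D1 h) (D1 h) = cinner h h"
      using gram[OF h z2 h z2, of 0 0] by (simp add: op0 u_def)
    have "cinner (A1 e + B1 h) (A1 e + B1 h) + cinner (X1 e + D1 h) (X1 e + D1 h)
        = (cinner (A1 e) (A1 e) + cinner (X1 e) (X1 e)) + (cinner (A1 e) (B1 h) + cinner (X1 e) (D1 h))
          + (cinner (B1 h) (A1 e) + cinner (D1 h) (X1 e)) + (cinner (B1 h) (B1 h) + cinner (D1 h) (D1 h))"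
      by (simp add: cinner_add_left cinner_add_right)
    then show "cinner (A1 e + B1 h) (A1 e + B1 h) + cinner (X1 e + D1 h) (X1 e + D1 h) = cinner e e + cinner h h"
      by (simp only: AX BD AB[OF h]) simp
  qed
  then obtain f1 where f1: "realization \<Psi> H1 (\<lambda>g h. fst (\<rho> g (h, 0))) (\<lambda>p. (A1 (fst p) + B1 (snd p), X1 (fst p) + D1 (snd p))) f1"
    using \<rho>1.realization_ex[OF \<Psi>] by blast
  have "isometric_op (UNIV \<times> H2) (UNIV \<times> H2) (\<lambda>p. (A2 (fst p) + Y2 (snd p), C2 (fst p) + D3 (snd p)))"
  proof (rule isometric_op_colligation[OF H2 ops(9) ops(11) ops(4) ops(7)])
    fix e k assume k: "k \<in> H2"
    \<comment> \<open>With h = 0 the operators A1 and X1 together preserve the norm of u, so they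
      drop out of the Gram identity of U.\<close>
    show "cinner (A2 e + Y2 k) (A2 e + Y2 k) + cinner (C2 e + D3 k) (C2 e + D3 k) = cinner e e + cinner k k"
      using gram[OF z1 k z1 k, of e e] AX[of "A2 e + Y2 k" "A2 e + Y2 k"]
      by (simp add: op0 u_def flip: add.assoc)
  qed
  then obtain f2 where f2: "realization \<Psi> H2 (\<lambda>g k. snd (\<rho> g (0, k))) (\<lambda>p. (A2 (fst p) + Y2 (snd p), C2 (fst p) + D3 (snd p))) f2"
    using \<rho>2.realization_ex[OF \<Psi>] by blast
  have "\<theta> x e = f1 x (f2 x e)" for x e
  proof -
    have "\<forall>x e. \<exists>w\<in>H1. A1 e + B1 (fst (\<rho> (evaluation \<Psi> x) (w, 0))) = f1 x e \<and> X1 e + D1 (fst (\<rho> (evaluation \<Psi> x) (w, 0))) = w"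
      using f1 by (simp add: realization_def)
    then obtain w1 where w1: "w1 \<in> H1" "A1 (f2 x e) + B1 (fst (\<rho> (evaluation \<Psi> x) (w1, 0))) = f1 x (f2 x e)"
      "X1 (f2 x e) + D1 (fst (\<rho> (evaluation \<Psi> x) (w1, 0))) = w1"
      by blast
    have "\<forall>x e. \<exists>w\<in>H2. A2 e + Y2 (snd (\<rho> (evaluation \<Psi> x) (0, w))) = f2 x e \<and> C2 e + D3 (snd (\<rho> (evaluation \<Psi> x) (0, w))) = w"
      using f2 by (simp add: realization_def)
    then obtain w2 where w2: "w2 \<in> H2" "A2 e + Y2 (snd (\<rho> (evaluation \<Psi> x) (0, w2))) = f2 x e"
      "C2 e + D3 (snd (\<rho> (evaluation \<Psi> x) (0, w2))) = w2"
      by blast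
    show ?thesis
      unfolding \<theta>[of x e] fac(1) fac(3)
    proof (rule cascade_transfer_function[OF \<Psi> red H1 H2 ops(1,5,6,7,8,10,11) fac(2,4)])
      show "norm (D1 h + D2 k, D3 k) \<le> norm (h, k)" if hk: "h \<in> H1" "k \<in> H2" for h k
      proof -
        have "norm (D1 h + D2 k, D3 k) \<le> norm (A1 (Y2 k) + B1 h, (D1 h + D2 k, D3 k))"
          by (rule norm_snd_le)
        also have "\<dots> = norm (h, k)"
          by (rule norm_eqI_cinner)
            (use gram[OF hk hk, of 0 0] hk in \<open>simp add: cinner_Pair op0 u_def fac(4) add.commute\<close>)
        finally show ?thesis .
      qed
    qed (assumption | rule w1 w2)+
  qed
  then have "\<theta> x = f1 x \<circ> f2 x" for x
    by (simp add: fun_eq_iff)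
  then show ?thesis
    using realization_schur_agler[OF \<Psi> f1] realization_schur_agler[OF \<Psi> f2] by blast
qed

text \<open>U is the product of the two given colligations. Isometry of the first makes its columns
  orthogonal, so the range on which the adjoint of A2 must be injective is {0}; at x0 the
  representation of the evaluation vanishes, which leaves \<theta>(x0) = A1 A2.\<close>

lemma factor_block_realization:
  fixes f1 f2 :: "'x \<Rightarrow> 'e::chilbert \<Rightarrow> 'e" and H1 :: "'h::chilbert set" and H2 :: "'k::chilbert set"
  assumes \<Psi>: "test_functions \<Psi>" and x0: "evaluation \<Psi> x0 = (\<lambda>\<psi>\<in>\<Psi>. 0)"
    and f1: "realization \<Psi> H1 \<rho>1 U1 f1" and f2: "realization \<Psi> H2 \<rho>2 U2 f2"
    and \<theta>: "\<And>x. \<theta> x = f1 x \<circ> f2 x"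
  shows "block_realization \<Psi> x0 \<theta> H1 H2"
proof -
  interpret \<rho>1: star_rep \<Psi> H1 \<rho>1 using f1 by (simp add: realization_def)
  interpret \<rho>2: star_rep \<Psi> H2 \<rho>2 using f2 by (simp add: realization_def)
  note H1 = \<rho>1.H and H2 = \<rho>2.H
  obtain A1 B1 X1 D1 where ops1: "A1 \<in> bounded_ops UNIV UNIV" "B1 \<in> bounded_ops H1 UNIV" "X1 \<in> bounded_ops UNIV H1"
    "D1 \<in> bounded_ops H1 H1" and U1: "\<And>e h. h \<in> H1 \<Longrightarrow> U1 (e, h) = (A1 e + B1 h, X1 e + D1 h)"
    by (rule realization_components[OF f1]) (rule that)
  obtain A2 Y2 C2 D3 where ops2: "A2 \<in> bounded_ops UNIV UNIV" "Y2 \<in> bounded_ops H2 UNIV" "C2 \<in> bounded_ops UNIV H2"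
    "D3 \<in> bounded_ops H2 H2" and U2: "\<And>e k. k \<in> H2 \<Longrightarrow> U2 (e, k) = (A2 e + Y2 k, C2 e + D3 k)"
    by (rule realization_components[OF f2]) (rule that)
  note z1 = hilbert_space_zero[OF H1] and z2 = hilbert_space_zero[OF H2]
  note op0 = bounded_ops_zero[OF ops1(1) hilbert_space_UNIV] bounded_ops_zero[OF ops1(2) H1]
    bounded_ops_zero[OF ops1(3) hilbert_space_UNIV] bounded_ops_zero[OF ops1(4) H1]
    bounded_ops_zero[OF ops2(1) hilbert_space_UNIV] bounded_ops_zero[OF ops2(2) H2]
    bounded_ops_zero[OF ops2(3) hilbert_space_UNIV] bounded_ops_zero[OF ops2(4) H2]
  have gram1: "cinner (A1 e + B1 h) (A1 e' + B1 h') + cinner (X1 e + D1 h) (X1 e' + D1 h') = cinner e e' + cinner h h'"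
    if "h \<in> H1" "h' \<in> H1" for e e' h h'
    using isometric_op_cinner[of "UNIV \<times> H1" "UNIV \<times> H1" U1 "(e, h)" "(e', h')"] f1 that
    by (simp add: realization_def hilbert_space_Times H1 U1 cinner_Pair)
  have gram2: "cinner (A2 e + Y2 k) (A2 e' + Y2 k') + cinner (C2 e + D3 k) (C2 e' + D3 k') = cinner e e' + cinner k k'"
    if "k \<in> H2" "k' \<in> H2" for e e' k k'
    using isometric_op_cinner[of "UNIV \<times> H2" "UNIV \<times> H2" U2 "(e, k)" "(e', k')"] f2 that
    by (simp add: realization_def hilbert_space_Times H2 U2 cinner_Pair)
  define \<rho> where "\<rho> = (\<lambda>g p. (\<rho>1 g (fst p), \<rho>2 g (snd p)))"
  have red: "reducible_rep \<Psi> H1 H2 \<rho>"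
    unfolding \<rho>_def by (rule reducible_rep_Times) unfold_locales
  define B2 where "B2 k = A1 (Y2 k)" for k
  define C1 where "C1 e = X1 (A2 e)" for e
  define D2 where "D2 k = X1 (Y2 k)" for k
  have B2: "B2 \<in> bounded_ops H2 UNIV" and C1: "C1 \<in> bounded_ops UNIV H1" and D2: "D2 \<in> bounded_ops H2 H1"
    unfolding B2_def[abs_def] C1_def[abs_def] D2_def[abs_def]
    by (rule bounded_ops_comp[OF ops2(2) ops1(1)], rule bounded_ops_comp[OF ops2(1) ops1(3)], rule bounded_ops_comp[OF ops2(2) ops1(3)])
  have \<theta>0: "\<theta> x0 e = A1 (A2 e)" for e
  proof -
    have a1: "f1 x0 e = A1 e" for e
    proof -
      obtain w where "w \<in> H1" "U1 (e, \<rho>1 (evaluation \<Psi> x0) w) = (f1 x0 e, w)"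
        using f1 unfolding realization_def by blast
      then show ?thesis by (simp add: x0 \<rho>1.zero U1 z1 op0)
    qed
    have a2: "f2 x0 e = A2 e" for e
    proof -
      obtain w where "w \<in> H2" "U2 (e, \<rho>2 (evaluation \<Psi> x0) w) = (f2 x0 e, w)"
        using f2 unfolding realization_def by blast
      then show ?thesis by (simp add: x0 \<rho>2.zero U2 z2 op0)
    qed
    show ?thesis by (simp add: \<theta> a1 a2)
  qed
  define U where "U = (\<lambda>(e, v). (\<theta> x0 e + (case v of (h, k) \<Rightarrow> B1 h + B2 k), (C1 e, C2 e) + (case v of (h, k) \<Rightarrow> (D1 h + D2 k, D3 k))))"
  have Ueq: "U (e, (h, k)) = (A1 (A2 e + Y2 k) + B1 h, (X1 (A2 e + Y2 k) + D1 h, C2 e + D3 k))" for e h k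
    by (simp add: U_def \<theta>0 B2_def C1_def D2_def bounded_ops_add[OF ops1(1)] bounded_ops_add[OF ops1(3)] ac_simps)
  have isoU: "cinner (U p) (U p) = cinner p p" if "p \<in> UNIV \<times> (H1 \<times> H2)" for p
  proof -
    obtain e h k where p: "p = (e, (h, k))" "h \<in> H1" "k \<in> H2" using \<open>p \<in> _\<close> by auto
    show ?thesis
      using gram1[OF p(2) p(2), of "A2 e + Y2 k" "A2 e + Y2 k"] gram2[OF p(3) p(3), of e e]
      unfolding p(1) Ueq cinner_Pair by (simp add: algebra_simps)
  qed
  note f = bounded_ops_fst[of H1 H2] and s = bounded_ops_snd[of H1 H2]
  have U: "isometric_op (UNIV \<times> (H1 \<times> H2)) (UNIV \<times> (H1 \<times> H2)) U"
  proof (rule back_subst[of "isometric_op _ _", OF isometric_op_colligation])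
    show "hilbert_space (H1 \<times> H2)" by (rule hilbert_space_Times[OF H1 H2])
    show "(\<lambda>e. A1 (A2 e)) \<in> bounded_ops UNIV UNIV" by (rule bounded_ops_comp[OF ops2(1) ops1(1)])
    show "(\<lambda>v. B1 (fst v) + B2 (snd v)) \<in> bounded_ops (H1 \<times> H2) UNIV"
      by (intro bounded_ops_add_op hilbert_space_UNIV bounded_ops_comp[OF f ops1(2)] bounded_ops_comp[OF s B2])
    show "(\<lambda>e. (C1 e, C2 e)) \<in> bounded_ops UNIV (H1 \<times> H2)" by (rule bounded_ops_Pair[OF C1 ops2(3)])
    show "(\<lambda>v. (D1 (fst v) + D2 (snd v), D3 (snd v))) \<in> bounded_ops (H1 \<times> H2) (H1 \<times> H2)"
      by (intro bounded_ops_Pair bounded_ops_add_op H1 bounded_ops_comp[OF f ops1(4)]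
          bounded_ops_comp[OF s D2] bounded_ops_comp[OF s ops2(4)])
    show "cinner (A1 (A2 e) + (B1 (fst v) + B2 (snd v))) (A1 (A2 e) + (B1 (fst v) + B2 (snd v)))
        + cinner ((C1 e, C2 e) + (D1 (fst v) + D2 (snd v), D3 (snd v))) ((C1 e, C2 e) + (D1 (fst v) + D2 (snd v), D3 (snd v)))
        = cinner e e + cinner v v" if "v \<in> H1 \<times> H2" for e v
      using isoU[of "(e, v)"] that by (auto simp: U_def \<theta>0 cinner_Pair)
  qed (auto simp: U_def \<theta>0 fun_eq_iff)
  have col: "adj UNIV A1 (A1 e) + adj UNIV X1 (X1 e) = e" for e
  proof -
    have "cinner d (adj UNIV A1 (A1 e) + adj UNIV X1 (X1 e)) = cinner d e" for d
      using gram1[OF z1 z1, of d e]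
      by (simp add: cinner_add_right op0 flip: cinner_adj[OF hilbert_space_UNIV ops1(1) UNIV_I] cinner_adj[OF hilbert_space_UNIV ops1(3) UNIV_I])
    then have "cinner (adj UNIV A1 (A1 e) + adj UNIV X1 (X1 e) - e) (adj UNIV A1 (A1 e) + adj UNIV X1 (X1 e) - e) = 0"
      by (simp only: cinner_diff_right) simp
    then show ?thesis by simp
  qed
  have "adj UNIV A1 (B1 h) + adj UNIV X1 (D1 h) = 0" if h: "h \<in> H1" for h
  proof -
    have "cinner d (adj UNIV A1 (B1 h) + adj UNIV X1 (D1 h)) = 0" for d
      using gram1[OF z1 h, of d 0]
      by (simp add: cinner_add_right op0 flip: cinner_adj[OF hilbert_space_UNIV ops1(1) UNIV_I] cinner_adj[OF hilbert_space_UNIV ops1(3) UNIV_I])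
    then show ?thesis using cinner_self_eq_zero by blast
  qed
  then have inj: "inj_on (adj UNIV A2) ((\<lambda>h. adj UNIV A1 (B1 h) + adj UNIV X1 (D1 h)) ` H1)"
    by (auto intro!: inj_onI)
  have val: "\<theta> x e = \<theta> x0 e + (\<lambda>(h, k). B1 h + B2 k) (\<rho> (evaluation \<Psi> x)
      (the_inv_into (H1 \<times> H2) (\<lambda>v. v - (\<lambda>(h, k). (D1 h + D2 k, D3 k)) (\<rho> (evaluation \<Psi> x) v)) (C1 e, C2 e)))" for x e
  proof -
    obtain w1 where w1: "w1 \<in> H1" "U1 (f2 x e, \<rho>1 (evaluation \<Psi> x) w1) = (f1 x (f2 x e), w1)"
      using f1 unfolding realization_def by blast
    obtain w2 where w2: "w2 \<in> H2" "U2 (e, \<rho>2 (evaluation \<Psi> x) w2) = (f2 x e, w2)"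
      using f2 unfolding realization_def by blast
    note E = evaluation_Cb[OF \<Psi>, of x]
    have "\<theta> x e = f1 x (f2 x e)"
      by (simp add: \<theta>)
    also have "\<dots> = A1 (A2 e) + (\<lambda>(h, k). B1 h + B2 k) (\<rho> (evaluation \<Psi> x)
      (the_inv_into (H1 \<times> H2) (\<lambda>v. v - (\<lambda>(h, k). (D1 h + D2 k, D3 k)) (\<rho> (evaluation \<Psi> x) v)) (X1 (A2 e), C2 e)))"
    proof (rule cascade_transfer_function[OF \<Psi> red H1 H2 ops1(2,4) D2 ops2(4) ops1(1,3) ops2(2) B2_def D2_def, symmetric])
      show "norm (D1 h + D2 k, D3 k) \<le> norm (h, k)" if hk: "h \<in> H1" "k \<in> H2" for h k
      proof -
        have "norm (D1 h + D2 k, D3 k) \<le> norm (U (0, (h, k)))"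
          using norm_snd_le[of "(D1 h + D2 k, D3 k)" "A1 (Y2 k) + B1 h"]
          unfolding Ueq by (simp add: op0 D2_def add.commute)
        also have "\<dots> = norm (h, k)"
          using norm_eqI_cinner[OF isoU[of "(0, (h, k))"]] hk by (simp add: norm_Pair)
        finally show ?thesis .
      qed
    qed (use w1 w2 in \<open>auto simp: U1 U2 \<rho>1.mem[OF E] \<rho>2.mem[OF E] \<rho>_def\<close>)
    finally show ?thesis
      by (simp only: \<theta>0 C1_def)
  qed
  show ?thesis
    unfolding block_realization_def Let_def
    by (intro exI[of _ \<rho>] bexI[of _ B1] bexI[of _ B2] bexI[of _ C1] bexI[of _ C2] bexI[of _ D1] bexI[of _ D2]
        bexI[of _ D3] bexI[of _ A1] bexI[of _ A2] bexI[of _ X1] bexI[of _ Y2] conjI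
        red U[unfolded U_def] col inj ops1 ops2 B2 C1 D2 allI ballI \<theta>0 B2_def C1_def D2_def val)
qed

subsection \<open>Finite approximation of the Agler decomposition\<close>

lemma sum_swap4:
  "(\<Sum>p\<in>I. \<Sum>q\<in>J. \<Sum>a\<in>A. \<Sum>b\<in>B. W p q a b) = (\<Sum>a\<in>A. \<Sum>b\<in>B. \<Sum>p\<in>I. \<Sum>q\<in>J. W p q a b)"
proof -
  have "(\<Sum>p\<in>I. \<Sum>q\<in>J. \<Sum>a\<in>A. \<Sum>b\<in>B. W p q a b) = (\<Sum>p\<in>I. \<Sum>a\<in>A. \<Sum>q\<in>J. \<Sum>b\<in>B. W p q a b)"
    by (intro sum.cong refl sum.swap)
  also have "\<dots> = (\<Sum>a\<in>A. \<Sum>p\<in>I. \<Sum>b\<in>B. \<Sum>q\<in>J. W p q a b)"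
    by (subst sum.swap) (intro sum.cong refl sum.swap)
  also have "\<dots> = (\<Sum>a\<in>A. \<Sum>b\<in>B. \<Sum>p\<in>I. \<Sum>q\<in>J. W p q a b)"
    by (intro sum.cong refl sum.swap)
  finally show ?thesis .
qed

text \<open>Positivity of a matrix on the finite set A passes to any point set: p contributes the
  coefficient vector with entries g a p.\<close>

lemma psd_compress:
  assumes "\<And>c. (\<Sum>a\<in>A. \<Sum>b\<in>A. c a * cnj (c b) * k a b) \<in> \<real>\<^sub>\<ge>\<^sub>0"
  shows "psd (\<lambda>p q. \<Sum>a\<in>A. \<Sum>b\<in>A. g a p * cnj (g b q) * k a b)"
  unfolding psd_def
proof (intro allI)
  fix n :: nat and c x
  define C where "C a = (\<Sum>i<n. c i * g a (x i))" for a
  have "(\<Sum>i<n. \<Sum>j<n. c i * cnj (c j) * (\<Sum>a\<in>A. \<Sum>b\<in>A. g a (x i) * cnj (g b (x j)) * k a b))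
      = (\<Sum>a\<in>A. \<Sum>b\<in>A. \<Sum>i<n. \<Sum>j<n. c i * cnj (c j) * (g a (x i) * cnj (g b (x j)) * k a b))"
    unfolding sum_distrib_left by (rule sum_swap4)
  also have "\<dots> = (\<Sum>a\<in>A. \<Sum>b\<in>A. C a * cnj (C b) * k a b)"
  proof (intro sum.cong refl)
    fix a b
    have "C a * cnj (C b) = (\<Sum>i<n. \<Sum>j<n. (c i * g a (x i)) * cnj (c j * g b (x j)))"
      unfolding C_def cnj_sum by (rule sum_product)
    then show "(\<Sum>i<n. \<Sum>j<n. c i * cnj (c j) * (g a (x i) * cnj (g b (x j)) * k a b)) = C a * cnj (C b) * k a b"
      by (simp add: sum_distrib_left mult_ac)
  qed
  also have "\<dots> \<in> \<real>\<^sub>\<ge>\<^sub>0" by (rule assms)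
  finally show "(\<Sum>i<n. \<Sum>j<n. c i * cnj (c j) * (\<Sum>a\<in>A. \<Sum>b\<in>A. g a (x i) * cnj (g b (x j)) * k a b)) \<in> \<real>\<^sub>\<ge>\<^sub>0" .
qed

text \<open>Iterating \<open>c\<^sub>a \<mapsto> \<phi>(a) c\<^sub>a\<close> only decreases the quadratic form, and it tends to \<open>0\<close>.\<close>

lemma nonneg_of_contractive:
  assumes A: "finite A" and \<phi>: "\<And>a. a \<in> A \<Longrightarrow> cmod (\<phi> a) < 1"
    and pos: "\<And>c. (\<Sum>a\<in>A. \<Sum>b\<in>A. c a * cnj (c b) * ((1 - \<phi> a * cnj (\<phi> b)) * k a b)) \<in> \<real>\<^sub>\<ge>\<^sub>0"
  shows "(\<Sum>a\<in>A. \<Sum>b\<in>A. c a * cnj (c b) * k a b) \<in> \<real>\<^sub>\<ge>\<^sub>0"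
proof -
  define T where "T m = (\<Sum>a\<in>A. \<Sum>b\<in>A. (c a * \<phi> a ^ m) * cnj (c b * \<phi> b ^ m) * k a b)" for m :: nat
  have step: "T m - T (Suc m) \<in> \<real>\<^sub>\<ge>\<^sub>0" for m
    using pos[of "\<lambda>a. c a * \<phi> a ^ m"] unfolding T_def
    by (simp add: algebra_simps flip: sum_subtractf)
  have "T 0 - T m \<in> \<real>\<^sub>\<ge>\<^sub>0" for m
  proof (induction m)
    case (Suc m)
    have "T 0 - T (Suc m) = (T 0 - T m) + (T m - T (Suc m))" by simp
    then show ?case
      using nonneg_Reals_add_I[OF Suc step[of m]] by simp
  qed simp
  moreover have "(\<lambda>m. T 0 - T m) \<longlonglongrightarrow> T 0 - (\<Sum>a\<in>A. \<Sum>b\<in>A. (c a * 0) * cnj (c b * 0) * k a b)"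
    unfolding T_def[of "_ :: nat"] by (intro tendsto_intros \<phi>)
  ultimately have "T 0 \<in> \<real>\<^sub>\<ge>\<^sub>0"
    using closed_sequentially[OF closed_nonneg_Reals_complex, of "\<lambda>m. T 0 - T m" "T 0"] by simp
  then show ?thesis by (simp add: T_def)
qed

lemma bounded_ops_sum_op:
  assumes "\<And>i. i \<in> I \<Longrightarrow> T i \<in> bounded_ops H K" "hilbert_space K"
  shows "(\<lambda>x. \<Sum>i\<in>I. T i x) \<in> bounded_ops H K"
  using assms(1)
proof (induction I rule: infinite_finite_induct)
  case (insert i I)
  then have "(\<lambda>x. T i x + (\<Sum>i\<in>I. T i x)) \<in> bounded_ops H K"
    by (intro bounded_ops_add_op assms(2)) auto
  then show ?case
    using insert by simp
qed (auto intro!: bounded_opsI[where M = 0] simp: hilbert_space_zero[OF assms(2)])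

lemma bounded_ops_rank_one: "(\<lambda>h. (t * cinner h u) *\<^sub>C v) \<in> bounded_ops UNIV UNIV"
proof (rule bounded_opsI)
  show "norm ((t * cinner h u) *\<^sub>C v) \<le> (cmod t * norm u * norm v) * norm h" for h
  proof -
    have "cmod t * cmod (cinner h u) * norm v \<le> cmod t * (norm h * norm u) * norm v"
      by (intro mult_right_mono mult_left_mono cinner_cmod_le) auto
    then show ?thesis by (simp add: norm_scaleC norm_mult mult_ac)
  qed
qed (auto simp: cinner_add_left cinner_scaleC_left distrib_left scaleC_add_left scaleC_scaleC mult_ac)

definition defect :: "('x \<Rightarrow> 'e::chilbert \<Rightarrow> 'e) \<Rightarrow> 'x \<times> 'e \<Rightarrow> 'x \<times> 'e \<Rightarrow> complex"
  where "defect f a b = cinner (snd a) (snd b) - cinner (f (fst a) (snd a)) (f (fst b) (snd b))"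

text \<open>
  A matrix \<open>s\<close> indexed by points \<open>(x, e)\<close> becomes an admissible operator kernel
  \<open>S(x, y) h = \<Sum> s\<^sub>a\<^sub>b \<langle>h, e\<^sub>a\<^sup>*\<rangle> e\<^sub>b\<^sup>*\<close> over the points \<open>a\<close> above \<open>x\<close> and \<open>b\<close> above \<open>y\<close>, where \<open>e\<^sup>*\<close> is the
  conjugate of \<open>e\<close> with respect to a finite orthonormal system. Testing the Schur--Agler condition on
  the vectors \<open>\<Sum> \<beta> \<otimes> \<beta>\<close> recovers the pairing of \<open>s\<close> with the defect matrix.
\<close>

lemma defect_pairing_nonneg:
  fixes f :: "'x \<Rightarrow> 'e::chilbert \<Rightarrow> 'e" and s :: "'x \<times> 'e \<Rightarrow> 'x \<times> 'e \<Rightarrow> complex"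
  assumes \<Psi>: "\<Psi> \<noteq> {}" "test_functions \<Psi>" and f: "f \<in> schur_agler_class \<Psi>" and A: "finite A"
    and pos: "\<And>\<psi> c. \<psi> \<in> \<Psi> \<Longrightarrow> (\<Sum>a\<in>A. \<Sum>b\<in>A. c a * cnj (c b) * ((1 - \<psi> (fst a) * cnj (\<psi> (fst b))) * s a b)) \<in> \<real>\<^sub>\<ge>\<^sub>0"
  shows "(\<Sum>a\<in>A. \<Sum>b\<in>A. s a b * defect f a b) \<in> \<real>\<^sub>\<ge>\<^sub>0"
proof -
  have fb: "f x \<in> bounded_ops UNIV UNIV" for x
    using f by (simp add: schur_agler_class_iff)
  obtain P where P: "finite P" "\<forall>e\<in>P. cinner e e = 1" "\<forall>e\<in>P. \<forall>e'\<in>P. e \<noteq> e' \<longrightarrow> cinner e e' = 0"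
    "\<forall>e\<in>snd ` A. (\<Sum>\<beta>\<in>P. cinner e \<beta> *\<^sub>C \<beta>) = e"
    using finite_orthonormal_expansion[of "snd ` A"] A by auto
  define star where "star a = (\<Sum>\<beta>\<in>P. cnj (cinner (snd a) \<beta>) *\<^sub>C \<beta>)" for a :: "'x \<times> 'e"
  \<comment> \<open>Conjugation turns this inner product into the coordinate of the vector of a
    along \<beta>, which is linear in that vector; sums over \<beta> can then reassemble the defect
    at a.\<close>
  have star1: "cinner \<beta> (star a) = cinner (snd a) \<beta>" if "\<beta> \<in> P" for \<beta> a
  proof -
    have "cinner \<beta> (star a) = (\<Sum>\<beta>'\<in>P. if \<beta>' = \<beta> then cinner (snd a) \<beta> else 0)"
      unfolding star_def cinner_sum_right cinner_scaleC_right using P(2,3) that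
      by (intro sum.cong) auto
    then show ?thesis using P(1) that by simp
  qed
  have star2: "cinner (star a) \<beta> = cnj (cinner (snd a) \<beta>)" if "\<beta> \<in> P" for \<beta> a
    using star1[OF that, of a] cinner_commute[of "star a" \<beta>] by simp
  define G where "G a p = (if fst a = fst p then cinner (snd p) (star a) else 0)" for a p :: "'x \<times> 'e"
  define S where "S x y h = (\<Sum>a\<in>A. \<Sum>b\<in>A. ((if fst a = x \<and> fst b = y then s a b else 0) * cinner h (star a)) *\<^sub>C star b)" for x y h
  have S: "S x y \<in> bounded_ops UNIV UNIV" for x y
    unfolding S_def[abs_def] by (intro bounded_ops_sum_op bounded_ops_rank_one hilbert_space_UNIV)
  have cS: "cinner (S (fst p) (fst q) (snd p)) (snd q) = (\<Sum>a\<in>A. \<Sum>b\<in>A. G a p * cnj (G b q) * s a b)" for p q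
    unfolding S_def cinner_sum_left
  proof (intro sum.cong refl)
    fix a b
    show "cinner (((if fst a = fst p \<and> fst b = fst q then s a b else 0) * cinner (snd p) (star a)) *\<^sub>C star b) (snd q)
        = G a p * cnj (G b q) * s a b"
      using cinner_commute[of "star b" "snd q"] by (simp add: G_def cinner_scaleC_left)
  qed
  \<comment> \<open>G a p vanishes unless a and p lie over the same point, so \<psi> may be
    evaluated at a and b instead of p and q.\<close>
  have cS\<psi>: "cinner ((1 - \<psi> (fst p) * cnj (\<psi> (fst q))) *\<^sub>C S (fst p) (fst q) (snd p)) (snd q)
      = (\<Sum>a\<in>A. \<Sum>b\<in>A. G a p * cnj (G b q) * ((1 - \<psi> (fst a) * cnj (\<psi> (fst b))) * s a b))" for \<psi> p q
    unfolding cinner_scaleC_left cS sum_distrib_left by (intro sum.cong refl) (simp add: G_def)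
  have "S \<in> admissible_kernels \<Psi>"
    unfolding admissible_kernels_def
  proof (intro CollectI conjI ballI)
    \<comment> \<open>Admissibility also asks for positivity of S itself, which is recovered from
      the condition for a single test function.\<close>
    obtain \<psi> where \<psi>: "\<psi> \<in> \<Psi>" using \<Psi>(1) by blast
    have lt: "cmod (\<psi> x) < 1" for x
      by (rule test_functions_bound[OF \<Psi>(2), of x]) (use \<psi> in force)
    have "(\<Sum>a\<in>A. \<Sum>b\<in>A. c a * cnj (c b) * s a b) \<in> \<real>\<^sub>\<ge>\<^sub>0" for c
      by (rule nonneg_of_contractive[OF A lt pos[OF \<psi>]])
    then have "psd (\<lambda>p q. \<Sum>a\<in>A. \<Sum>b\<in>A. G a p * cnj (G b q) * s a b)"
      by (rule psd_compress)
    then show "positive_kernel S"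
      by (simp add: positive_kernel_iff_psd S cS)
  next
    fix \<psi> assume \<psi>: "\<psi> \<in> \<Psi>"
    have "psd (\<lambda>p q. \<Sum>a\<in>A. \<Sum>b\<in>A. G a p * cnj (G b q) * ((1 - \<psi> (fst a) * cnj (\<psi> (fst b))) * s a b))"
      by (rule psd_compress[OF pos[OF \<psi>]])
    moreover have "(\<lambda>h. (1 - \<psi> x * cnj (\<psi> y)) *\<^sub>C S x y h) \<in> bounded_ops UNIV UNIV" for x y
      by (rule bounded_ops_scaleC_op[OF S hilbert_space_UNIV])
    ultimately show "positive_kernel (\<lambda>x y h. (1 - \<psi> x * cnj (\<psi> y)) *\<^sub>C S x y h)"
      unfolding positive_kernel_iff_psd cS\<psi> by simp
  qed
  then have psd: "psd (schur_kernel f 1 S)"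
    using f by (simp add: schur_agler_class_iff)
  \<comment> \<open>Testing with coefficient 1 on \<beta> tensor \<beta> over every base
    point.\<close>
  define I where "I = fst ` A \<times> P"
  have I: "finite I" using A P(1) by (simp add: I_def)
  have collapse: "(\<Sum>p\<in>I. if fst a = fst p then X p else 0) = (\<Sum>\<beta>\<in>P. X (fst a, \<beta>))" if "a \<in> A" for a and X :: "'x \<times> 'e \<Rightarrow> complex"
  proof -
    have "(\<Sum>p\<in>I. if fst a = fst p then X p else 0) = (\<Sum>\<beta>\<in>P. \<Sum>x\<in>fst ` A. if fst a = x then X (x, \<beta>) else 0)"
      unfolding I_def sum.cartesian_product' by (subst sum.swap) simp
    then show ?thesis
      using A that by simp
  qed
  \<comment> \<open>The defect is sesquilinear in the vector components, so its values on the
    orthonormal system determine it on A.\<close>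
  have expand: "(\<Sum>\<beta>\<in>P. \<Sum>\<beta>'\<in>P. cinner (snd a) \<beta> * cnj (cinner (snd b) \<beta>') * defect f (fst a, \<beta>) (fst b, \<beta>')) = defect f a b"
    if ab: "a \<in> A" "b \<in> A" for a b
  proof -
    have e: "snd c = (\<Sum>\<beta>\<in>P. cinner (snd c) \<beta> *\<^sub>C \<beta>)" if "c \<in> A" for c
      using P(4) that by simp
    have fe: "f (fst c) (snd c) = (\<Sum>\<beta>\<in>P. cinner (snd c) \<beta> *\<^sub>C f (fst c) \<beta>)" if "c \<in> A" for c
      by (subst e[OF that]) (simp add: bounded_ops_sum[OF fb hilbert_space_UNIV] bounded_ops_scaleC[OF fb])
    have "defect f a b = cinner (\<Sum>\<beta>\<in>P. cinner (snd a) \<beta> *\<^sub>C \<beta>) (\<Sum>\<beta>\<in>P. cinner (snd b) \<beta> *\<^sub>C \<beta>)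
        - cinner (\<Sum>\<beta>\<in>P. cinner (snd a) \<beta> *\<^sub>C f (fst a) \<beta>) (\<Sum>\<beta>\<in>P. cinner (snd b) \<beta> *\<^sub>C f (fst b) \<beta>)"
      unfolding defect_def fe[OF ab(1)] fe[OF ab(2)] e[OF ab(1), symmetric] e[OF ab(2), symmetric] ..
    then show ?thesis
      unfolding cinner_sum_sum by (simp add: defect_def right_diff_distrib sum_subtractf)
  qed
  have val: "schur_kernel f 1 S (fst p, snd p, snd p) (fst q, snd q, snd q)
      = (\<Sum>a\<in>A. \<Sum>b\<in>A. s a b * (if fst a = fst p then if fst b = fst q
          then cinner (snd a) (snd p) * cnj (cinner (snd b) (snd q)) * defect f p q else 0 else 0))"
    if "p \<in> I" "q \<in> I" for p q
  proof -
    have pq: "snd p \<in> P" "snd q \<in> P" using that by (auto simp: I_def)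
    have "schur_kernel f 1 S (fst p, snd p, snd p) (fst q, snd q, snd q) = defect f p q * cinner (S (fst p) (fst q) (snd p)) (snd q)"
      by (simp add: schur_kernel_def defect_def)
    then show ?thesis
      unfolding cS sum_distrib_left using pq by (simp add: G_def star1 cong: if_cong) (intro sum.cong refl, simp)
  qed
  have "(\<Sum>p\<in>I. \<Sum>q\<in>I. 1 * cnj 1 * schur_kernel f 1 S (fst p, snd p, snd p) (fst q, snd q, snd q)) \<in> \<real>\<^sub>\<ge>\<^sub>0"
    by (rule psd_sum_nonneg[OF psd I])
  also have "(\<Sum>p\<in>I. \<Sum>q\<in>I. 1 * cnj 1 * schur_kernel f 1 S (fst p, snd p, snd p) (fst q, snd q, snd q))
      = (\<Sum>p\<in>I. \<Sum>q\<in>I. \<Sum>a\<in>A. \<Sum>b\<in>A. s a b * (if fst a = fst p then if fst b = fst q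
          then cinner (snd a) (snd p) * cnj (cinner (snd b) (snd q)) * defect f p q else 0 else 0))"
    by (intro sum.cong refl) (simp only: val complex_cnj_one mult_1_left)
  also have "\<dots> = (\<Sum>a\<in>A. \<Sum>b\<in>A. s a b * defect f a b)"
  proof (subst sum_swap4, intro sum.cong refl)
    fix a b assume ab: "a \<in> A" "b \<in> A"
    have "(\<Sum>p\<in>I. \<Sum>q\<in>I. s a b * (if fst a = fst p then if fst b = fst q
          then cinner (snd a) (snd p) * cnj (cinner (snd b) (snd q)) * defect f p q else 0 else 0))
        = s a b * (\<Sum>p\<in>I. if fst a = fst p then \<Sum>q\<in>I. if fst b = fst q
          then cinner (snd a) (snd p) * cnj (cinner (snd b) (snd q)) * defect f p q else 0 else 0)"
      unfolding sum_distrib_left by (intro sum.cong refl) (simp add: sum_distrib_left)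
    then show "(\<Sum>p\<in>I. \<Sum>q\<in>I. s a b * (if fst a = fst p then if fst b = fst q
          then cinner (snd a) (snd p) * cnj (cinner (snd b) (snd q)) * defect f p q else 0 else 0)) = s a b * defect f a b"
      by (simp only: collapse[OF ab(1)] collapse[OF ab(2)] fst_conv snd_conv expand[OF ab])
  qed
  finally show ?thesis .
qed

section \<open>The cone of Agler sums and its separation from the defect\<close>

definition agler_sum :: "nat \<Rightarrow> (nat \<Rightarrow> 'x \<Rightarrow> complex) \<Rightarrow> (nat \<Rightarrow> 'x \<times> 'e \<Rightarrow> complex) \<Rightarrow> 'x \<times> 'e \<Rightarrow> 'x \<times> 'e \<Rightarrow> complex"
  where "agler_sum m \<psi> c a b = (\<Sum>k<m. c k a * cnj (c k b) * (1 - \<psi> k (fst a) * cnj (\<psi> k (fst b))))"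

text \<open>Let p be the point of the closed cone closest to the defect and L = defect - p. The
  negative Hermitian part s of L pairs nonnegatively with the cone, hence with the defect by
  \<open>defect_pairing_nonneg\<close>; but the latter pairing is -<L, L> - <L, p> with <L, p> \<ge>
  0, so L = 0.\<close>

lemma schur_agler_approx:
  fixes f :: "'x \<Rightarrow> 'e::chilbert \<Rightarrow> 'e"
  assumes \<Psi>: "\<Psi> \<noteq> {}" "test_functions \<Psi>" and f: "f \<in> schur_agler_class \<Psi>" and A: "finite A" and \<epsilon>: "\<epsilon> > 0"
  obtains m \<psi> c where "\<And>k. k < m \<Longrightarrow> \<psi> k \<in> \<Psi>"
    "\<And>a b. a \<in> A \<Longrightarrow> b \<in> A \<Longrightarrow> cmod (agler_sum m \<psi> c a b - defect f a b) < \<epsilon>"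
proof -
  \<comment> \<open>An orthonormal family indexed by pairs of points turns matrices on A into
    vectors of a Hilbert space, where closest points exist and entries are inner products with unit
    vectors.\<close>
  define basis where "basis p = kvec (Index p)" for p :: "('x \<times> 'e) \<times> ('x \<times> 'e)"
  have basis: "cinner (basis p) (basis q) = (if p = q then 1 else 0)" for p q
    by (simp add: basis_def cinner_kvec pdk_index_def)
  define mvec where "mvec N = (\<Sum>p\<in>A \<times> A. N (fst p) (snd p) *\<^sub>C basis p)" for N
  have AA: "finite (A \<times> A)" using A by simp
  have coord: "cinner (mvec N) (basis (a, b)) = N a b" if "a \<in> A" "b \<in> A" for N a b
  proof -
    have "cinner (mvec N) (basis (a, b)) = (\<Sum>p\<in>A \<times> A. if p = (a, b) then N a b else 0)"
      unfolding mvec_def cinner_sum_left cinner_scaleC_left basis by (intro sum.cong) auto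
    then show ?thesis using AA that by simp
  qed
  have mvec_add: "mvec (\<lambda>a b. M a b + N a b) = mvec M + mvec N" for M N
    by (simp add: mvec_def scaleC_add_left sum.distrib)
  have mvec_scale: "mvec (\<lambda>a b. of_real r * N a b) = r *\<^sub>R mvec N" for r N
    by (simp add: mvec_def scaleR_scaleC scaleC_sum_right scaleC_scaleC)
  define K where "K = {mvec (agler_sum m \<psi> c) | m \<psi> c. \<forall>k<m. \<psi> k \<in> \<Psi>}"
  have K0: "0 \<in> K"
    unfolding K_def
    by (rule CollectI, rule exI[of _ 0]) (simp add: mvec_def agler_sum_def)
  have Kscale: "r *\<^sub>R v \<in> K" if v: "v \<in> K" and r: "r \<ge> 0" for r v
  proof -
    obtain m \<psi> c where v: "v = mvec (agler_sum m \<psi> c)" and \<psi>: "\<forall>k<m. \<psi> k \<in> \<Psi>"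
      using v unfolding K_def by blast
    have sq: "complex_of_real (sqrt r) * complex_of_real (sqrt r) = of_real r"
      using r by (simp flip: of_real_mult)
    have "(\<lambda>a b. of_real r * agler_sum m \<psi> c a b) = agler_sum m \<psi> (\<lambda>k a. of_real (sqrt r) * c k a)"
      unfolding agler_sum_def sum_distrib_left sq[symmetric] by (simp add: mult_ac)
    then have "r *\<^sub>R v = mvec (agler_sum m \<psi> (\<lambda>k a. of_real (sqrt r) * c k a))"
      unfolding v mvec_scale[symmetric] by simp
    with \<psi> show ?thesis unfolding K_def by blast
  qed
  have Kadd: "v + w \<in> K" if v: "v \<in> K" and w: "w \<in> K" for v w
  proof -
    obtain m \<psi> c where v: "v = mvec (agler_sum m \<psi> c)" and \<psi>: "\<forall>k<m. \<psi> k \<in> \<Psi>"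
      using v unfolding K_def by blast
    obtain n \<phi> d where w: "w = mvec (agler_sum n \<phi> d)" and \<phi>: "\<forall>k<n. \<phi> k \<in> \<Psi>"
      using w unfolding K_def by blast
    define \<omega> where "\<omega> k = (if k < m then \<psi> k else \<phi> (k - m))" for k
    define e where "e k = (if k < m then c k else d (k - m))" for k
    have split: "(\<Sum>k<m + n. F k) = (\<Sum>k<m. F k) + (\<Sum>k<n. F (m + k))" for F :: "nat \<Rightarrow> complex"
      by (induction n) (simp_all add: add.assoc)
    have "agler_sum (m + n) \<omega> e = (\<lambda>a b. agler_sum m \<psi> c a b + agler_sum n \<phi> d a b)"
      unfolding agler_sum_def split by (simp add: \<omega>_def e_def)
    then have "v + w = mvec (agler_sum (m + n) \<omega> e)"
      by (simp add: v w mvec_add)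
    moreover have "\<forall>k<m + n. \<omega> k \<in> \<Psi>"
      using \<psi> \<phi> by (auto simp: \<omega>_def)
    ultimately show ?thesis unfolding K_def by blast
  qed
  have "convex K"
    unfolding convex_def by (intro ballI allI impI Kadd Kscale)
  then have "convex (closure K)"
    by (rule convex_closure)
  moreover have "closure K \<noteq> {}"
    using K0 closure_subset by blast
  ultimately obtain p where p: "p \<in> closure K" "\<And>y. y \<in> closure K \<Longrightarrow> inner (mvec (defect f) - p) (y - p) \<le> 0"
    using closest_point_variational[of "closure K" "mvec (defect f)"] by auto
  define L where "L = mvec (defect f) - p"
  have pL: "inner L p \<ge> 0"
    using p(2)[of 0] K0 closure_subset[of K] by (auto simp: L_def)
  have KL: "inner L v \<le> 0" if v: "v \<in> K" for v
  proof (rule ccontr)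
    assume "\<not> inner L v \<le> 0"
    then have pos: "inner L v > 0" by simp
    \<comment> \<open>Chosen so that L has inner product 1 with t v - p, against the variational
      inequality.\<close>
    define t where "t = (inner L p + 1) / inner L v"
    have "t *\<^sub>R v \<in> closure K"
      using Kscale[OF v, of t] closure_subset[of K] pL pos by (auto simp: t_def)
    then have "inner L (t *\<^sub>R v - p) \<le> 0"
      unfolding L_def by (rule p(2))
    then show False
      using pos by (simp add: inner_diff_right t_def)
  qed
  have "L = 0"
  proof (rule ccontr)
    assume nz: "L \<noteq> 0"
    define l where "l a b = cnj (cinner L (basis (a, b)))" for a b
    have pair: "cinner (mvec N) L = (\<Sum>a\<in>A. \<Sum>b\<in>A. N a b * l a b)" for N
    proof -
      have "cinner (mvec N) L = (\<Sum>p\<in>A \<times> A. N (fst p) (snd p) * l (fst p) (snd p))"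
        unfolding mvec_def cinner_sum_left cinner_scaleC_left
        by (intro sum.cong refl) (simp add: l_def flip: cinner_commute)
      then show ?thesis
        by (simp add: sum.cartesian_product case_prod_beta)
    qed
    \<comment> \<open>The real inner product with Hermitian matrices sees only the Hermitian part of
      l; the sign makes the pairing with the cone nonnegative.\<close>
    define s where "s a b = (- 1 / 2) * (l a b + cnj (l b a))" for a b
    have herm: "(\<Sum>a\<in>A. \<Sum>b\<in>A. N a b * s a b) = - complex_of_real (inner L (mvec N))"
      if N: "\<And>a b. a \<in> A \<Longrightarrow> b \<in> A \<Longrightarrow> N b a = cnj (N a b)" for N
    proof -
      have "(\<Sum>a\<in>A. \<Sum>b\<in>A. N a b * cnj (l b a)) = (\<Sum>b\<in>A. \<Sum>a\<in>A. N a b * cnj (l b a))"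
        by (rule sum.swap)
      also have "\<dots> = cnj (\<Sum>b\<in>A. \<Sum>a\<in>A. N b a * l b a)"
        unfolding cnj_sum
      proof (intro sum.cong refl)
        fix b a assume "b \<in> A" "a \<in> A"
        then show "N a b * cnj (l b a) = cnj (N b a * l b a)"
          by (simp add: N[of a b])
      qed
      finally have "(\<Sum>a\<in>A. \<Sum>b\<in>A. N a b * cnj (l b a)) = cnj (cinner (mvec N) L)"
        by (simp add: pair)
      moreover have "(\<Sum>a\<in>A. \<Sum>b\<in>A. N a b * s a b)
          = (- 1 / 2) * ((\<Sum>a\<in>A. \<Sum>b\<in>A. N a b * l a b) + (\<Sum>a\<in>A. \<Sum>b\<in>A. N a b * cnj (l b a)))"
        unfolding sum.distrib[symmetric] sum_distrib_left
        by (intro sum.cong refl) (simp add: s_def algebra_simps)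
      ultimately have "(\<Sum>a\<in>A. \<Sum>b\<in>A. N a b * s a b) = (- 1 / 2) * (cinner (mvec N) L + cnj (cinner (mvec N) L))"
        by (simp only: pair)
      also have "\<dots> = - complex_of_real (Re (cinner (mvec N) L))"
        by (simp add: complex_add_cnj)
      finally show ?thesis
        unfolding inner_commute[of L] by (simp add: inner_cinner)
    qed
    have nonneg: "(\<Sum>a\<in>A. \<Sum>b\<in>A. s a b * defect f a b) \<in> \<real>\<^sub>\<ge>\<^sub>0"
    proof (rule defect_pairing_nonneg[OF \<Psi> f A])
      fix \<psi> and c :: "'x \<times> 'e \<Rightarrow> complex" assume \<psi>: "\<psi> \<in> \<Psi>"
      let ?N = "agler_sum 1 (\<lambda>_. \<psi>) (\<lambda>_. c)"
      have "mvec ?N \<in> K"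
        unfolding K_def using \<psi> by blast
      then have "inner L (mvec ?N) \<le> 0" by (rule KL)
      moreover have "(\<Sum>a\<in>A. \<Sum>b\<in>A. ?N a b * s a b) = - complex_of_real (inner L (mvec ?N))"
        by (rule herm) (simp add: agler_sum_def mult_ac)
      ultimately have "(\<Sum>a\<in>A. \<Sum>b\<in>A. ?N a b * s a b) \<in> \<real>\<^sub>\<ge>\<^sub>0"
        by (simp add: complex_nonneg_Reals_iff)
      then show "(\<Sum>a\<in>A. \<Sum>b\<in>A. c a * cnj (c b) * ((1 - \<psi> (fst a) * cnj (\<psi> (fst b))) * s a b)) \<in> \<real>\<^sub>\<ge>\<^sub>0"
        by (simp add: agler_sum_def mult.assoc)
    qed
    have "(\<Sum>a\<in>A. \<Sum>b\<in>A. defect f a b * s a b) = - complex_of_real (inner L (mvec (defect f)))"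
    proof (rule herm)
      show "defect f b a = cnj (defect f a b)" for a b
        unfolding defect_def complex_cnj_diff by (simp flip: cinner_commute)
    qed
    also have "inner L (mvec (defect f)) = inner L L + inner L p"
      by (simp add: L_def inner_diff_right)
    finally have "complex_of_real (- (inner L L + inner L p)) \<in> \<real>\<^sub>\<ge>\<^sub>0"
      using nonneg unfolding mult.commute[of "s _ _"] of_real_minus by (simp only:)
    moreover have "inner L L > 0" using nz by simp
    ultimately show False
      using pL unfolding complex_nonneg_Reals_iff Re_complex_of_real by linarith
  qed
  then have "mvec (defect f) \<in> closure K"
    using p(1) by (simp add: L_def)
  then obtain v where v: "v \<in> K" "dist v (mvec (defect f)) < \<epsilon>"
    using \<epsilon> unfolding closure_approachable by blast
  then obtain m \<psi> c where v': "v = mvec (agler_sum m \<psi> c)" and \<psi>: "\<forall>k<m. \<psi> k \<in> \<Psi>"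
    unfolding K_def by blast
  show ?thesis
  proof (rule that)
    show "\<psi> k \<in> \<Psi>" if "k < m" for k using \<psi> that by blast
    fix a b assume ab: "a \<in> A" "b \<in> A"
    have "agler_sum m \<psi> c a b - defect f a b = cinner (v - mvec (defect f)) (basis (a, b))"
      by (simp add: v' cinner_diff_left coord[OF ab])
    then have "cmod (agler_sum m \<psi> c a b - defect f a b) \<le> norm (v - mvec (defect f)) * norm (basis (a, b))"
      using cinner_cmod_le by metis
    also have "norm (basis (a, b)) = 1"
    proof -
      have "complex_of_real ((norm (basis (a, b)))\<^sup>2) = of_real 1"
        using basis[of "(a, b)" "(a, b)"] unfolding cinner_self by simp
      then have "(norm (basis (a, b)))\<^sup>2 = 1"
        by (simp only: of_real_eq_iff)
      then have "norm (basis (a, b)) = 1 \<or> norm (basis (a, b)) = - 1"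
        by (simp only: power2_eq_1_iff)
      then show ?thesis
        using norm_ge_zero[of "basis (a, b)"] by linarith
    qed
    also have "norm (v - mvec (defect f)) * 1 < \<epsilon>"
      using v(2) by (simp add: dist_norm)
    finally show "cmod (agler_sum m \<psi> c a b - defect f a b) < \<epsilon>" .
  qed
qed

subsection \<open>The Agler decomposition\<close>

text \<open>
  A positive functional-valued kernel \<open>\<Gamma>\<close> is encoded as the scalar kernel
  \<open>q((g, a), (h, b)) = \<Gamma>(a, b)(g cnj(h))\<close>, on which \<open>Cb \<Psi>\<close> acts through the first component. A first
  component outside \<open>Cb \<Psi>\<close> is read as \<open>0\<close>.
\<close>

type_synonym ('x, 'a) atom = "(('x \<Rightarrow> complex) \<Rightarrow> complex) \<times> 'a"

definition atom_value :: "('x \<Rightarrow> complex) set \<Rightarrow> ('x, 'a) atom \<Rightarrow> ('x \<Rightarrow> complex) \<Rightarrow> complex"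
  where "atom_value \<Psi> t \<psi> = (if fst t \<in> Cb \<Psi> then fst t \<psi> else 0)"

definition act :: "('x \<Rightarrow> complex) set \<Rightarrow> (('x \<Rightarrow> complex) \<Rightarrow> complex) \<Rightarrow>
    ('x, 'a) atom \<Rightarrow> ('x, 'a) atom"
  where "act \<Psi> u t = (\<lambda>\<psi>\<in>\<Psi>. u \<psi> * atom_value \<Psi> t \<psi>, snd t)"

definition unit_atom :: "('x \<Rightarrow> complex) set \<Rightarrow> 'a \<Rightarrow> ('x, 'a) atom"
  where "unit_atom \<Psi> a = (\<lambda>\<psi>\<in>\<Psi>. 1, a)"

lemma snd_act [simp]: "snd (act \<Psi> u t) = snd t"
  by (simp add: act_def)

lemma snd_unit_atom [simp]: "snd (unit_atom \<Psi> a) = a"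
  by (simp add: unit_atom_def)

lemma atom_value_unit_atom: "\<psi> \<in> \<Psi> \<Longrightarrow> atom_value \<Psi> (unit_atom \<Psi> a) \<psi> = 1"
  by (simp add: atom_value_def unit_atom_def Cb_const)

lemma atom_value_act:
  assumes "u \<in> Cb \<Psi>" "\<psi> \<in> \<Psi>"
  shows "atom_value \<Psi> (act \<Psi> u t) \<psi> = u \<psi> * atom_value \<Psi> t \<psi>"
proof -
  have "fst (act \<Psi> u t) \<in> Cb \<Psi>"
    using Cb_mult[OF assms(1), of "fst t"] Cb_const[where c = 0]
    by (cases "fst t \<in> Cb \<Psi>") (simp_all add: act_def atom_value_def)
  then show ?thesis
    using assms(2) by (simp add: atom_value_def[of \<Psi> "act \<Psi> u t"]) (simp add: act_def)
qed

text \<open>What the Kolmogorov space of q needs in order to carry a representation: the bound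
  allows the action of u to be extended to the span, the remaining clauses become the laws of a
  unital *-representation. They speak of values of q because atoms cannot be added or scaled, and
  acting by 1 changes an atom whose function lies outside \<open>Cb \<Psi>\<close>.\<close>

definition module_kernel :: "('x \<Rightarrow> complex) set \<Rightarrow>
    (('x, 'a) atom \<Rightarrow> ('x, 'a) atom \<Rightarrow> complex) \<Rightarrow> bool"
  where "module_kernel \<Psi> q \<longleftrightarrow> psd q \<and>
    (\<forall>u\<in>Cb \<Psi>. \<forall>m\<ge>0. (\<forall>\<psi>\<in>\<Psi>. cmod (u \<psi>) \<le> m) \<longrightarrow>
      psd (\<lambda>t s. complex_of_real (m\<^sup>2) * q t s - q (act \<Psi> u t) (act \<Psi> u s))) \<and>
    (\<forall>u\<in>Cb \<Psi>. \<forall>t s. q (act \<Psi> u t) s = q t (act \<Psi> (\<lambda>\<psi>\<in>\<Psi>. cnj (u \<psi>)) s)) \<and>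
    (\<forall>u\<in>Cb \<Psi>. \<forall>v\<in>Cb \<Psi>. \<forall>t s. q (act \<Psi> (\<lambda>\<psi>\<in>\<Psi>. u \<psi> + v \<psi>) t) s = q (act \<Psi> u t) s + q (act \<Psi> v t) s) \<and>
    (\<forall>u\<in>Cb \<Psi>. \<forall>c t s. q (act \<Psi> (\<lambda>\<psi>\<in>\<Psi>. c * u \<psi>) t) s = c * q (act \<Psi> u t) s) \<and>
    (\<forall>u\<in>Cb \<Psi>. \<forall>v\<in>Cb \<Psi>. \<forall>t s. q (act \<Psi> (\<lambda>\<psi>\<in>\<Psi>. u \<psi> * v \<psi>) t) s = q (act \<Psi> u (act \<Psi> v t)) s) \<and>
    (\<forall>t s. q (act \<Psi> (\<lambda>\<psi>\<in>\<Psi>. 1) t) s = q t s)"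

lemma module_kernelD:
  assumes "module_kernel \<Psi> q"
  shows module_kernel_psd: "psd q"
    and module_kernel_bound: "u \<in> Cb \<Psi> \<Longrightarrow> m \<ge> 0 \<Longrightarrow> (\<And>\<psi>. \<psi> \<in> \<Psi> \<Longrightarrow> cmod (u \<psi>) \<le> m) \<Longrightarrow>
      psd (\<lambda>t s. complex_of_real (m\<^sup>2) * q t s - q (act \<Psi> u t) (act \<Psi> u s))"
    and module_kernel_star: "u \<in> Cb \<Psi> \<Longrightarrow> q (act \<Psi> u t) s = q t (act \<Psi> (\<lambda>\<psi>\<in>\<Psi>. cnj (u \<psi>)) s)"
    and module_kernel_add: "u \<in> Cb \<Psi> \<Longrightarrow> v \<in> Cb \<Psi> \<Longrightarrow>
      q (act \<Psi> (\<lambda>\<psi>\<in>\<Psi>. u \<psi> + v \<psi>) t) s = q (act \<Psi> u t) s + q (act \<Psi> v t) s"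
    and module_kernel_scale: "u \<in> Cb \<Psi> \<Longrightarrow> q (act \<Psi> (\<lambda>\<psi>\<in>\<Psi>. c * u \<psi>) t) s = c * q (act \<Psi> u t) s"
    and module_kernel_mult: "u \<in> Cb \<Psi> \<Longrightarrow> v \<in> Cb \<Psi> \<Longrightarrow>
      q (act \<Psi> (\<lambda>\<psi>\<in>\<Psi>. u \<psi> * v \<psi>) t) s = q (act \<Psi> u (act \<Psi> v t)) s"
    and module_kernel_one: "q (act \<Psi> (\<lambda>\<psi>\<in>\<Psi>. 1) t) s = q t s"
  using assms unfolding module_kernel_def by blast+

text \<open>Sums of point masses: u acts on the k-th summand as the scalar u(\<psi> k). Scalar d k
  yields the kernels of Agler sums, vector-valued d k a module containing a copy of E.\<close>

lemma module_kernel_point_evaluations: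
  fixes \<phi> :: "'k \<Rightarrow> ('x, 'a) atom \<Rightarrow> 'b::chilbert"
  assumes \<psi>: "\<And>k. k \<in> K \<Longrightarrow> \<psi> k \<in> \<Psi>" and \<phi>: "\<And>k t. k \<in> K \<Longrightarrow> \<phi> k t = atom_value \<Psi> t (\<psi> k) *\<^sub>C d k (snd t)"
  shows "module_kernel \<Psi> (\<lambda>t s. \<Sum>k\<in>K. cinner (\<phi> k t) (\<phi> k s))"
proof -
  have act: "\<phi> k (act \<Psi> u t) = u (\<psi> k) *\<^sub>C \<phi> k t" if "k \<in> K" "u \<in> Cb \<Psi>" for k u t
    using that by (simp add: \<phi> atom_value_act \<psi> scaleC_scaleC)
  have "psd (\<lambda>t s. complex_of_real (m\<^sup>2) * (\<Sum>k\<in>K. cinner (\<phi> k t) (\<phi> k s)) - (\<Sum>k\<in>K. cinner (\<phi> k (act \<Psi> u t)) (\<phi> k (act \<Psi> u s))))"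
    if u: "u \<in> Cb \<Psi>" and m: "m \<ge> 0" "\<forall>\<psi>\<in>\<Psi>. cmod (u \<psi>) \<le> m" for u m
  proof -
    \<comment> \<open>The square root of the slack m^2 - |u(\<psi> k)|^2 writes the difference of
      the two kernels as a sum of rescaled Gram kernels.\<close>
    define r where "r k = complex_of_real (sqrt (m\<^sup>2 - (cmod (u (\<psi> k)))\<^sup>2))" for k
    have r: "r k * cnj (r k) = complex_of_real (m\<^sup>2) - u (\<psi> k) * cnj (u (\<psi> k))" if "k \<in> K" for k
    proof -
      have "(cmod (u (\<psi> k)))\<^sup>2 \<le> m\<^sup>2"
        using m \<psi>[OF that] by (intro power_mono) auto
      then show ?thesis
        by (simp add: r_def flip: complex_norm_square of_real_mult)
    qed
    have "complex_of_real (m\<^sup>2) * (\<Sum>k\<in>K. cinner (\<phi> k t) (\<phi> k s)) - (\<Sum>k\<in>K. cinner (\<phi> k (act \<Psi> u t)) (\<phi> k (act \<Psi> u s)))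
        = (\<Sum>k\<in>K. r k * cnj (r k) * cinner (\<phi> k t) (\<phi> k s))" for t s
      unfolding sum_distrib_left sum_subtractf[symmetric]
      by (intro sum.cong refl) (simp add: r act u cinner_scaleC_left cinner_scaleC_right algebra_simps)
    moreover have "psd (\<lambda>t s. \<Sum>k\<in>K. r k * cnj (r k) * cinner (\<phi> k t) (\<phi> k s))"
      by (rule psd_sum) (rule psd_scale_rank1[OF psd_cinner])
    ultimately show ?thesis by simp
  qed
  moreover have "psd (\<lambda>t s. \<Sum>k\<in>K. cinner (\<phi> k t) (\<phi> k s))"
    by (rule psd_sum) (rule psd_cinner)
  moreover have "(\<Sum>k\<in>K. cinner (\<phi> k (act \<Psi> (\<lambda>\<psi>\<in>\<Psi>. 1) t)) (\<phi> k s)) = (\<Sum>k\<in>K. cinner (\<phi> k t) (\<phi> k s))" for t s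
    by (intro sum.cong refl) (simp add: act Cb_const \<psi>)
  ultimately show ?thesis
    unfolding module_kernel_def
    by (simp add: act \<psi> Cb_cnj Cb_add Cb_scale Cb_mult cinner_scaleC_left cinner_scaleC_right sum_distrib_left
        mult.assoc flip: sum.distrib cong: sum.cong) (simp add: algebra_simps)
qed

section \<open>Closedness and compactness under pointwise convergence\<close>

lemma closed_Collect_ball_const: "(\<And>u. u \<in> A \<Longrightarrow> closed {q. P u q}) \<Longrightarrow> closed {q. \<forall>u\<in>A. P u q}"
  unfolding Collect_ball_eq by (intro closed_INT ballI)

lemma closed_Collect_imp_const: "(Q \<Longrightarrow> closed {q. P q}) \<Longrightarrow> closed {q. Q \<longrightarrow> P q}"
  by (cases Q) simp_all

lemma closed_Collect_psd:
  assumes "\<And>t s. continuous_on UNIV (\<lambda>q. F q t s)"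
  shows "closed {q. psd (F q)}"
  unfolding psd_def
proof (intro closed_Collect_all)
  fix n :: nat and c x
  have "closed ((\<lambda>q. \<Sum>i<n. \<Sum>j<n. c i * cnj (c j) * F q (x i) (x j)) -` \<real>\<^sub>\<ge>\<^sub>0)"
    by (intro closed_vimage closed_nonneg_Reals_complex continuous_intros assms)
  then show "closed {q. (\<Sum>i<n. \<Sum>j<n. c i * cnj (c j) * F q (x i) (x j)) \<in> \<real>\<^sub>\<ge>\<^sub>0}"
    by (simp add: vimage_def)
qed

lemma continuous_on_coordinate: "continuous_on UNIV (\<lambda>q. q p)"
  by (rule continuous_on_product_coordinates)

text \<open>For fixed parameters every clause is a closed condition on finitely many values of q, so
  pointwise limits preserve it.\<close>

lemma closed_module_kernel: "closed {q. module_kernel \<Psi> (\<lambda>t s. q (t, s))}"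
  unfolding module_kernel_def
  by (intro closed_Collect_conj closed_Collect_ball_const closed_Collect_all closed_Collect_imp_const
      closed_Collect_psd closed_Collect_eq continuous_intros continuous_on_coordinate)

lemma compact_box:
  fixes B :: "'i \<Rightarrow> real"
  shows "compact {q :: 'i \<Rightarrow> complex. \<forall>p. cmod (q p) \<le> B p}"
proof -
  have "compactin (product_topology (\<lambda>_. euclidean) UNIV) (PiE UNIV (\<lambda>p. cball (0 :: complex) (B p)))"
    unfolding compactin_PiE by simp
  then show ?thesis
    unfolding euclidean_product_topology by (simp add: PiE_def Pi_def)
qed

text \<open>Every finite approximation is a sum of point masses, hence a module kernel, and lies in
  a product of discs that does not depend on the approximation. The finite intersection property
  gives one q satisfying all approximate equations.\<close>

lemma agler_decomposition:
  fixes f :: "'x \<Rightarrow> 'e::chilbert \<Rightarrow> 'e"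
  assumes \<Psi>: "\<Psi> \<noteq> {}" "test_functions \<Psi>" and f: "f \<in> schur_agler_class \<Psi>"
  obtains q where "module_kernel \<Psi> q"
    "\<And>a b. q (unit_atom \<Psi> a) (unit_atom \<Psi> b)
      - q (act \<Psi> (evaluation \<Psi> (fst a)) (unit_atom \<Psi> a)) (act \<Psi> (evaluation \<Psi> (fst b)) (unit_atom \<Psi> b)) = defect f a b"
proof -
  have "\<forall>x. \<exists>r. 0 \<le> r \<and> r < 1 \<and> (\<forall>\<psi>\<in>\<Psi>. cmod (\<psi> x) \<le> r)"
    using test_functions_bound[OF \<Psi>(2)] by metis
  then obtain r where r: "\<And>x. 0 \<le> r x" "\<And>x. r x < 1" "\<And>x \<psi>. \<psi> \<in> \<Psi> \<Longrightarrow> cmod (\<psi> x) \<le> r x"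
    by metis
  have "\<forall>g. \<exists>M. M \<ge> 0 \<and> (g \<in> Cb \<Psi> \<longrightarrow> (\<forall>\<psi>\<in>\<Psi>. cmod (g \<psi>) \<le> M))"
    using Cb_bound by (metis order_refl)
  then obtain G where G: "\<And>g. G g \<ge> 0" "\<And>g \<psi>. g \<in> Cb \<Psi> \<Longrightarrow> \<psi> \<in> \<Psi> \<Longrightarrow> cmod (g \<psi>) \<le> G g"
    by metis
  \<comment> \<open>A lower bound for 1 - |\<psi>(x)|^2 that is uniform in \<psi>; its positivity is
    where the supremum condition on test functions enters.\<close>
  define \<delta> where "\<delta> x = 1 - (r x)\<^sup>2" for x
  have \<delta>: "\<delta> x > 0" for x
    using r(1,2)[of x] by (simp add: \<delta>_def power_less_one_iff abs_square_less_1)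
  \<comment> \<open>Bounds the sum of |\<phi> k t|^2 below: G controls the function in the atom, the
    quotient controls the sum of the |c k a|^2 through the diagonal of the Agler sum.\<close>
  define B where "B t = (G (fst t))\<^sup>2 * (((norm (snd (snd t)))\<^sup>2 + 1) / \<delta> (fst (snd t)))"
    for t :: "('x, 'x \<times> 'e) atom"
  define eq where "eq q a b = q (unit_atom \<Psi> a, unit_atom \<Psi> b)
      - q (act \<Psi> (evaluation \<Psi> (fst a)) (unit_atom \<Psi> a), act \<Psi> (evaluation \<Psi> (fst b)) (unit_atom \<Psi> b))" for q :: "_ \<Rightarrow> complex" and a b :: "'x \<times> 'e"
  define F where "F = (\<lambda>(A, \<epsilon>). {q. module_kernel \<Psi> (\<lambda>t s. q (t, s)) \<and> (\<forall>a\<in>A. \<forall>b\<in>A. cmod (eq q a b - defect f a b) \<le> \<epsilon>)})"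
  define I where "I = {(A :: ('x \<times> 'e) set, \<epsilon>). finite A \<and> (\<epsilon> :: real) > 0}"
  have "{q. \<forall>p. cmod (q p) \<le> B (fst p) + B (snd p)} \<inter> (\<Inter>i\<in>I. F i) \<noteq> {}"
  proof (rule compact_imp_fip_image[OF compact_box])
    fix i assume "i \<in> I"
    show "closed (F i)"
      unfolding F_def case_prod_beta eq_def
      by (intro closed_Collect_conj closed_module_kernel closed_Collect_ball_const closed_Collect_le
          continuous_intros continuous_on_coordinate)
  next
    fix J assume J: "finite J" "J \<subseteq> I"
    define A where "A = (\<Union>i\<in>J. fst i)"
    \<comment> \<open>The cap at 1 keeps the diagonal of the Agler sum at a = (x, e) below |e|^2 +
      1, the numerator in B, whatever precision is demanded.\<close>
    define \<epsilon> where "\<epsilon> = Min (insert 1 (snd ` J))"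
    have A: "finite A"
      using J by (auto simp: A_def I_def)
    have \<epsilon>: "\<epsilon> > 0" "\<epsilon> \<le> 1" "\<And>i. i \<in> J \<Longrightarrow> \<epsilon> \<le> snd i"
      using J by (auto simp: \<epsilon>_def I_def)
    obtain m \<psi> c where \<psi>: "\<And>k. k < m \<Longrightarrow> \<psi> k \<in> \<Psi>"
      and approx: "\<And>a b. a \<in> A \<Longrightarrow> b \<in> A \<Longrightarrow> cmod (agler_sum m \<psi> c a b - defect f a b) < \<epsilon>"
      using schur_agler_approx[OF \<Psi> f A \<epsilon>(1)] by metis
    \<comment> \<open>Nothing controls c outside A; setting it to 0 there keeps q in the box at
      every atom.\<close>
    define d where "d k a = (if a \<in> A then c k a else 0)" for k a
    define \<phi> where "\<phi> k t = atom_value \<Psi> t (\<psi> k) *\<^sub>C d k (snd t)" for k and t :: "('x, 'x \<times> 'e) atom"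
    define q where "q p = (\<Sum>k<m. cinner (\<phi> k (fst p)) (\<phi> k (snd p)))" for p
    have module: "module_kernel \<Psi> (\<lambda>t s. q (t, s))"
      unfolding q_def fst_conv snd_conv
      by (rule module_kernel_point_evaluations[where d = d and \<psi> = \<psi>]) (auto simp: \<psi> \<phi>_def)
    have eqq: "eq q a b = agler_sum m \<psi> c a b" if "a \<in> A" "b \<in> A" for a b
    proof -
      have "\<phi> k (unit_atom \<Psi> a) = d k a" "\<phi> k (act \<Psi> (evaluation \<Psi> x) (unit_atom \<Psi> a)) = \<psi> k x * d k a"
        if "k < m" for k a x
        using \<psi>[OF that]
        by (simp_all add: \<phi>_def atom_value_unit_atom atom_value_act evaluation_Cb[OF \<Psi>(2)] scaleC_complex_def)
          (simp add: evaluation_def)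
      then show ?thesis
        using that unfolding eq_def q_def agler_sum_def sum_subtractf[symmetric]
        by (intro sum.cong refl) (simp add: cinner_complex_def d_def algebra_simps)
    qed
    have bound: "(\<Sum>k<m. (cmod (\<phi> k t))\<^sup>2) \<le> B t" for t
    proof (cases "fst t \<in> Cb \<Psi> \<and> snd t \<in> A")
      case False
      then have "\<phi> k t = 0" for k
        by (auto simp: \<phi>_def atom_value_def d_def scaleC_complex_def)
      then show ?thesis
        using \<delta>[of "fst (snd t)"] by (simp add: B_def)
    next
      case True
      let ?a = "snd t" and ?x = "fst (snd t)"
      have "\<delta> ?x * (\<Sum>k<m. (cmod (c k ?a))\<^sup>2) \<le> (\<Sum>k<m. (cmod (c k ?a))\<^sup>2 * (1 - (cmod (\<psi> k ?x))\<^sup>2))"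
        unfolding sum_distrib_left
      proof (rule sum_mono)
        fix k assume "k \<in> {..<m}"
        then have "(cmod (\<psi> k ?x))\<^sup>2 \<le> (r ?x)\<^sup>2"
          using r(3)[OF \<psi>] by (intro power_mono) auto
        then have "(cmod (c k ?a))\<^sup>2 * \<delta> ?x \<le> (cmod (c k ?a))\<^sup>2 * (1 - (cmod (\<psi> k ?x))\<^sup>2)"
          by (intro mult_left_mono) (auto simp: \<delta>_def)
        then show "\<delta> ?x * (cmod (c k ?a))\<^sup>2 \<le> (cmod (c k ?a))\<^sup>2 * (1 - (cmod (\<psi> k ?x))\<^sup>2)"
          by (simp add: mult.commute)
      qed
      also have "\<dots> = Re (agler_sum m \<psi> c ?a ?a)"
      proof -
        have "agler_sum m \<psi> c ?a ?a = (\<Sum>k<m. of_real ((cmod (c k ?a))\<^sup>2 * (1 - (cmod (\<psi> k ?x))\<^sup>2)))"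
          unfolding agler_sum_def complex_norm_square[symmetric] by (intro sum.cong refl) simp
        then show ?thesis by (simp only: Re_sum Re_complex_of_real)
      qed
      also have "\<dots> \<le> Re (defect f ?a ?a) + 1"
      proof -
        have "Re (agler_sum m \<psi> c ?a ?a - defect f ?a ?a) \<le> 1"
          using approx[of ?a ?a] True \<epsilon>(2) complex_Re_le_cmod[of "agler_sum m \<psi> c ?a ?a - defect f ?a ?a"] by simp
        then show ?thesis by simp
      qed
      also have "\<dots> \<le> (norm (snd ?a))\<^sup>2 + 1"
        by (simp add: defect_def cinner_self flip: of_real_power)
      finally have le: "(\<Sum>k<m. (cmod (c k ?a))\<^sup>2) \<le> ((norm (snd ?a))\<^sup>2 + 1) / \<delta> ?x"
        using \<delta>[of ?x] by (simp add: field_simps)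
      have "(\<Sum>k<m. (cmod (\<phi> k t))\<^sup>2) \<le> (\<Sum>k<m. (G (fst t))\<^sup>2 * (cmod (c k ?a))\<^sup>2)"
      proof (rule sum_mono)
        fix k assume "k \<in> {..<m}"
        then have "(cmod (fst t (\<psi> k)))\<^sup>2 \<le> (G (fst t))\<^sup>2"
          using G(2)[of "fst t" "\<psi> k"] \<psi> True by (intro power_mono) auto
        then show "(cmod (\<phi> k t))\<^sup>2 \<le> (G (fst t))\<^sup>2 * (cmod (c k ?a))\<^sup>2"
          using True by (simp add: \<phi>_def atom_value_def d_def scaleC_complex_def norm_mult power_mult_distrib mult_right_mono)
      qed
      also have "\<dots> \<le> B t"
        unfolding B_def sum_distrib_left[symmetric] by (intro mult_left_mono le) auto
      finally show ?thesis .
    qed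
    have "cmod (q p) \<le> B (fst p) + B (snd p)" for p
    proof -
      have "cmod (q p) \<le> (\<Sum>k<m. cmod (cinner (\<phi> k (fst p)) (\<phi> k (snd p))))"
        unfolding q_def by (rule norm_sum)
      also have "\<dots> \<le> (\<Sum>k<m. (cmod (\<phi> k (fst p)))\<^sup>2 + (cmod (\<phi> k (snd p)))\<^sup>2)"
      proof (rule sum_mono)
        fix k
        have "0 \<le> (cmod (\<phi> k (fst p)) - cmod (\<phi> k (snd p)))\<^sup>2 + (cmod (\<phi> k (fst p)))\<^sup>2 + (cmod (\<phi> k (snd p)))\<^sup>2"
          by simp
        then show "cmod (cinner (\<phi> k (fst p)) (\<phi> k (snd p))) \<le> (cmod (\<phi> k (fst p)))\<^sup>2 + (cmod (\<phi> k (snd p)))\<^sup>2"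
          by (simp add: cinner_complex_def norm_mult power2_diff)
      qed
      also have "\<dots> \<le> B (fst p) + B (snd p)"
        unfolding sum.distrib by (intro add_mono bound)
      finally show ?thesis .
    qed
    moreover have "q \<in> F i" if i: "i \<in> J" for i
    proof -
      have "cmod (eq q a b - defect f a b) \<le> snd i" if ab: "a \<in> fst i" "b \<in> fst i" for a b
      proof -
        have "a \<in> A" "b \<in> A" using ab i by (auto simp: A_def)
        then show ?thesis
          using approx[of a b] \<epsilon>(3)[OF i] by (simp add: eqq)
      qed
      then show ?thesis
        using module by (simp add: F_def case_prod_beta)
    qed
    ultimately show "{q. \<forall>p. cmod (q p) \<le> B (fst p) + B (snd p)} \<inter> (\<Inter>i\<in>J. F i) \<noteq> {}"
      by blast
  qed
  then obtain q where q: "\<And>i. i \<in> I \<Longrightarrow> q \<in> F i"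
    by blast
  show ?thesis
  proof (rule that[of "\<lambda>t s. q (t, s)"])
    show "module_kernel \<Psi> (\<lambda>t s. q (t, s))"
      using q[of "({}, 1)"] by (simp add: F_def I_def)
    fix a b :: "'x \<times> 'e"
    \<comment> \<open>For a fixed pair of points all precisions hold for the same q, so the equation
      is exact.\<close>
    have "cmod (eq q a b - defect f a b) \<le> \<epsilon>" if "\<epsilon> > 0" for \<epsilon>
      using q[of "({a, b}, \<epsilon>)"] that by (simp add: F_def I_def)
    then have "cmod (eq q a b - defect f a b) \<le> 0"
      by (rule field_le_epsilon[where y = 0, simplified])
    then show "q (unit_atom \<Psi> a, unit_atom \<Psi> b)
      - q (act \<Psi> (evaluation \<Psi> (fst a)) (unit_atom \<Psi> a), act \<Psi> (evaluation \<Psi> (fst b)) (unit_atom \<Psi> b)) = defect f a b"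
      by (simp add: eq_def)
  qed
qed

subsection \<open>Realization of Schur--Agler functions\<close>

lemma bounded_ops_cinner:
  assumes T: "T \<in> bounded_ops H K"
  shows "(\<lambda>v. cinner (T v) w) \<in> bounded_ops H (UNIV :: complex set)"
proof -
  obtain M where M: "M \<ge> 0" "\<And>x. x \<in> H \<Longrightarrow> norm (T x) \<le> M * norm x"
    using bounded_ops_bound[OF T] by blast
  show ?thesis
  proof (rule bounded_opsI)
    show "norm (cinner (T x) w) \<le> (M * norm w) * norm x" if "x \<in> H" for x
    proof -
      have "cmod (cinner (T x) w) \<le> norm (T x) * norm w" by (rule cinner_cmod_le)
      also have "\<dots> \<le> (M * norm x) * norm w" using M(2)[OF that] by (rule mult_right_mono) simp
      finally show ?thesis by (simp add: mult_ac)
    qed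
  qed (simp_all add: bounded_ops_add[OF T] bounded_ops_scaleC[OF T] cinner_add_left cinner_scaleC_left scaleC_complex_def)
qed

lemma adjoint_on_hspan:
  assumes T: "T \<in> bounded_ops (hspan A) (hspan A)" and S: "S \<in> bounded_ops (hspan A) (hspan A)"
    and base: "\<And>a b. a \<in> A \<Longrightarrow> b \<in> A \<Longrightarrow> cinner (T a) b = cinner a (S b)"
    and v: "v \<in> hspan A" and w: "w \<in> hspan A"
  shows "cinner (T v) w = cinner v (S w)"
proof -
  have left: "cinner (T v) b = cinner v (S b)" if b: "b \<in> A" for b
    by (rule bounded_ops_eq_on_hspan[OF bounded_ops_cinner[OF T] bounded_ops_cinner[OF bounded_ops_id] _ v])
      (rule base[OF _ b])
  have "cinner (S w) v = cinner w (T v)"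
  proof (rule bounded_ops_eq_on_hspan[OF bounded_ops_cinner[OF S] bounded_ops_cinner[OF bounded_ops_id] _ w])
    show "cinner (S b) v = cinner b (T v)" if "b \<in> A" for b
      using left[OF that] cinner_commute[of "S b" v] cinner_commute[of b "T v"] by simp
  qed
  then show ?thesis
    using cinner_commute[of v "S w"] cinner_commute[of "T v" w] by simp
qed

text \<open>Absorbs the number of a copy into the atoms, so that functions on countably many copies
  still fit into the index type of \<open>universe\<close>.\<close>

lemma countable_copies_inj:
  assumes "infinite (UNIV :: 'a set)"
  obtains i :: "nat \<times> 'a \<Rightarrow> 'a" where "inj i"
proof -
  include cardinal_syntax
  have "|UNIV :: nat set| \<le>o |UNIV :: 'a set|"
    using assms by (simp add: infinite_iff_card_of_nat)
  then have "|(UNIV :: nat set) \<times> (UNIV :: 'a set)| =o |UNIV :: 'a set|"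
    using card_of_Times_infinite[of "UNIV :: 'a set" "UNIV :: nat set"] assms by auto
  then have "|UNIV :: (nat \<times> 'a) set| \<le>o |UNIV :: 'a set|"
    by (simp add: ordIso_iff_ordLeq)
  then show ?thesis
    using that unfolding card_of_ordLeq[symmetric] by auto
qed

text \<open>The decomposition says that v and w have equal Gram matrices, which gives an isometry V
  on the span of v only. V takes values in E plus copy 0 of the module, while R embeds all of E + H
  into the copies from 1 on. So V on the span and R on its orthogonal complement combine to an
  isometry of E + H.\<close>

lemma schur_agler_realization:
  fixes f :: "'x \<Rightarrow> 'e::chilbert \<Rightarrow> 'e"
  assumes \<Psi>: "\<Psi> \<noteq> {}" "test_functions \<Psi>" and f: "f \<in> schur_agler_class \<Psi>"
  shows "\<exists>(H :: ('x, 'e) universe set) \<rho> U. realization \<Psi> H \<rho> U f"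
proof -
  obtain q where q: "module_kernel \<Psi> q"
    and eq: "\<And>a b. q (unit_atom \<Psi> a) (unit_atom \<Psi> b)
      - q (act \<Psi> (evaluation \<Psi> (fst a)) (unit_atom \<Psi> a)) (act \<Psi> (evaluation \<Psi> (fst b)) (unit_atom \<Psi> b)) = defect f a b"
    using agler_decomposition[OF \<Psi> f] by metis
  obtain \<psi>0 where \<psi>0: "\<psi>0 \<in> \<Psi>" using \<Psi>(1) by blast
  obtain x0 :: 'x where True by blast
  \<comment> \<open>A module whose unit atoms have the inner products of E, with functions acting
    through their value at the single point \<psi>0; it places a copy of E inside H.\<close>
  define qE where "qE t s = (\<Sum>k\<in>{()}. cinner (atom_value \<Psi> t \<psi>0 *\<^sub>C snd (snd t)) (atom_value \<Psi> s \<psi>0 *\<^sub>C snd (snd s)))"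
    for t s :: "('x, 'x \<times> 'e) atom"
  have qE: "module_kernel \<Psi> qE"
    unfolding qE_def[abs_def]
    by (rule module_kernel_point_evaluations[where \<psi> = "\<lambda>_. \<psi>0" and d = "\<lambda>_. snd"]) (simp_all add: \<psi>0)
  \<comment> \<open>Copy 0 carries the decomposition and copy 1 receives E; the period 2 makes a
    shift by two copies isometric.\<close>
  define k where "k n = (if even n then q else qE)" for n :: nat
  have k: "module_kernel \<Psi> (k n)" for n
    by (simp add: k_def q qE)
  define Q where "Q p r = (if fst p = fst r then k (fst p) (snd p) (snd r) else 0)"
    for p r :: "nat \<times> ('x, 'x \<times> 'e) atom"
  have "psd Q"
    unfolding Q_def[abs_def] by (rule psd_direct_sum) (rule module_kernel_psd[OF k])
  have "infinite (UNIV :: (('x, 'x \<times> 'e) atom) set)"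
  proof
    assume fin: "finite (UNIV :: (('x, 'x \<times> 'e) atom) set)"
    have "inj (\<lambda>c :: complex. ((\<lambda>_. c) :: ('x \<Rightarrow> complex) \<Rightarrow> complex, x0, 0 :: 'e))"
      by (auto intro!: injI dest: fun_cong)
    then have "finite (UNIV :: complex set)"
      using fin by (metis finite_imageD finite_subset subset_UNIV)
    then show False
      using infinite_UNIV_char_0 by blast
  qed
  then obtain \<iota> :: "nat \<times> ('x, 'x \<times> 'e) atom \<Rightarrow> ('x, 'x \<times> 'e) atom" where \<iota>: "inj \<iota>"
    by (rule countable_copies_inj)
  \<comment> \<open>The copy number has been absorbed by \<iota>, so the natural number in the index
    stays at 0.\<close>
  define code where "code h = (0 :: nat, \<lambda>t. h (inv \<iota> t))"
    for h :: "nat \<times> ('x, 'x \<times> 'e) atom \<Rightarrow> complex"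
  have "inj code"
  proof (rule injI)
    fix g h assume "code g = code h"
    then have "g (inv \<iota> (\<iota> p)) = h (inv \<iota> (\<iota> p))" for p
      unfolding code_def prod.inject by metis
    then show "g = h"
      by (simp add: \<iota> fun_eq_iff)
  qed
  obtain \<gamma> :: "_ \<Rightarrow> ('x, 'e) universe" where \<gamma>Q: "\<And>p r. cinner (\<gamma> p) (\<gamma> r) = Q p r"
    using kolmogorov_decomposition[OF \<open>psd Q\<close> \<open>inj code\<close>] by metis
  define H where "H = hspan (range \<gamma>)"
  have H: "hilbert_space H" by (simp add: H_def)
  have \<gamma>: "cinner (\<gamma> (n, t)) (\<gamma> (m, s)) = (if n = m then k n t s else 0)" for n m t s
    by (simp add: \<gamma>Q Q_def)
  have \<gamma>H: "\<gamma> p \<in> H" for p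
    unfolding H_def by (rule hspan_base) simp
  \<comment> \<open>The module laws are identities between values of the kernels, so vectors are
    compared by pairing with generators.\<close>
  have H_eqI: "v = w" if "v \<in> H" "w \<in> H" "\<And>n s. cinner v (\<gamma> (n, s)) = cinner w (\<gamma> (n, s))" for v w
    by (rule hspan_eqI[of v "range \<gamma>"]) (use that in \<open>auto simp: H_def\<close>)

  have "\<exists>T. T \<in> bounded_ops H H \<and> (\<forall>n t. T (\<gamma> (n, t)) = \<gamma> (n, act \<Psi> u t))" if u: "u \<in> Cb \<Psi>" for u
  proof -
    obtain m where m: "m \<ge> 0" "\<And>\<psi>. \<psi> \<in> \<Psi> \<Longrightarrow> cmod (u \<psi>) \<le> m"
      using Cb_bound[OF u] by metis
    have "psd (\<lambda>p r. if fst p = fst r then complex_of_real (m\<^sup>2) * k (fst p) (snd p) (snd r)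
        - k (fst p) (act \<Psi> u (snd p)) (act \<Psi> u (snd r)) else 0)"
      by (rule psd_direct_sum[of "\<lambda>n t s. complex_of_real (m\<^sup>2) * k n t s - k n (act \<Psi> u t) (act \<Psi> u s)"])
        (rule module_kernel_bound[OF k u m])
    moreover have "(if fst p = fst r then complex_of_real (m\<^sup>2) * k (fst p) (snd p) (snd r)
        - k (fst p) (act \<Psi> u (snd p)) (act \<Psi> u (snd r)) else 0)
      = complex_of_real (m\<^sup>2) * cinner (\<gamma> p) (\<gamma> r) - cinner (\<gamma> (fst p, act \<Psi> u (snd p))) (\<gamma> (fst r, act \<Psi> u (snd r)))" for p r
      by (simp add: \<gamma>Q Q_def)
    ultimately have p: "psd (\<lambda>p r. complex_of_real (m\<^sup>2) * cinner (\<gamma> p) (\<gamma> r)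
        - cinner (\<gamma> (fst p, act \<Psi> u (snd p))) (\<gamma> (fst r, act \<Psi> u (snd r))))"
      by simp
    obtain T where T: "T \<in> bounded_ops (hspan (range \<gamma>)) (hspan (range (\<lambda>p. \<gamma> (fst p, act \<Psi> u (snd p)))))"
      "\<And>p. T (\<gamma> p) = \<gamma> (fst p, act \<Psi> u (snd p))"
      by (rule extend_bounded[OF m(1) p]) (rule that)
    have "hspan (range (\<lambda>p. \<gamma> (fst p, act \<Psi> u (snd p)))) \<subseteq> H"
      unfolding H_def by (rule hspan_mono) auto
    then have "T \<in> bounded_ops H H"
      using T(1) bounded_ops_mono unfolding H_def by blast
    then show ?thesis
      using T(2) by (intro exI[of _ T]) simp
  qed
  then have "\<forall>u. \<exists>T. u \<in> Cb \<Psi> \<longrightarrow> T \<in> bounded_ops H H \<and> (\<forall>n t. T (\<gamma> (n, t)) = \<gamma> (n, act \<Psi> u t))"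
    by blast
  from choice[OF this] obtain \<rho> where \<rho>: "\<And>u. u \<in> Cb \<Psi> \<Longrightarrow> \<rho> u \<in> bounded_ops H H"
    "\<And>u n t. u \<in> Cb \<Psi> \<Longrightarrow> \<rho> u (\<gamma> (n, t)) = \<gamma> (n, act \<Psi> u t)"
    by blast
  have rho_eq: "T v = S v" if "T \<in> bounded_ops H H" "S \<in> bounded_ops H H" "v \<in> H"
    "\<And>n t. T (\<gamma> (n, t)) = S (\<gamma> (n, t))" for T S v
    by (rule bounded_ops_eq_on_hspan[OF that(1,2)[unfolded H_def] _ that(3)[unfolded H_def]]) (use that(4) in auto)
  have "unital_star_rep \<Psi> H \<rho>"
  proof (rule unital_star_repI[OF H \<rho>(1)])
    show "\<rho> (\<lambda>\<psi>\<in>\<Psi>. 1) v = v" if v: "v \<in> H" for v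
    proof (rule rho_eq[OF \<rho>(1)[OF Cb_const] bounded_ops_id v])
      show "\<rho> (\<lambda>\<psi>\<in>\<Psi>. 1) (\<gamma> (n, t)) = \<gamma> (n, t)" for n t
        by (rule H_eqI) (simp_all add: module_kernel_one[OF k] \<rho>(2) Cb_const \<gamma>H \<gamma>)
    qed
    show "\<rho> (\<lambda>\<psi>\<in>\<Psi>. u \<psi> + w \<psi>) v = \<rho> u v + \<rho> w v" if uw: "u \<in> Cb \<Psi>" "w \<in> Cb \<Psi>" and v: "v \<in> H" for u w v
    proof (rule rho_eq[OF \<rho>(1)[OF Cb_add[OF uw]] bounded_ops_add_op[OF \<rho>(1)[OF uw(1)] \<rho>(1)[OF uw(2)] H] v])
      show "\<rho> (\<lambda>\<psi>\<in>\<Psi>. u \<psi> + w \<psi>) (\<gamma> (n, t)) = \<rho> u (\<gamma> (n, t)) + \<rho> w (\<gamma> (n, t))" for n t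
        by (rule H_eqI) (simp_all add: module_kernel_add[OF k] uw \<rho>(2) Cb_add \<gamma>H \<gamma>
            hilbert_space_add[OF H] cinner_add_left)
    qed
    show "\<rho> (\<lambda>\<psi>\<in>\<Psi>. c * u \<psi>) v = c *\<^sub>C \<rho> u v" if u: "u \<in> Cb \<Psi>" and v: "v \<in> H" for c u v
    proof (rule rho_eq[OF \<rho>(1)[OF Cb_scale[OF u]] bounded_ops_scaleC_op[OF \<rho>(1)[OF u] H] v])
      show "\<rho> (\<lambda>\<psi>\<in>\<Psi>. c * u \<psi>) (\<gamma> (n, t)) = c *\<^sub>C \<rho> u (\<gamma> (n, t))" for n t
        by (rule H_eqI) (simp_all add: module_kernel_scale[OF k] u \<rho>(2) Cb_scale \<gamma>H \<gamma>
            hilbert_space_scaleC[OF H] cinner_scaleC_left)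
    qed
    show "\<rho> (\<lambda>\<psi>\<in>\<Psi>. u \<psi> * w \<psi>) v = \<rho> u (\<rho> w v)" if uw: "u \<in> Cb \<Psi>" "w \<in> Cb \<Psi>" and v: "v \<in> H" for u w v
    proof (rule rho_eq[OF \<rho>(1)[OF Cb_mult[OF uw]] bounded_ops_comp[OF \<rho>(1)[OF uw(2)] \<rho>(1)[OF uw(1)]] v])
      show "\<rho> (\<lambda>\<psi>\<in>\<Psi>. u \<psi> * w \<psi>) (\<gamma> (n, t)) = \<rho> u (\<rho> w (\<gamma> (n, t)))" for n t
        by (rule H_eqI) (simp_all add: module_kernel_mult[OF k] uw \<rho>(2) Cb_mult \<gamma>H \<gamma>)
    qed
    show "cinner (\<rho> u v) w = cinner v (\<rho> (\<lambda>\<psi>\<in>\<Psi>. cnj (u \<psi>)) w)" if u: "u \<in> Cb \<Psi>" and vw: "v \<in> H" "w \<in> H" for u v w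
    proof (rule adjoint_on_hspan[OF \<rho>(1)[OF u, unfolded H_def] \<rho>(1)[OF Cb_cnj[OF u], unfolded H_def] _ vw[unfolded H_def]])
      have "k n (act \<Psi> u t) s = k n t (act \<Psi> (\<lambda>\<psi>\<in>\<Psi>. cnj (u \<psi>)) s)" for n t s
        by (rule module_kernel_star[OF k u])
      then have "cinner (\<rho> u (\<gamma> (n, t))) (\<gamma> (m, s)) = cinner (\<gamma> (n, t)) (\<rho> (\<lambda>\<psi>\<in>\<Psi>. cnj (u \<psi>)) (\<gamma> (m, s)))" for n t m s
        by (simp add: \<rho>(2) Cb_cnj u \<gamma>)
      then show "cinner (\<rho> u a) b = cinner a (\<rho> (\<lambda>\<psi>\<in>\<Psi>. cnj (u \<psi>)) b)" if "a \<in> range \<gamma>" "b \<in> range \<gamma>" for a b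
        using that by auto
    qed
  qed
  then have star: "star_rep \<Psi> H \<rho>"
    by (intro star_rep.intro H)

  \<comment> \<open>Inputs and outputs of the colligation to be built, for a = (x, e): the unit atom
    at a in copy 0 is to be the state for the input e at x.\<close>
  define v where "v a = (snd a, \<gamma> (0, act \<Psi> (evaluation \<Psi> (fst a)) (unit_atom \<Psi> a)))" for a
  define w where "w a = (f (fst a) (snd a), \<gamma> (0, unit_atom \<Psi> a))" for a
  have gram: "cinner (w a) (w b) = cinner (v a) (v b)" for a b
    using eq[of a b] by (simp add: v_def w_def cinner_Pair \<gamma> k_def defect_def algebra_simps)
  obtain V where V: "V \<in> bounded_ops (hspan (range v)) (hspan (range w))" "\<And>a. V (v a) = w a"
    "\<And>x y. x \<in> hspan (range v) \<Longrightarrow> y \<in> hspan (range v) \<Longrightarrow> cinner (V x) (V y) = cinner x y"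
    by (rule extend_isometry[of w v, OF gram]) (rule that)
  define rv where "rv i = (case i of Inl e \<Rightarrow> (e :: 'e, 0) | Inr p \<Rightarrow> (0, \<gamma> p))" for i
  \<comment> \<open>E moves into copy 1 and copy n into copy n + 2, of the same parity; copy 0 stays
    free for the range of V.\<close>
  define rw where "rw i = (case i of Inl e \<Rightarrow> (0 :: 'e, \<gamma> (1, unit_atom \<Psi> (x0, e))) | Inr p \<Rightarrow> (0, \<gamma> (fst p + 2, snd p)))" for i
  have "cinner (rw i) (rw j) = cinner (rv i) (rv j)" for i j
    by (auto simp: rw_def rv_def cinner_Pair \<gamma> k_def qE_def atom_value_unit_atom \<psi>0 split: sum.splits)
  then obtain R where R: "R \<in> bounded_ops (hspan (range rv)) (hspan (range rw))"
    "\<And>i. R (rv i) = rw i"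
    "\<And>x y. x \<in> hspan (range rv) \<Longrightarrow> y \<in> hspan (range rv) \<Longrightarrow> cinner (R x) (R y) = cinner x y"
    by (rule extend_isometry) (rule that)
  have UH: "hilbert_space ((UNIV :: 'e set) \<times> H)"
    by (intro hilbert_space_Times hilbert_space_UNIV H)
  have sub: "hspan (range v) \<subseteq> UNIV \<times> H" "hspan (range w) \<subseteq> UNIV \<times> H" "hspan (range rw) \<subseteq> UNIV \<times> H"
    by (rule hspan_minimal[OF UH]; auto simp: v_def w_def rw_def \<gamma>H split: sum.splits)+
  have dom: "hspan (range rv) = UNIV \<times> H"
  proof
    show "hspan (range rv) \<subseteq> UNIV \<times> H"
      by (rule hspan_minimal[OF UH]) (auto simp: rv_def \<gamma>H hilbert_space_zero[OF H] split: sum.splits)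
    have "H \<subseteq> {h \<in> UNIV. (0, h) \<in> hspan (range rv)}"
      unfolding H_def
    proof (rule hspan_minimal)
      show "hilbert_space {h \<in> UNIV. (0 :: 'e, h) \<in> hspan (range rv)}"
        by (rule hilbert_space_vimage[OF bounded_ops_inr[OF hilbert_space_UNIV] hilbert_space_UNIV hilbert_space_hspan])
      have "rv (Inr p) \<in> hspan (range rv)" for p by (rule hspan_base) simp
      then show "range \<gamma> \<subseteq> {h \<in> UNIV. (0, h) \<in> hspan (range rv)}"
        by (auto simp: rv_def)
    qed
    then have "(e, h) \<in> hspan (range rv)" if "h \<in> H" for e h
    proof -
      have "rv (Inl e) \<in> hspan (range rv)" by (rule hspan_base) simp
      moreover have "(0, h) \<in> hspan (range rv)"
        using \<open>H \<subseteq> _\<close> that by blast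
      ultimately have "rv (Inl e) + (0, h) \<in> hspan (range rv)"
        by (rule hilbert_space_add[OF hilbert_space_hspan])
      then show ?thesis by (simp add: rv_def)
    qed
    then show "UNIV \<times> H \<subseteq> hspan (range rv)" by auto
  qed
  \<comment> \<open>The state part of w lies in copy 0, whereas rw has no E-component and uses only
    copies from 1 on.\<close>
  have orth: "cinner a b = 0" if "a \<in> hspan (range w)" "b \<in> hspan (range rw)" for a b
    by (rule hspan_ortho[OF that]) (auto simp: w_def rw_def cinner_Pair \<gamma> split: sum.splits)
  let ?M = "hspan (range v)"
  define U where "U p = V (proj ?M p) + R (p - proj ?M p)" for p
  note P = proj_bounded_ops[OF hilbert_space_hspan, of "range v"]
  have PM: "proj ?M \<in> bounded_ops (UNIV \<times> H) ?M"
    by (rule bounded_ops_mono[OF P]) auto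
  have PU: "proj ?M \<in> bounded_ops (UNIV \<times> H) (UNIV \<times> H)"
    by (rule bounded_ops_mono[OF P _ sub(1)]) auto
  have iso: "isometric_op (UNIV \<times> H) (UNIV \<times> H) U"
  proof (rule isometric_opI)
    have "V \<in> bounded_ops ?M (UNIV \<times> H)"
      by (rule bounded_ops_mono[OF V(1) order_refl sub(2)])
    moreover have "R \<in> bounded_ops (UNIV \<times> H) (UNIV \<times> H)"
      using bounded_ops_mono[OF R(1) order_refl sub(3)] by (simp add: dom)
    ultimately show "U \<in> bounded_ops (UNIV \<times> H) (UNIV \<times> H)"
      unfolding U_def[abs_def]
      by (intro bounded_ops_add_op UH bounded_ops_comp[OF PM] bounded_ops_comp[OF bounded_ops_diff_op[OF bounded_ops_id PU UH]])
    fix p assume p: "p \<in> (UNIV :: 'e set) \<times> H"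
    let ?a = "proj ?M p" and ?b = "p - proj ?M p"
    have a: "?a \<in> ?M" by (rule proj_mem) simp
    have b: "?b \<in> hspan (range rv)"
      unfolding dom by (rule hilbert_space_diff[OF UH p]) (use a sub(1) in blast)
    have VR: "cinner (V ?a) (R ?b) = 0"
      by (rule orth[OF bounded_ops_mem[OF V(1) a] bounded_ops_mem[OF R(1) b]])
    have ba: "cinner ?b ?a = 0"
      by (rule proj_ortho[OF hilbert_space_hspan a])
    have "cinner (U p) (U p) = cinner (V ?a) (V ?a) + cinner (R ?b) (R ?b)"
      using VR cinner_swap_zero[of "V ?a" "R ?b"] by (simp add: U_def cinner_add_left cinner_add_right)
    also have "\<dots> = cinner ?a ?a + cinner ?b ?b"
      by (simp only: V(3)[OF a a] R(3)[OF b b])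
    also have "\<dots> = cinner (?a + ?b) (?a + ?b)"
      unfolding cinner_add_left cinner_add_right using ba cinner_swap_zero[of ?a ?b] by simp
    finally show "cinner (U p) (U p) = cinner p p" by simp
  qed
  \<comment> \<open>On the vectors v the projection is the identity and R contributes 0, so U acts
    as V and the unit atom solves the state equation.\<close>
  have "U (e, \<rho> (evaluation \<Psi> x) (\<gamma> (0, unit_atom \<Psi> (x, e)))) = (f x e, \<gamma> (0, unit_atom \<Psi> (x, e)))" for x e
  proof -
    have "(e, \<rho> (evaluation \<Psi> x) (\<gamma> (0, unit_atom \<Psi> (x, e)))) = v (x, e)"
      by (simp add: v_def \<rho>(2) evaluation_Cb[OF \<Psi>(2)])
    moreover have "proj ?M (v (x, e)) = v (x, e)"
      by (rule proj_eqI) (auto intro: hspan_base)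
    moreover have "R 0 = 0"
      by (rule bounded_ops_zero[OF R(1) hilbert_space_hspan])
    ultimately show ?thesis
      by (simp add: U_def V(2)) (simp add: w_def)
  qed
  then have "realization \<Psi> H \<rho> U f"
    unfolding realization_def using star iso \<gamma>H by blast
  then show ?thesis by blast
qed

section \<open>Equivalence of factorization and block realization\<close>

theorem theorem3p4:
  fixes \<Psi> :: "('x \<Rightarrow> complex) set" and x0 :: 'x and \<theta> :: "'x \<Rightarrow> 'e::chilbert \<Rightarrow> 'e"
  assumes "\<Psi> \<noteq> {}" and "test_functions \<Psi>" and "evaluation \<Psi> x0 = (\<lambda>\<psi>\<in>\<Psi>. 0)"
    and "\<theta> \<in> schur_agler_class \<Psi>"
  shows "((\<exists>\<psi>1\<in>schur_agler_class \<Psi>. \<exists>\<psi>2\<in>schur_agler_class \<Psi>. \<forall>x. \<theta> x = \<psi>1 x \<circ> \<psi>2 x) \<longleftrightarrow>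
      (\<exists>(H1 :: ('x, 'e) universe set) (H2 :: ('x, 'e) universe set).
        hilbert_space H1 \<and> hilbert_space H2 \<and> block_realization \<Psi> x0 \<theta> H1 H2)) \<and>
    ((\<exists>(H1 :: 'h1::chilbert set) (H2 :: 'h2::chilbert set).
        hilbert_space H1 \<and> hilbert_space H2 \<and> block_realization \<Psi> x0 \<theta> H1 H2) \<longrightarrow>
      (\<exists>\<psi>1\<in>schur_agler_class \<Psi>. \<exists>\<psi>2\<in>schur_agler_class \<Psi>. \<forall>x. \<theta> x = \<psi>1 x \<circ> \<psi>2 x))"
proof (intro conjI iffI impI; (elim exE conjE bexE)?)
  fix f1 f2 :: "'x \<Rightarrow> 'e \<Rightarrow> 'e"
  assume f: "f1 \<in> schur_agler_class \<Psi>" "f2 \<in> schur_agler_class \<Psi>" and \<theta>: "\<forall>x. \<theta> x = f1 x \<circ> f2 x"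
  obtain H1 :: "('x, 'e) universe set" and \<rho>1 U1 where r1: "realization \<Psi> H1 \<rho>1 U1 f1"
    using schur_agler_realization[OF assms(1,2) f(1)] by blast
  obtain H2 :: "('x, 'e) universe set" and \<rho>2 U2 where r2: "realization \<Psi> H2 \<rho>2 U2 f2"
    using schur_agler_realization[OF assms(1,2) f(2)] by blast
  have "block_realization \<Psi> x0 \<theta> H1 H2"
    by (rule factor_block_realization[OF assms(2,3) r1 r2]) (use \<theta> in blast)
  moreover have "hilbert_space H1" "hilbert_space H2"
    using r1 r2 by (simp_all add: realization_def star_rep_def)
  ultimately show "\<exists>(H1 :: ('x, 'e) universe set) (H2 :: ('x, 'e) universe set).
      hilbert_space H1 \<and> hilbert_space H2 \<and> block_realization \<Psi> x0 \<theta> H1 H2"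
    by blast
\<comment> \<open>The two remaining goals are one implication, for spaces in the universe and for
  spaces of arbitrary types.\<close>
qed (rule block_realization_factor[OF assms(2)]; assumption)+

end
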